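(* Let $\mathcal C$ be a strict monoidal category with coequalizers, $A$ an algebra in $\mathcal C$, $\mathcal D$ a right $\mathcal C$-category with coequalizers, and $X$ an object of $\mathcal C$. Suppose that $A$ and $X$ are (left) $\mathcal D$-coflat and left coflat objects of $\mathcal C$. Then $A\otimes X$, with left $A$-module structure $m_A\otimes \mathrm{Id}_X$, has an $A$-ring (respectively $A$-coring) structure in $\mathcal C$ compatible with $\mathcal D$ if and only if $X$ has an algebra (respectively coalgebra) structure in the monoidal category $EM(\mathcal C)(A)$ (that is, there exists a morphism $\psi: X\otimes A\to A\otimes X$ such that $(X,\psi)$ is an object of $EM(\mathcal C)(A)$ which carries an algebra, respectively coalgebra, structure in $EM(\mathcal C)(A)$).
   Context: Identity morphisms in composites are denoted by the object. $m_A,\eta_A$ denote multiplication and unit of $A$. Right $\mathcal C$-category (taken strict): a category $\mathcal D$ with a functor $\diamond:\mathcal D\times\mathcal C\to\mathcal D$ with $(M\diamond X)\diamond Y=M\diamond(X\otimes Y)$ and $M\diamond\underline 1=M$. A right module in $\mathcal D$ over $A$ is $M\in\mathcal D$ with an associative and unital action $\nu_M:M\diamond A\to M$; they form the category $\mathcal D_A$. For $M\in\mathcal D_A$ and a left $A$-module $Y$ in $\mathcal C$, $M\diamond_A Y$ is the coequalizer in $\mathcal D$ of the two morphisms $M\diamond A\diamond Y\rightrightarrows M\diamond Y$ induced by the actions; for $\mathcal D=\mathcal C$, $\diamond=\otimes$ one writes $\otimes_A$. An object $X\in \mathcal C$ is $\mathcal D$-coflat if $-\diamond X:\mathcal D\to\mathcal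 D$ preserves coequalizers, and left coflat if $-\otimes X:\mathcal C\to\mathcal C$ does. A left $A$-module $Y$ is $\mathcal D$-robust if for all $M\in\mathcal D$ and $Z\in\mathcal C_A$ the canonical morphism $(M\diamond Z)\diamond_A Y\to M\diamond(Z\otimes_A Y)$ is an isomorphism, and left robust if this holds for $\mathcal D=\mathcal C$. If $A$ is left coflat and $\mathcal D$-coflat, the category ${}^{\mathcal D!}_A\mathcal C_A$ of $A$-bimodules in $\mathcal C$ which are left coflat, $\mathcal D$-coflat, left robust and $\mathcal D$-robust is monoidal with tensor product $\otimes_A$ and unit $A$. An $A$-ring (resp. $A$-coring) in $\mathcal C$ compatible with $\mathcal D$ is an algebra (resp. coalgebra) in ${}^{\mathcal D!}_A\mathcal C_A$. The monoidal category $EM(\mathcal C)(A)$: objects are pairs $(X,\psi)$ with $X\in\mathcal C$ and $\psi:X\otimes A\to A\otimes X$ satisfying $\psi(X\otimes m_A)=(m_A\otimes X)(A\otimes\psi)(\psi\otimes A)$ and $\psi(X\otimes\eta_A)=\eta_A\otimes X$. A morphism $\rho:(X,\psi)\to(Y,\phi)$ is a morphism $\rho:X\to A\otimes Y$ in $\mathcal C$ with $(m_A\otimes Y)(A\otimes\rho)\psi=(m_A\otimes Y)(A\otimes\phi)(\rho\otimes A)$. The composite of $\rho:(X,\psi)\to(Y,\phi)$ and $\rho':(Y,\phi)\to(Z,\gamma)$ is $(m_A\otimes Z)(A\otimes\rho')\rho$; the identity of $(X,\psi)$ is $\eta_A\otimes X$. Tensor product: $(X,\psi)\underline\otimes(Y,\phi)=(X\otimes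 Y,(\psi\otimes Y)(X\otimes\phi))$; for $\rho:(X,\psi)\to(X',\psi')$ and $\rho':(Y,\phi)\to(Y',\phi')$, $\rho\underline\otimes\rho'=(m_A\otimes X'\otimes Y')(A\otimes\psi'\otimes Y')(\rho\otimes\rho')$. The unit object is $(\underline 1,\mathrm{Id}_A)$. *)

theory Defs
  imports Main
begin

section \<open>Categories\<close>

record ('o, 'm) cat =
  Obj :: "'o set"
  Arr :: "'m set"
  Dom :: "'m \<Rightarrow> 'o"
  Cod :: "'m \<Rightarrow> 'o"
  Ide :: "'o \<Rightarrow> 'm"
  Comp :: "'m \<Rightarrow> 'm \<Rightarrow> 'm" (infixr "\<cdot>\<index>" 55)

definition Hom :: "('o, 'm, 'z) cat_scheme \<Rightarrow> 'o \<Rightarrow> 'o \<Rightarrow> 'm set" where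
  "Hom C a b = {f \<in> Arr C. Dom C f = a \<and> Cod C f = b}"

locale category =
  fixes C :: "('o, 'm, 'z) cat_scheme" (structure)
  assumes Dom_Obj: "f \<in> Arr C \<Longrightarrow> Dom C f \<in> Obj C"
    and Cod_Obj: "f \<in> Arr C \<Longrightarrow> Cod C f \<in> Obj C"
    and Ide_Hom: "a \<in> Obj C \<Longrightarrow> Ide C a \<in> Hom C a a"
    and Comp_Hom: "\<lbrakk>f \<in> Hom C a b; g \<in> Hom C b c\<rbrakk> \<Longrightarrow> g \<cdot> f \<in> Hom C a c"
    and Comp_Ide: "f \<in> Hom C a b \<Longrightarrow> f \<cdot> Ide C a = f"
    and Ide_Comp: "f \<in> Hom C a b \<Longrightarrow> Ide C b \<cdot> f = f"
    and Comp_assoc: "\<lbrakk>f \<in> Hom C a b; g \<in> Hom C b c; h \<in> Hom C c d\<rbrakk>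
      \<Longrightarrow> (h \<cdot> g) \<cdot> f = h \<cdot> (g \<cdot> f)"

definition iso :: "('o, 'm, 'z) cat_scheme \<Rightarrow> 'm \<Rightarrow> bool" where
  "iso C f \<longleftrightarrow> f \<in> Arr C \<and>
    (\<exists>g \<in> Hom C (Cod C f) (Dom C f).
      g \<cdot>\<^bsub>C\<^esub> f = Ide C (Dom C f) \<and> f \<cdot>\<^bsub>C\<^esub> g = Ide C (Cod C f))"

definition coequalizer :: "('o, 'm, 'z) cat_scheme \<Rightarrow> 'm \<Rightarrow> 'm \<Rightarrow> 'm \<Rightarrow> bool" where
  "coequalizer C f g q \<longleftrightarrow>
    f \<in> Arr C \<and> g \<in> Hom C (Dom C f) (Cod C f) \<and>
    q \<in> Arr C \<and> Dom C q = Cod C f \<and> q \<cdot>\<^bsub>C\<^esub> f = q \<cdot>\<^bsub>C\<^esub> g \<and>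
    (\<forall>h \<in> Arr C. Dom C h = Cod C f \<and> h \<cdot>\<^bsub>C\<^esub> f = h \<cdot>\<^bsub>C\<^esub> g \<longrightarrow>
      (\<exists>!k. k \<in> Hom C (Cod C q) (Cod C h) \<and> k \<cdot>\<^bsub>C\<^esub> q = h))"

definition has_coequalizers :: "('o, 'm, 'z) cat_scheme \<Rightarrow> bool" where
  "has_coequalizers C \<longleftrightarrow>
    (\<forall>a b. \<forall>f \<in> Hom C a b. \<forall>g \<in> Hom C a b. \<exists>q. coequalizer C f g q)"

text \<open>A fixed choice of coequalizers; \<open>coeq C f g\<close> is the projection, its codomain the
  coequalizer object.\<close>

definition coeq :: "('o, 'm, 'z) cat_scheme \<Rightarrow> 'm \<Rightarrow> 'm \<Rightarrow> 'm" where
  "coeq C f g = (SOME q. coequalizer C f g q)"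

text \<open>The morphism induced by \<open>h\<close> along \<open>q\<close>. It is only used where \<open>q\<close> is a coequalizer, or a
  composite of two such, through which \<open>h\<close> factors, so that it exists and is unique.\<close>

definition induced :: "('o, 'm, 'z) cat_scheme \<Rightarrow> 'm \<Rightarrow> 'm \<Rightarrow> 'm" where
  "induced C q h = (THE k. k \<in> Hom C (Cod C q) (Cod C h) \<and> k \<cdot>\<^bsub>C\<^esub> q = h)"

text \<open>Functors \<open>B \<times> C \<rightarrow> E\<close>, given by their object part and their arrow part.\<close>

locale bifunctor = B: category B + C: category C + E: category E
  for B :: "('a, 'b, 'z1) cat_scheme" and C :: "('o, 'm, 'z2) cat_scheme"
    and E :: "('p, 'q, 'z3) cat_scheme"
    and FO :: "'a \<Rightarrow> 'o \<Rightarrow> 'p" and FM :: "'b \<Rightarrow> 'm \<Rightarrow> 'q" +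
  assumes FO_Obj: "\<lbrakk>a \<in> Obj B; x \<in> Obj C\<rbrakk> \<Longrightarrow> FO a x \<in> Obj E"
    and FM_Hom: "\<lbrakk>f \<in> Hom B a b; g \<in> Hom C x y\<rbrakk> \<Longrightarrow> FM f g \<in> Hom E (FO a x) (FO b y)"
    and FM_Ide: "\<lbrakk>a \<in> Obj B; x \<in> Obj C\<rbrakk> \<Longrightarrow> FM (Ide B a) (Ide C x) = Ide E (FO a x)"
    and FM_Comp: "\<lbrakk>f \<in> Hom B a b; f' \<in> Hom B b c; g \<in> Hom C x y; g' \<in> Hom C y z\<rbrakk>
      \<Longrightarrow> FM (f' \<cdot>\<^bsub>B\<^esub> f) (g' \<cdot>\<^bsub>C\<^esub> g) = FM f' g' \<cdot>\<^bsub>E\<^esub> FM f g"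


section \<open>Monoidal categories, algebras and coalgebras\<close>

text \<open>Tensor product of objects is written \<open>\<odot>\<close>, of arrows \<open>\<otimes>\<close>. The associativity constraint
  \<open>Assoc X Y Z\<close> goes from \<open>(X \<odot> Y) \<odot> Z\<close> to \<open>X \<odot> (Y \<odot> Z)\<close>, and \<open>LUnit X\<close>, \<open>RUnit X\<close> go from
  \<open>\<one> \<odot> X\<close>, \<open>X \<odot> \<one>\<close> to \<open>X\<close>. The constraints are part of the data because tensoring over an
  algebra is not strict.\<close>

record ('o, 'm) moncat = "('o, 'm) cat" +
  Unit :: "'o" ("\<one>\<index>")
  TensO :: "'o \<Rightarrow> 'o \<Rightarrow> 'o" (infixr "\<odot>\<index>" 72)
  TensM :: "'m \<Rightarrow> 'm \<Rightarrow> 'm" (infixr "\<otimes>\<index>" 70)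
  Assoc :: "'o \<Rightarrow> 'o \<Rightarrow> 'o \<Rightarrow> 'm"
  LUnit :: "'o \<Rightarrow> 'm"
  RUnit :: "'o \<Rightarrow> 'm"

locale strict_monoidal_category = bifunctor C C C "TensO C" "TensM C"
  for C :: "('o, 'm) moncat" (structure) +
  assumes Unit_Obj: "\<one> \<in> Obj C"
    and TensO_assoc: "\<lbrakk>X \<in> Obj C; Y \<in> Obj C; Z \<in> Obj C\<rbrakk> \<Longrightarrow> (X \<odot> Y) \<odot> Z = X \<odot> (Y \<odot> Z)"
    and TensM_assoc: "\<lbrakk>f \<in> Arr C; g \<in> Arr C; h \<in> Arr C\<rbrakk> \<Longrightarrow> (f \<otimes> g) \<otimes> h = f \<otimes> (g \<otimes> h)"
    and TensO_LUnit: "X \<in> Obj C \<Longrightarrow> \<one> \<odot> X = X"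
    and TensO_RUnit: "X \<in> Obj C \<Longrightarrow> X \<odot> \<one> = X"
    and TensM_LUnit: "f \<in> Arr C \<Longrightarrow> Ide C \<one> \<otimes> f = f"
    and TensM_RUnit: "f \<in> Arr C \<Longrightarrow> f \<otimes> Ide C \<one> = f"
    and Assoc_Ide: "\<lbrakk>X \<in> Obj C; Y \<in> Obj C; Z \<in> Obj C\<rbrakk> \<Longrightarrow> Assoc C X Y Z = Ide C (X \<odot> Y \<odot> Z)"
    and LUnit_Ide: "X \<in> Obj C \<Longrightarrow> LUnit C X = Ide C X"
    and RUnit_Ide: "X \<in> Obj C \<Longrightarrow> RUnit C X = Ide C X"

definition algebra :: "('o, 'm) moncat \<Rightarrow> 'o \<Rightarrow> 'm \<Rightarrow> 'm \<Rightarrow> bool" where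
  "algebra C A m e \<longleftrightarrow>
    A \<in> Obj C \<and> m \<in> Hom C (A \<odot>\<^bsub>C\<^esub> A) A \<and> e \<in> Hom C \<one>\<^bsub>C\<^esub> A \<and>
    m \<cdot>\<^bsub>C\<^esub> (m \<otimes>\<^bsub>C\<^esub> Ide C A) = m \<cdot>\<^bsub>C\<^esub> (Ide C A \<otimes>\<^bsub>C\<^esub> m) \<cdot>\<^bsub>C\<^esub> Assoc C A A A \<and>
    m \<cdot>\<^bsub>C\<^esub> (e \<otimes>\<^bsub>C\<^esub> Ide C A) = LUnit C A \<and>
    m \<cdot>\<^bsub>C\<^esub> (Ide C A \<otimes>\<^bsub>C\<^esub> e) = RUnit C A"

definition coalgebra :: "('o, 'm) moncat \<Rightarrow> 'o \<Rightarrow> 'm \<Rightarrow> 'm \<Rightarrow> bool" where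
  "coalgebra C K \<Delta> \<epsilon> \<longleftrightarrow>
    K \<in> Obj C \<and> \<Delta> \<in> Hom C K (K \<odot>\<^bsub>C\<^esub> K) \<and> \<epsilon> \<in> Hom C K \<one>\<^bsub>C\<^esub> \<and>
    Assoc C K K K \<cdot>\<^bsub>C\<^esub> (\<Delta> \<otimes>\<^bsub>C\<^esub> Ide C K) \<cdot>\<^bsub>C\<^esub> \<Delta> = (Ide C K \<otimes>\<^bsub>C\<^esub> \<Delta>) \<cdot>\<^bsub>C\<^esub> \<Delta> \<and>
    LUnit C K \<cdot>\<^bsub>C\<^esub> (\<epsilon> \<otimes>\<^bsub>C\<^esub> Ide C K) \<cdot>\<^bsub>C\<^esub> \<Delta> = Ide C K \<and>
    RUnit C K \<cdot>\<^bsub>C\<^esub> (Ide C K \<otimes>\<^bsub>C\<^esub> \<epsilon>) \<cdot>\<^bsub>C\<^esub> \<Delta> = Ide C K"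


section \<open>Right categories over a strict monoidal category\<close>

text \<open>The action on objects is written \<open>\<star>\<close>, on arrows \<open>\<diamondop>\<close>.\<close>

record ('p, 'q, 'o, 'm) actcat = "('p, 'q) cat" +
  ActO :: "'p \<Rightarrow> 'o \<Rightarrow> 'p" (infixl "\<star>\<index>" 71)
  ActM :: "'q \<Rightarrow> 'm \<Rightarrow> 'q" (infixl "\<diamondop>\<index>" 69)

locale right_category = C: strict_monoidal_category C + bifunctor D C D "ActO D" "ActM D"
  for C :: "('o, 'm) moncat" and D :: "('p, 'q, 'o, 'm) actcat" (structure) +
  assumes ActO_assoc: "\<lbrakk>M \<in> Obj D; X \<in> Obj C; Y \<in> Obj C\<rbrakk> \<Longrightarrow> (M \<star> X) \<star> Y = M \<star> (X \<odot>\<^bsub>C\<^esub> Y)"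
    and ActM_assoc: "\<lbrakk>h \<in> Arr D; f \<in> Arr C; g \<in> Arr C\<rbrakk>
      \<Longrightarrow> (h \<diamondop> f) \<diamondop> g = h \<diamondop> (f \<otimes>\<^bsub>C\<^esub> g)"
    and ActO_Unit: "M \<in> Obj D \<Longrightarrow> M \<star> \<one>\<^bsub>C\<^esub> = M"
    and ActM_Unit: "h \<in> Arr D \<Longrightarrow> h \<diamondop> Ide C \<one>\<^bsub>C\<^esub> = h"

text \<open>\<open>C\<close> as a right category over itself. The left-handed notions (left coflat, left robust)
  are the notions below for this right category.\<close>

definition regular :: "('o, 'm) moncat \<Rightarrow> ('o, 'm, 'o, 'm) actcat" where
  "regular C = \<lparr>Obj = Obj C, Arr = Arr C, Dom = Dom C, Cod = Cod C, Ide = Ide C, Comp = Comp C,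
    ActO = TensO C, ActM = TensM C\<rparr>"

definition coflat :: "('o, 'm) moncat \<Rightarrow> ('p, 'q, 'o, 'm) actcat \<Rightarrow> 'o \<Rightarrow> bool" where
  "coflat C D X \<longleftrightarrow>
    (\<forall>f g q. coequalizer D f g q \<longrightarrow>
      coequalizer D (f \<diamondop>\<^bsub>D\<^esub> Ide C X) (g \<diamondop>\<^bsub>D\<^esub> Ide C X) (q \<diamondop>\<^bsub>D\<^esub> Ide C X))"


section \<open>Modules\<close>

text \<open>In this and the following sections \<open>C\<close> is meant to be strict, so no constraints appear in
  equations in \<open>C\<close> and \<open>D\<close>; \<open>(A, m, e)\<close> is an algebra in \<open>C\<close>.\<close>

definition right_module ::
  "('o, 'm) moncat \<Rightarrow> 'o \<Rightarrow> 'm \<Rightarrow> 'm \<Rightarrow> ('p, 'q, 'o, 'm) actcat \<Rightarrow> 'p \<Rightarrow> 'q \<Rightarrow> bool" where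
  "right_module C A m e D M \<nu> \<longleftrightarrow>
    M \<in> Obj D \<and> \<nu> \<in> Hom D (M \<star>\<^bsub>D\<^esub> A) M \<and>
    \<nu> \<cdot>\<^bsub>D\<^esub> (\<nu> \<diamondop>\<^bsub>D\<^esub> Ide C A) = \<nu> \<cdot>\<^bsub>D\<^esub> (Ide D M \<diamondop>\<^bsub>D\<^esub> m) \<and>
    \<nu> \<cdot>\<^bsub>D\<^esub> (Ide D M \<diamondop>\<^bsub>D\<^esub> e) = Ide D M"

definition left_module :: "('o, 'm) moncat \<Rightarrow> 'o \<Rightarrow> 'm \<Rightarrow> 'm \<Rightarrow> 'o \<Rightarrow> 'm \<Rightarrow> bool" where
  "left_module C A m e Y \<mu> \<longleftrightarrow>
    Y \<in> Obj C \<and> \<mu> \<in> Hom C (A \<odot>\<^bsub>C\<^esub> Y) Y \<and>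
    \<mu> \<cdot>\<^bsub>C\<^esub> (Ide C A \<otimes>\<^bsub>C\<^esub> \<mu>) = \<mu> \<cdot>\<^bsub>C\<^esub> (m \<otimes>\<^bsub>C\<^esub> Ide C Y) \<and>
    \<mu> \<cdot>\<^bsub>C\<^esub> (e \<otimes>\<^bsub>C\<^esub> Ide C Y) = Ide C Y"

text \<open>The projection \<open>M \<star> Y \<rightarrow> M \<star>\<^sub>A Y\<close> for a right \<open>A\<close>-module \<open>(M, \<nu>)\<close> in \<open>D\<close> and a left
  \<open>A\<close>-module \<open>(Y, \<mu>)\<close> in \<open>C\<close>. The object \<open>M \<star>\<^sub>A Y\<close> is its codomain.\<close>

definition bal ::
  "('o, 'm) moncat \<Rightarrow> ('p, 'q, 'o, 'm) actcat \<Rightarrow> 'p \<Rightarrow> 'q \<Rightarrow> 'o \<Rightarrow> 'm \<Rightarrow> 'q" where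
  "bal C D M \<nu> Y \<mu> = coeq D (\<nu> \<diamondop>\<^bsub>D\<^esub> Ide C Y) (Ide D M \<diamondop>\<^bsub>D\<^esub> \<mu>)"

text \<open>The canonical morphism \<open>(M \<star> Z) \<star>\<^sub>A Y \<rightarrow> M \<star> (Z \<odot>\<^sub>A Y)\<close>, where \<open>\<zeta>\<close> is the right action
  on \<open>Z\<close> and \<open>M \<star> Z\<close> carries the right action induced by \<open>\<zeta>\<close>.\<close>

definition robust_can ::
  "('o, 'm) moncat \<Rightarrow> ('p, 'q, 'o, 'm) actcat \<Rightarrow> 'p \<Rightarrow> 'o \<Rightarrow> 'm \<Rightarrow> 'o \<Rightarrow> 'm \<Rightarrow> 'q" where
  "robust_can C D M Z \<zeta> Y \<mu> =
    induced D (bal C D (M \<star>\<^bsub>D\<^esub> Z) (Ide D M \<diamondop>\<^bsub>D\<^esub> \<zeta>) Y \<mu>)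
      (Ide D M \<diamondop>\<^bsub>D\<^esub> bal C (regular C) Z \<zeta> Y \<mu>)"

definition robust ::
  "('o, 'm) moncat \<Rightarrow> 'o \<Rightarrow> 'm \<Rightarrow> 'm \<Rightarrow> ('p, 'q, 'o, 'm) actcat \<Rightarrow> 'o \<Rightarrow> 'm \<Rightarrow> bool" where
  "robust C A m e D Y \<mu> \<longleftrightarrow>
    (\<forall>M Z \<zeta>. M \<in> Obj D \<and> right_module C A m e (regular C) Z \<zeta> \<longrightarrow>
      iso D (robust_can C D M Z \<zeta> Y \<mu>))"


section \<open>The monoidal category of coflat and robust bimodules\<close>

text \<open>Structured arrows: the underlying arrow alone does not determine the structures carried by
  its source and target.\<close>

datatype ('x, 'm) sarr = SArr (src: 'x) (tgt: 'x) (und: 'm)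

datatype ('o, 'm) bimod = Bimod (bcar: 'o) (lact: 'm) (ract: 'm)

definition bimodule ::
  "('o, 'm) moncat \<Rightarrow> 'o \<Rightarrow> 'm \<Rightarrow> 'm \<Rightarrow> ('o, 'm) bimod \<Rightarrow> bool" where
  "bimodule C A m e P \<longleftrightarrow>
    left_module C A m e (bcar P) (lact P) \<and>
    right_module C A m e (regular C) (bcar P) (ract P) \<and>
    ract P \<cdot>\<^bsub>C\<^esub> (lact P \<otimes>\<^bsub>C\<^esub> Ide C A) = lact P \<cdot>\<^bsub>C\<^esub> (Ide C A \<otimes>\<^bsub>C\<^esub> ract P)"

definition bim_objects ::
  "('o, 'm) moncat \<Rightarrow> ('p, 'q, 'o, 'm) actcat \<Rightarrow> 'o \<Rightarrow> 'm \<Rightarrow> 'm \<Rightarrow> ('o, 'm) bimod set" where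
  "bim_objects C D A m e = {P. bimodule C A m e P \<and>
    coflat C (regular C) (bcar P) \<and> coflat C D (bcar P) \<and>
    robust C A m e (regular C) (bcar P) (lact P) \<and> robust C A m e D (bcar P) (lact P)}"

definition bim_arrow ::
  "('o, 'm) moncat \<Rightarrow> 'o \<Rightarrow> ('o, 'm) bimod \<Rightarrow> ('o, 'm) bimod \<Rightarrow> 'm \<Rightarrow> bool" where
  "bim_arrow C A P Q f \<longleftrightarrow>
    f \<in> Hom C (bcar P) (bcar Q) \<and>
    f \<cdot>\<^bsub>C\<^esub> lact P = lact Q \<cdot>\<^bsub>C\<^esub> (Ide C A \<otimes>\<^bsub>C\<^esub> f) \<and>
    f \<cdot>\<^bsub>C\<^esub> ract P = ract Q \<cdot>\<^bsub>C\<^esub> (f \<otimes>\<^bsub>C\<^esub> Ide C A)"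

definition bim_proj :: "('o, 'm) moncat \<Rightarrow> ('o, 'm) bimod \<Rightarrow> ('o, 'm) bimod \<Rightarrow> 'm" where
  "bim_proj C P Q = bal C (regular C) (bcar P) (ract P) (bcar Q) (lact Q)"

definition bim_tensor ::
  "('o, 'm) moncat \<Rightarrow> 'o \<Rightarrow> ('o, 'm) bimod \<Rightarrow> ('o, 'm) bimod \<Rightarrow> ('o, 'm) bimod" where
  "bim_tensor C A P Q = Bimod (Cod C (bim_proj C P Q))
    (induced C (Ide C A \<otimes>\<^bsub>C\<^esub> bim_proj C P Q) (bim_proj C P Q \<cdot>\<^bsub>C\<^esub> (lact P \<otimes>\<^bsub>C\<^esub> Ide C (bcar Q))))
    (induced C (bim_proj C P Q \<otimes>\<^bsub>C\<^esub> Ide C A) (bim_proj C P Q \<cdot>\<^bsub>C\<^esub> (Ide C (bcar P) \<otimes>\<^bsub>C\<^esub> ract Q)))"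

definition bim_cat ::
  "('o, 'm) moncat \<Rightarrow> ('p, 'q, 'o, 'm) actcat \<Rightarrow> 'o \<Rightarrow> 'm \<Rightarrow> 'm
    \<Rightarrow> (('o, 'm) bimod, (('o, 'm) bimod, 'm) sarr) moncat" where
  "bim_cat C D A m e = \<lparr>
    Obj = bim_objects C D A m e,
    Arr = {SArr P Q f |P Q f.
      P \<in> bim_objects C D A m e \<and> Q \<in> bim_objects C D A m e \<and> bim_arrow C A P Q f},
    Dom = src,
    Cod = tgt,
    Ide = (\<lambda>P. SArr P P (Ide C (bcar P))),
    Comp = (\<lambda>g f. SArr (src f) (tgt g) (und g \<cdot>\<^bsub>C\<^esub> und f)),
    Unit = Bimod A m m,
    TensO = bim_tensor C A,
    TensM = (\<lambda>f g. SArr (bim_tensor C A (src f) (src g)) (bim_tensor C A (tgt f) (tgt g))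
      (induced C (bim_proj C (src f) (src g))
        (bim_proj C (tgt f) (tgt g) \<cdot>\<^bsub>C\<^esub> (und f \<otimes>\<^bsub>C\<^esub> und g)))),
    Assoc = (\<lambda>P Q R.
      SArr (bim_tensor C A (bim_tensor C A P Q) R) (bim_tensor C A P (bim_tensor C A Q R))
        (induced C
          (bim_proj C (bim_tensor C A P Q) R \<cdot>\<^bsub>C\<^esub> (bim_proj C P Q \<otimes>\<^bsub>C\<^esub> Ide C (bcar R)))
          (bim_proj C P (bim_tensor C A Q R) \<cdot>\<^bsub>C\<^esub> (Ide C (bcar P) \<otimes>\<^bsub>C\<^esub> bim_proj C Q R)))),
    LUnit = (\<lambda>P. SArr (bim_tensor C A (Bimod A m m) P) P
      (induced C (bim_proj C (Bimod A m m) P) (lact P))),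
    RUnit = (\<lambda>P. SArr (bim_tensor C A P (Bimod A m m)) P
      (induced C (bim_proj C P (Bimod A m m)) (ract P)))\<rparr>"

text \<open>Rings and corings over \<open>A\<close> in \<open>C\<close> compatible with \<open>D\<close>.\<close>

definition compatible_ring ::
  "('o, 'm) moncat \<Rightarrow> ('p, 'q, 'o, 'm) actcat \<Rightarrow> 'o \<Rightarrow> 'm \<Rightarrow> 'm \<Rightarrow> ('o, 'm) bimod
    \<Rightarrow> (('o, 'm) bimod, 'm) sarr \<Rightarrow> (('o, 'm) bimod, 'm) sarr \<Rightarrow> bool" where
  "compatible_ring C D A m e = algebra (bim_cat C D A m e)"

definition compatible_coring ::
  "('o, 'm) moncat \<Rightarrow> ('p, 'q, 'o, 'm) actcat \<Rightarrow> 'o \<Rightarrow> 'm \<Rightarrow> 'm \<Rightarrow> ('o, 'm) bimod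
    \<Rightarrow> (('o, 'm) bimod, 'm) sarr \<Rightarrow> (('o, 'm) bimod, 'm) sarr \<Rightarrow> bool" where
  "compatible_coring C D A m e = coalgebra (bim_cat C D A m e)"


section \<open>The monoidal category EM(C)(A)\<close>

definition em_objects :: "('o, 'm) moncat \<Rightarrow> 'o \<Rightarrow> 'm \<Rightarrow> 'm \<Rightarrow> ('o \<times> 'm) set" where
  "em_objects C A m e = {(X, \<psi>).
    X \<in> Obj C \<and> \<psi> \<in> Hom C (X \<odot>\<^bsub>C\<^esub> A) (A \<odot>\<^bsub>C\<^esub> X) \<and>
    \<psi> \<cdot>\<^bsub>C\<^esub> (Ide C X \<otimes>\<^bsub>C\<^esub> m)
      = (m \<otimes>\<^bsub>C\<^esub> Ide C X) \<cdot>\<^bsub>C\<^esub> (Ide C A \<otimes>\<^bsub>C\<^esub> \<psi>) \<cdot>\<^bsub>C\<^esub> (\<psi> \<otimes>\<^bsub>C\<^esub> Ide C A) \<and>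
    \<psi> \<cdot>\<^bsub>C\<^esub> (Ide C X \<otimes>\<^bsub>C\<^esub> e) = e \<otimes>\<^bsub>C\<^esub> Ide C X}"

definition em_arrow ::
  "('o, 'm) moncat \<Rightarrow> 'o \<Rightarrow> 'm \<Rightarrow> 'o \<times> 'm \<Rightarrow> 'o \<times> 'm \<Rightarrow> 'm \<Rightarrow> bool" where
  "em_arrow C A m = (\<lambda>(X, \<psi>) (Y, \<phi>) \<rho>.
    \<rho> \<in> Hom C X (A \<odot>\<^bsub>C\<^esub> Y) \<and>
    (m \<otimes>\<^bsub>C\<^esub> Ide C Y) \<cdot>\<^bsub>C\<^esub> (Ide C A \<otimes>\<^bsub>C\<^esub> \<rho>) \<cdot>\<^bsub>C\<^esub> \<psi>
      = (m \<otimes>\<^bsub>C\<^esub> Ide C Y) \<cdot>\<^bsub>C\<^esub> (Ide C A \<otimes>\<^bsub>C\<^esub> \<phi>) \<cdot>\<^bsub>C\<^esub> (\<rho> \<otimes>\<^bsub>C\<^esub> Ide C A))"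

definition em_tensor :: "('o, 'm) moncat \<Rightarrow> 'o \<times> 'm \<Rightarrow> 'o \<times> 'm \<Rightarrow> 'o \<times> 'm" where
  "em_tensor C = (\<lambda>(X, \<psi>) (Y, \<phi>).
    (X \<odot>\<^bsub>C\<^esub> Y, (\<psi> \<otimes>\<^bsub>C\<^esub> Ide C Y) \<cdot>\<^bsub>C\<^esub> (Ide C X \<otimes>\<^bsub>C\<^esub> \<phi>)))"

definition em_ide :: "('o, 'm) moncat \<Rightarrow> 'm \<Rightarrow> 'o \<times> 'm \<Rightarrow> ('o \<times> 'm, 'm) sarr" where
  "em_ide C e = (\<lambda>P. SArr P P (e \<otimes>\<^bsub>C\<^esub> Ide C (fst P)))"

text \<open>\<open>EM_cat\<close> is again strict, hence its constraints are identities.\<close>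

definition EM_cat ::
  "('o, 'm) moncat \<Rightarrow> 'o \<Rightarrow> 'm \<Rightarrow> 'm \<Rightarrow> ('o \<times> 'm, ('o \<times> 'm, 'm) sarr) moncat" where
  "EM_cat C A m e = \<lparr>
    Obj = em_objects C A m e,
    Arr = {SArr P Q \<rho> |P Q \<rho>.
      P \<in> em_objects C A m e \<and> Q \<in> em_objects C A m e \<and> em_arrow C A m P Q \<rho>},
    Dom = src,
    Cod = tgt,
    Ide = em_ide C e,
    Comp = (\<lambda>\<rho>' \<rho>. SArr (src \<rho>) (tgt \<rho>')
      ((m \<otimes>\<^bsub>C\<^esub> Ide C (fst (tgt \<rho>'))) \<cdot>\<^bsub>C\<^esub> (Ide C A \<otimes>\<^bsub>C\<^esub> und \<rho>') \<cdot>\<^bsub>C\<^esub> und \<rho>)),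
    Unit = (\<one>\<^bsub>C\<^esub>, Ide C A),
    TensO = em_tensor C,
    TensM = (\<lambda>\<rho> \<rho>'. SArr (em_tensor C (src \<rho>) (src \<rho>')) (em_tensor C (tgt \<rho>) (tgt \<rho>'))
      ((m \<otimes>\<^bsub>C\<^esub> Ide C (fst (tgt \<rho>)) \<otimes>\<^bsub>C\<^esub> Ide C (fst (tgt \<rho>')))
        \<cdot>\<^bsub>C\<^esub> (Ide C A \<otimes>\<^bsub>C\<^esub> snd (tgt \<rho>) \<otimes>\<^bsub>C\<^esub> Ide C (fst (tgt \<rho>')))
        \<cdot>\<^bsub>C\<^esub> (und \<rho> \<otimes>\<^bsub>C\<^esub> und \<rho>'))),
    Assoc = (\<lambda>P Q R. em_ide C e (em_tensor C P (em_tensor C Q R))),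
    LUnit = em_ide C e,
    RUnit = em_ide C e\<rparr>"

end

theory Submission
  imports Defs
begin

text \<open>
  A left linear map \<open>A \<odot> V \<rightarrow> A \<odot> W\<close> of free left modules is the same as a map \<open>\<rho> : V \<rightarrow> A \<odot> W\<close>:
  restrict along the unit in one direction, and in the other take the extension
  \<open>lift W \<rho> = (m \<otimes> W) \<cdot> (A \<otimes> \<rho>)\<close>. So free left modules form the Kleisli category of the monad
  \<open>A \<odot> -\<close>, and the composition in \<open>EM\<close> is Kleisli composition. A right action on \<open>A \<odot> X\<close> that
  commutes with \<open>m \<otimes> X\<close> is itself a left linear map \<open>A \<odot> (X \<odot> A) \<rightarrow> A \<odot> X\<close>, hence equals
  \<open>lift X \<psi>\<close> for a unique \<open>\<psi> : X \<odot> A \<rightarrow> A \<odot> X\<close>; associativity and unitality of the action are precisely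
  the two axioms that make \<open>(X, \<psi>)\<close> an object of \<open>EM\<close> (lemmas \<open>presented_bimodule\<close> and \<open>bimodule_is_free\<close>), and right
  linearity of \<open>lift Y \<rho>\<close> is the axiom for a morphism of \<open>EM\<close>.

  This correspondence is monoidal. For a right module \<open>M\<close>, the action \<open>M \<odot> A \<odot> W \<rightarrow> M \<odot> W\<close> is a
  coequalizer of the pair that defines the tensor product of \<open>M\<close> with \<open>A \<odot> W\<close> over \<open>A\<close>, and it is
  split by the unit of \<open>A\<close> (\<open>frame_split_coequalizer\<close>). Three things follow. Every functor
  \<open>M \<star> -\<close> preserves it, so free modules are robust. The tensor product of \<open>M\<close> and
  \<open>A \<odot> W\<close> over \<open>A\<close> is \<open>M \<odot> W\<close>, so that of the bimodules belonging to \<open>(X, \<psi>)\<close> and \<open>(Y, \<phi>)\<close> is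
  \<open>A \<odot> X \<odot> Y\<close>, and the induced actions are those belonging to the tensor product in \<open>EM\<close>
  (\<open>tensor_presented\<close>). Coflatness of \<open>A\<close> and \<open>X\<close> then makes all bimodules involved objects of
  the category of coflat robust bimodules (\<open>presented_bim_object\<close>).

  The tensor product over \<open>A\<close> is only a chosen coequalizer, so it is isomorphic but not equal to
  \<open>M \<odot> W\<close>. The isomorphisms are recorded as \<^emph>\<open>charts\<close>. Read in charts, tensor products of arrows
  become whiskerings in \<open>C\<close> (\<open>tensor_arrow_in_charts\<close>) and the associativity and unit constraints
  become identities (\<open>associator_in_charts\<close>, \<open>left_unitor\<close>, \<open>right_unitor\<close>). Each axiom for a ring
  or coring on \<open>A \<odot> X\<close> thus becomes an equation between maps \<open>lift W \<alpha>\<close> and \<open>lift W \<beta>\<close>, and since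
  \<open>lift\<close> is injective it says \<open>\<alpha> = \<beta>\<close>, which is the corresponding axiom in \<open>EM\<close>
  (\<open>algebra_equations\<close>, \<open>coalgebra_equations\<close>).
\<close>

section \<open>Categories and split coequalizers\<close>

lemma in_Hom: "f \<in> Hom C a b \<longleftrightarrow> f \<in> Arr C \<and> Dom C f = a \<and> Cod C f = b"
  by (auto simp: Hom_def)

text \<open>All conditions are equations, so unlike the universal property they are preserved by every
  functor.\<close>

definition split_coequalizer ::
  "('o, 'm, 'z) cat_scheme \<Rightarrow> 'm \<Rightarrow> 'm \<Rightarrow> 'm \<Rightarrow> 'm \<Rightarrow> 'm \<Rightarrow> bool" where
  "split_coequalizer C f g q s t \<longleftrightarrow>
    f \<in> Arr C \<and> g \<in> Hom C (Dom C f) (Cod C f) \<and> q \<in> Arr C \<and> Dom C q = Cod C f \<and>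
    s \<in> Hom C (Cod C q) (Cod C f) \<and> t \<in> Hom C (Cod C f) (Dom C f) \<and>
    q \<cdot>\<^bsub>C\<^esub> f = q \<cdot>\<^bsub>C\<^esub> g \<and> q \<cdot>\<^bsub>C\<^esub> s = Ide C (Cod C q) \<and>
    g \<cdot>\<^bsub>C\<^esub> t = Ide C (Cod C f) \<and> f \<cdot>\<^bsub>C\<^esub> t = s \<cdot>\<^bsub>C\<^esub> q"

context category
begin

lemma Dom_Cod_Obj [simp]:
  "f \<in> Arr C \<Longrightarrow> Dom C f \<in> Obj C" "f \<in> Arr C \<Longrightarrow> Cod C f \<in> Obj C"
  using Dom_Obj Cod_Obj by auto

lemma Ide_typing [simp]:
  assumes "a \<in> Obj C"
  shows "Ide C a \<in> Arr C" "Dom C (Ide C a) = a" "Cod C (Ide C a) = a"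
  using Ide_Hom[OF assms] by (auto simp: in_Hom)

lemma Comp_typing [simp]:
  assumes "f \<in> Arr C" "g \<in> Arr C" "Dom C g = Cod C f"
  shows "g \<cdot> f \<in> Arr C" "Dom C (g \<cdot> f) = Dom C f" "Cod C (g \<cdot> f) = Cod C g"
  using Comp_Hom[of f "Dom C f" "Cod C f" g "Cod C g"] assms by (auto simp: in_Hom)

lemma Comp_Ide' [simp]: "\<lbrakk>f \<in> Arr C; Dom C f = a\<rbrakk> \<Longrightarrow> f \<cdot> Ide C a = f"
  using Comp_Ide by (auto simp: in_Hom)

lemma Ide_Comp' [simp]: "\<lbrakk>f \<in> Arr C; Cod C f = b\<rbrakk> \<Longrightarrow> Ide C b \<cdot> f = f"
  using Ide_Comp by (auto simp: in_Hom)

lemma assoc: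
  "\<lbrakk>f \<in> Arr C; g \<in> Arr C; h \<in> Arr C; Dom C g = Cod C f; Dom C h = Cod C g\<rbrakk>
    \<Longrightarrow> (h \<cdot> g) \<cdot> f = h \<cdot> g \<cdot> f"
  using Comp_assoc by (auto simp: in_Hom)

lemma split_epi_cancel:
  assumes "q \<in> Arr C" "s \<in> Hom C (Cod C q) (Dom C q)" "q \<cdot> s = Ide C (Cod C q)"
    and "k \<in> Arr C" "k' \<in> Arr C" "Dom C k = Cod C q" "Dom C k' = Cod C q" "k \<cdot> q = k' \<cdot> q"
  shows "k = k'"
proof -
  have "k = (k \<cdot> q) \<cdot> s" using assms(1-7) by (simp add: assoc in_Hom)
  also have "\<dots> = (k' \<cdot> q) \<cdot> s" using assms(8) by simp
  also have "\<dots> = k'" using assms(1-7) by (simp add: assoc in_Hom)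
  finally show ?thesis .
qed

text \<open>Induced arrows are identified by guessing them: the splitting of \<open>q\<close> gives uniqueness
  without appeal to a universal property. This also covers arrows induced along a composite of two
  projections, as in the associativity constraint.\<close>

lemma induced_along_split_epi:
  assumes "q \<in> Arr C" "s \<in> Hom C (Cod C q) (Dom C q)" "q \<cdot> s = Ide C (Cod C q)"
    and "k \<in> Arr C" "Dom C k = Cod C q" "k \<cdot> q = h"
  shows "induced C q h = k"
  unfolding induced_def
proof (rule the_equality)
  show "k \<in> Hom C (Cod C q) (Cod C h) \<and> k \<cdot> q = h"
    using assms by (auto simp: in_Hom)
  show "k' = k" if "k' \<in> Hom C (Cod C q) (Cod C h) \<and> k' \<cdot> q = h" for k'
    using split_epi_cancel[OF assms(1-3), of k' k] assms that by (auto simp: in_Hom)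
qed

text \<open>A map \<open>h\<close> with \<open>h \<cdot> f = h \<cdot> g\<close> factors as \<open>h \<cdot> s\<close>, because
  \<open>h \<cdot> s \<cdot> q = h \<cdot> f \<cdot> t = h \<cdot> g \<cdot> t = h\<close>.\<close>

lemma split_coequalizer_is_coequalizer:
  assumes "split_coequalizer C f g q s t"
  shows "coequalizer C f g q"
proof -
  note S = assms[unfolded split_coequalizer_def in_Hom]
  have "\<exists>!k. k \<in> Hom C (Cod C q) (Cod C h) \<and> k \<cdot> q = h"
    if h: "h \<in> Arr C" "Dom C h = Cod C f" "h \<cdot> f = h \<cdot> g" for h
  proof (rule ex1I[of _ "h \<cdot> s"])
    have "(h \<cdot> s) \<cdot> q = (h \<cdot> f) \<cdot> t" using S h(1,2) by (simp add: assoc)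
    also have "\<dots> = h" using S h by (simp add: assoc)
    finally show "h \<cdot> s \<in> Hom C (Cod C q) (Cod C h) \<and> (h \<cdot> s) \<cdot> q = h"
      using S h by (simp add: in_Hom)
    show "k = h \<cdot> s" if "k \<in> Hom C (Cod C q) (Cod C h) \<and> k \<cdot> q = h" for k
      using S h that by (auto simp: in_Hom assoc)
  qed
  with S show ?thesis by (auto simp: coequalizer_def in_Hom)
qed

lemma coequalizer_factor:
  assumes "coequalizer C f g q" "h \<in> Arr C" "Dom C h = Cod C f" "h \<cdot> f = h \<cdot> g"
  obtains k where "k \<in> Hom C (Cod C q) (Cod C h)" "k \<cdot> q = h"
    "\<And>k'. k' \<in> Hom C (Cod C q) (Cod C h) \<Longrightarrow> k' \<cdot> q = h \<Longrightarrow> k' = k"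
    "induced C q h = k"
proof -
  have ex: "\<exists>!k. k \<in> Hom C (Cod C q) (Cod C h) \<and> k \<cdot> q = h"
    using assms by (auto simp: coequalizer_def)
  then obtain k where k: "k \<in> Hom C (Cod C q) (Cod C h)" "k \<cdot> q = h" by blast
  moreover have "induced C q h = k"
    unfolding induced_def using ex k by (auto intro: the1_equality)
  ultimately show ?thesis using that ex by blast
qed

lemma coequalizers_compared:
  assumes q: "coequalizer C f g q" and q': "coequalizer C f g q'"
  obtains c c' where "c \<in> Hom C (Cod C q) (Cod C q')" "c' \<in> Hom C (Cod C q') (Cod C q)"
    "c \<cdot> q = q'" "c' \<cdot> q' = q" "c' \<cdot> c = Ide C (Cod C q)" "c \<cdot> c' = Ide C (Cod C q')"
    "induced C q q' = c"
proof -
  note Q = q[unfolded coequalizer_def] and Q' = q'[unfolded coequalizer_def]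
  obtain c where c: "c \<in> Hom C (Cod C q) (Cod C q')" "c \<cdot> q = q'" "induced C q q' = c"
    using coequalizer_factor[OF q, of q'] Q' by metis
  obtain c' where c': "c' \<in> Hom C (Cod C q') (Cod C q)" "c' \<cdot> q' = q"
    using coequalizer_factor[OF q', of q] Q by metis
  have "(c' \<cdot> c) \<cdot> q = q" "(c \<cdot> c') \<cdot> q' = q'"
    using c c' Q Q' by (auto simp: assoc in_Hom)
  then have "c' \<cdot> c = Ide C (Cod C q)" "c \<cdot> c' = Ide C (Cod C q')"
    using coequalizer_factor[OF q, of q] coequalizer_factor[OF q', of q'] Q Q' c c'
    by (metis (no_types) Comp_Hom Dom_Cod_Obj(2) Ide_Comp' Ide_Hom)+
  with c c' show ?thesis using that by blast
qed

lemma induced_between_coequalizers_iso: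
  assumes "coequalizer C f g q" "coequalizer C f g q'"
  shows "iso C (induced C q q')"
  by (rule coequalizers_compared[OF assms]) (auto simp: iso_def in_Hom)

text \<open>Splitness belongs to the parallel pair: once one coequalizer of a pair splits, so does
  every other one, with the same \<open>t\<close>. This carries the explicit splittings below over to the chosen
  coequalizers.\<close>

lemma coequalizer_of_split_pair:
  assumes p: "split_coequalizer C f g p s t" and q: "coequalizer C f g q"
  obtains c c' where "c \<in> Hom C (Cod C q) (Cod C p)" "c' \<in> Hom C (Cod C p) (Cod C q)"
    "c \<cdot> q = p" "c' \<cdot> p = q" "c' \<cdot> c = Ide C (Cod C q)" "c \<cdot> c' = Ide C (Cod C p)"
    "split_coequalizer C f g q (s \<cdot> c) t"
proof -
  note P = p[unfolded split_coequalizer_def in_Hom] and Q = q[unfolded coequalizer_def in_Hom]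
  obtain c c' where c: "c \<in> Hom C (Cod C q) (Cod C p)" "c' \<in> Hom C (Cod C p) (Cod C q)"
    "c \<cdot> q = p" "c' \<cdot> p = q" "c' \<cdot> c = Ide C (Cod C q)" "c \<cdot> c' = Ide C (Cod C p)"
    using coequalizers_compared[OF q split_coequalizer_is_coequalizer[OF p]] by metis
  have T: "p \<in> Arr C" "Dom C p = Cod C f" "s \<in> Hom C (Cod C p) (Cod C f)"
    using P by (auto simp: in_Hom)
  have "q \<cdot> s \<cdot> c = (c' \<cdot> p) \<cdot> s \<cdot> c" by (simp add: c(4))
  also have "\<dots> = c' \<cdot> (p \<cdot> s) \<cdot> c" using T c(1,2) by (simp add: assoc in_Hom)
  also have "\<dots> = Ide C (Cod C q)" using P c by (simp add: in_Hom)
  finally have "split_coequalizer C f g q (s \<cdot> c) t"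
    using P Q c by (simp add: split_coequalizer_def in_Hom assoc)
  with c show ?thesis using that by blast
qed

text \<open>Coequalizers are invariant under isomorphism of diagrams; needed for coflatness of objects
  that are only isomorphic to a tensor product.\<close>

lemma coequalizer_transport:
  assumes q: "coequalizer C f g q"
    and u: "u \<in> Hom C (Dom C f) (Dom C f')" "u' \<in> Hom C (Dom C f') (Dom C f)" "u \<cdot> u' = Ide C (Dom C f')"
    and v: "v \<in> Hom C (Cod C f) (Cod C f')" "v' \<in> Hom C (Cod C f') (Cod C f)" "v \<cdot> v' = Ide C (Cod C f')"
    and w: "w \<in> Hom C (Cod C q) (Cod C q')" "w' \<in> Hom C (Cod C q') (Cod C q)"
      "w' \<cdot> w = Ide C (Cod C q)" "w \<cdot> w' = Ide C (Cod C q')"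
    and f': "f' \<in> Arr C" "g' \<in> Hom C (Dom C f') (Cod C f')" "q' \<in> Arr C" "Dom C q' = Cod C f'"
    and sq: "f' \<cdot> u = v \<cdot> f" "g' \<cdot> u = v \<cdot> g" "q' \<cdot> v = w \<cdot> q"
  shows "coequalizer C f' g' q'"
proof -
  note Q = q[unfolded coequalizer_def in_Hom]
  note T = u(1,2) v(1,2) w(1,2) f'
  have T' [simp]: "f \<in> Arr C" "g \<in> Arr C" "q \<in> Arr C" "Dom C g = Dom C f" "Cod C g = Cod C f" "Dom C q = Cod C f"
    using Q by auto
  have "(f' \<cdot> u) \<cdot> u' = f'" "(g' \<cdot> u) \<cdot> u' = g'" "(q' \<cdot> v) \<cdot> v' = q'"
    using T u(3) v(3) by (simp_all add: assoc in_Hom)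
  moreover have "(f' \<cdot> u) \<cdot> u' = v \<cdot> f \<cdot> u'" "(g' \<cdot> u) \<cdot> u' = v \<cdot> g \<cdot> u'" "(q' \<cdot> v) \<cdot> v' = w \<cdot> q \<cdot> v'"
    using T by (simp_all add: sq assoc in_Hom)
  ultimately have f'_eq: "f' = v \<cdot> f \<cdot> u'" and g'_eq: "g' = v \<cdot> g \<cdot> u'" and q'_eq: "q' = w \<cdot> q \<cdot> v'"
    by metis+
  have comm: "q' \<cdot> f' = q' \<cdot> g'"
  proof -
    have "q' \<cdot> f' = (q' \<cdot> v) \<cdot> f \<cdot> u'" using T by (subst f'_eq) (simp add: assoc in_Hom)
    also have "\<dots> = w \<cdot> (q \<cdot> f) \<cdot> u'" using T by (simp add: sq assoc in_Hom)
    also have "\<dots> = w \<cdot> (q \<cdot> g) \<cdot> u'" using Q by simp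
    also have "\<dots> = (q' \<cdot> v) \<cdot> g \<cdot> u'" using T by (simp add: sq assoc in_Hom)
    also have "\<dots> = q' \<cdot> g'" using T by (subst g'_eq) (simp add: assoc in_Hom)
    finally show ?thesis .
  qed
  have "\<exists>!k. k \<in> Hom C (Cod C q') (Cod C h) \<and> k \<cdot> q' = h"
    if h: "h \<in> Arr C" "Dom C h = Cod C f'" "h \<cdot> f' = h \<cdot> g'" for h
  proof -
    have "(h \<cdot> v) \<cdot> f = (h \<cdot> f') \<cdot> u" using T h(1,2) by (simp add: assoc in_Hom sq)
    also have "\<dots> = (h \<cdot> v) \<cdot> g" unfolding h(3) using T h(1,2) by (simp add: assoc in_Hom sq)
    finally have eq: "(h \<cdot> v) \<cdot> f = (h \<cdot> v) \<cdot> g" .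
    have hv: "h \<cdot> v \<in> Arr C" "Dom C (h \<cdot> v) = Cod C f" "Cod C (h \<cdot> v) = Cod C h"
      using T h(1,2) by (simp_all add: in_Hom)
    obtain k where k: "k \<in> Hom C (Cod C q) (Cod C h)" "k \<cdot> q = h \<cdot> v"
      "\<And>k'. k' \<in> Hom C (Cod C q) (Cod C h) \<Longrightarrow> k' \<cdot> q = h \<cdot> v \<Longrightarrow> k' = k"
      using coequalizer_factor[OF q hv(1,2) eq] unfolding hv(3) by metis
    show ?thesis
    proof (rule ex1I[of _ "k \<cdot> w'"])
      have "(k \<cdot> w') \<cdot> q' = k \<cdot> (w' \<cdot> w) \<cdot> q \<cdot> v'"
        using T k(1) by (subst q'_eq) (simp add: assoc in_Hom del: w)
      also have "\<dots> = (k \<cdot> q) \<cdot> v'" using T k(1) by (simp add: w assoc in_Hom)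
      also have "\<dots> = h" unfolding k(2) using T h(1,2) by (simp add: assoc in_Hom v)
      finally show "k \<cdot> w' \<in> Hom C (Cod C q') (Cod C h) \<and> (k \<cdot> w') \<cdot> q' = h"
        using T k(1) by (simp add: in_Hom)
      fix k' assume k': "k' \<in> Hom C (Cod C q') (Cod C h) \<and> k' \<cdot> q' = h"
      have "(k' \<cdot> w) \<cdot> q = k' \<cdot> (q' \<cdot> v)" using T k' by (simp add: assoc in_Hom sq)
      also have "\<dots> = (k' \<cdot> q') \<cdot> v" using T k' by (simp add: assoc[symmetric] in_Hom)
      finally have "(k' \<cdot> w) \<cdot> q = h \<cdot> v" using k' by simp
      then have "k' \<cdot> w = k" using k(3)[of "k' \<cdot> w"] k' T by (simp add: in_Hom)
      then show "k' = k \<cdot> w'" using k' T w(4) by (auto simp: assoc in_Hom)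
    qed
  qed
  with comm T show ?thesis by (simp add: coequalizer_def in_Hom)
qed

end

lemma coeq_is_coequalizer:
  assumes "has_coequalizers C" "f \<in> Hom C a b" "g \<in> Hom C a b"
  shows "coequalizer C f g (coeq C f g)"
  using assms unfolding has_coequalizers_def coeq_def by (metis someI_ex)

section \<open>Whiskering, right categories and coflatness\<close>

context strict_monoidal_category
begin

declare Unit_Obj [simp]
lemmas assoc = B.assoc

lemma TensO_Obj [simp]: "\<lbrakk>X \<in> Obj C; Y \<in> Obj C\<rbrakk> \<Longrightarrow> X \<odot> Y \<in> Obj C"
  by (rule FO_Obj)

lemma TensM_typing [simp]:
  assumes "f \<in> Arr C" "g \<in> Arr C"
  shows "f \<otimes> g \<in> Arr C" "Dom C (f \<otimes> g) = Dom C f \<odot> Dom C g" "Cod C (f \<otimes> g) = Cod C f \<odot> Cod C g"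
  using FM_Hom[of f "Dom C f" "Cod C f" g "Dom C g" "Cod C g"] assms by (auto simp: in_Hom)

declare TensO_assoc [simp] TensO_LUnit [simp] TensO_RUnit [simp] TensM_LUnit [simp] TensM_RUnit [simp]
declare TensM_assoc [simp]

lemma TensM_Ide [simp]: "\<lbrakk>X \<in> Obj C; Y \<in> Obj C\<rbrakk> \<Longrightarrow> Ide C X \<otimes> Ide C Y = Ide C (X \<odot> Y)"
  by (rule FM_Ide)

lemma TensM_Ide_Ide [simp]:
  "\<lbrakk>X \<in> Obj C; Y \<in> Obj C; f \<in> Arr C\<rbrakk> \<Longrightarrow> Ide C X \<otimes> Ide C Y \<otimes> f = Ide C (X \<odot> Y) \<otimes> f"
  by (simp add: TensM_assoc[symmetric] del: TensM_assoc)

lemma interchange: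
  "\<lbrakk>f \<in> Arr C; g \<in> Arr C; f' \<in> Arr C; g' \<in> Arr C; Dom C f' = Cod C f; Dom C g' = Cod C g\<rbrakk>
    \<Longrightarrow> (f' \<otimes> g') \<cdot> (f \<otimes> g) = (f' \<cdot> f) \<otimes> (g' \<cdot> g)"
  by (rule FM_Comp[symmetric]) (auto simp: in_Hom)

lemma whisker_left:
  "\<lbrakk>f \<in> Arr C; g \<in> Arr C; Dom C g = Cod C f; X \<in> Obj C\<rbrakk>
    \<Longrightarrow> Ide C X \<otimes> (g \<cdot> f) = (Ide C X \<otimes> g) \<cdot> (Ide C X \<otimes> f)"
  by (simp add: interchange)

lemma whisker_right:
  "\<lbrakk>f \<in> Arr C; g \<in> Arr C; Dom C g = Cod C f; X \<in> Obj C\<rbrakk>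
    \<Longrightarrow> (g \<cdot> f) \<otimes> Ide C X = (g \<otimes> Ide C X) \<cdot> (f \<otimes> Ide C X)"
  by (simp add: interchange)

text \<open>Maps acting on different tensor factors commute. Together with the whiskering laws this is
  the rule by which all diagram computations below proceed.\<close>

lemma slide:
  "\<lbrakk>f \<in> Arr C; g \<in> Arr C; Cod C f = b; Dom C g = c\<rbrakk>
    \<Longrightarrow> (Ide C b \<otimes> g) \<cdot> (f \<otimes> Ide C c) = (f \<otimes> Ide C (Cod C g)) \<cdot> (Ide C (Dom C f) \<otimes> g)"
  by (auto simp: interchange)

lemma slide_Comp:
  assumes "f \<in> Arr C" "g \<in> Arr C" "Cod C f = b" "Dom C g = c" "h \<in> Arr C" "Cod C h = Dom C f \<odot> c"
  shows "(Ide C b \<otimes> g) \<cdot> (f \<otimes> Ide C c) \<cdot> h = (f \<otimes> Ide C (Cod C g)) \<cdot> (Ide C (Dom C f) \<otimes> g) \<cdot> h"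
proof -
  have "(Ide C b \<otimes> g) \<cdot> (f \<otimes> Ide C c) \<cdot> h = ((Ide C b \<otimes> g) \<cdot> (f \<otimes> Ide C c)) \<cdot> h"
    using assms by (subst assoc) auto
  also have "\<dots> = ((f \<otimes> Ide C (Cod C g)) \<cdot> (Ide C (Dom C f) \<otimes> g)) \<cdot> h"
    using assms by (simp only: slide)
  also have "\<dots> = (f \<otimes> Ide C (Cod C g)) \<cdot> (Ide C (Dom C f) \<otimes> g) \<cdot> h"
    using assms by (subst assoc) auto
  finally show ?thesis .
qed

end

lemma regular_simps [simp]:
  "Obj (regular C) = Obj C" "Arr (regular C) = Arr C" "Dom (regular C) = Dom C"
  "Cod (regular C) = Cod C" "Ide (regular C) = Ide C" "Comp (regular C) = Comp C"
  "ActO (regular C) = TensO C" "ActM (regular C) = TensM C" "Hom (regular C) = Hom C"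
  by (auto simp: regular_def Hom_def fun_eq_iff)

lemma regular_coequalizers [simp]:
  "coequalizer (regular C) = coequalizer C" "coeq (regular C) = coeq C"
  "has_coequalizers (regular C) = has_coequalizers C"
proof -
  show *: "coequalizer (regular C) = coequalizer C"
    by (simp add: coequalizer_def fun_eq_iff)
  show "coeq (regular C) = coeq C" "has_coequalizers (regular C) = has_coequalizers C"
    by (simp_all add: coeq_def has_coequalizers_def fun_eq_iff *)
qed

lemma (in strict_monoidal_category) right_category_regular: "right_category C (regular C)"
proof -
  have "category (regular C)"
    by unfold_locales (use B.Comp_Hom B.Comp_assoc in \<open>auto simp: in_Hom\<close>)
  then interpret R: category "regular C" .
  show ?thesis
    by unfold_locales (auto simp: in_Hom interchange)
qed

context right_category
begin

lemma ActO_Obj [simp]: "\<lbrakk>M \<in> Obj D; X \<in> Obj C\<rbrakk> \<Longrightarrow> M \<star> X \<in> Obj D"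
  by (rule FO_Obj)

lemma ActM_typing [simp]:
  assumes "h \<in> Arr D" "f \<in> Arr C"
  shows "h \<diamondop> f \<in> Arr D" "Dom D (h \<diamondop> f) = Dom D h \<star> Dom C f" "Cod D (h \<diamondop> f) = Cod D h \<star> Cod C f"
  using FM_Hom[of h "Dom D h" "Cod D h" f "Dom C f" "Cod C f"] assms by (auto simp: in_Hom)

lemma whisker_D_left:
  "\<lbrakk>f \<in> Arr C; g \<in> Arr C; Dom C g = Cod C f; M \<in> Obj D\<rbrakk>
    \<Longrightarrow> (Ide D M \<diamondop> g) \<cdot> (Ide D M \<diamondop> f) = Ide D M \<diamondop> (g \<cdot>\<^bsub>C\<^esub> f)"
  using FM_Comp[of "Ide D M" M M "Ide D M" M f "Dom C f" "Cod C f" g "Cod C g"]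
  by (auto simp: in_Hom)

lemma slide_D:
  "\<lbrakk>f \<in> Arr D; g \<in> Arr C\<rbrakk>
    \<Longrightarrow> (Ide D (Cod D f) \<diamondop> g) \<cdot> (f \<diamondop> Ide C (Dom C g)) = (f \<diamondop> Ide C (Cod C g)) \<cdot> (Ide D (Dom D f) \<diamondop> g)"
  using FM_Comp[of f "Dom D f" "Cod D f" "Ide D (Cod D f)" "Cod D f" "Ide C (Dom C g)" "Dom C g" "Dom C g" g "Cod C g"]
    FM_Comp[of "Ide D (Dom D f)" "Dom D f" "Dom D f" f "Cod D f" g "Dom C g" "Cod C g" "Ide C (Cod C g)" "Cod C g"]
  by (auto simp: in_Hom)

lemma ActM_Ide [simp]: "\<lbrakk>M \<in> Obj D; X \<in> Obj C\<rbrakk> \<Longrightarrow> Ide D M \<diamondop> Ide C X = Ide D (M \<star> X)"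
  by (rule FM_Ide)

lemma ActM_split_coequalizer:
  assumes "split_coequalizer C f g q s t" "M \<in> Obj D"
  shows "split_coequalizer D (Ide D M \<diamondop> f) (Ide D M \<diamondop> g) (Ide D M \<diamondop> q) (Ide D M \<diamondop> s) (Ide D M \<diamondop> t)"
  using assms by (simp add: split_coequalizer_def in_Hom whisker_D_left)

lemma coflat_TensO:
  assumes "coflat C D X" "coflat C D Y" "X \<in> Obj C" "Y \<in> Obj C"
  shows "coflat C D (X \<odot>\<^bsub>C\<^esub> Y)"
  unfolding coflat_def
proof (intro allI impI)
  fix f g q assume q: "coequalizer D f g q"
  then have "coequalizer D ((f \<diamondop> Ide C X) \<diamondop> Ide C Y) ((g \<diamondop> Ide C X) \<diamondop> Ide C Y) ((q \<diamondop> Ide C X) \<diamondop> Ide C Y)"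
    using assms by (simp add: coflat_def)
  with q assms show "coequalizer D (f \<diamondop> Ide C (X \<odot>\<^bsub>C\<^esub> Y)) (g \<diamondop> Ide C (X \<odot>\<^bsub>C\<^esub> Y)) (q \<diamondop> Ide C (X \<odot>\<^bsub>C\<^esub> Y))"
    by (simp add: coequalizer_def in_Hom ActM_assoc)
qed

lemma coflat_Unit: "coflat C D \<one>\<^bsub>C\<^esub>"
  by (auto simp: coflat_def coequalizer_def in_Hom ActM_Unit)

lemma coflat_iso:
  assumes X: "coflat C D X" and i: "i \<in> Hom C X Y" "j \<in> Hom C Y X" "j \<cdot>\<^bsub>C\<^esub> i = Ide C X" "i \<cdot>\<^bsub>C\<^esub> j = Ide C Y"
  shows "coflat C D Y"
  unfolding coflat_def
proof (intro allI impI)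
  fix f g q assume q: "coequalizer D f g q"
  have Q: "f \<in> Arr D" "g \<in> Arr D" "q \<in> Arr D" "Dom D g = Dom D f" "Cod D g = Cod D f" "Dom D q = Cod D f"
    using q by (auto simp: coequalizer_def in_Hom)
  have T [simp]: "i \<in> Arr C" "Dom C i = X" "Cod C i = Y" "j \<in> Arr C" "Dom C j = Y" "Cod C j = X"
    using i by (auto simp: in_Hom)
  have O [simp]: "X \<in> Obj C" "Y \<in> Obj C"
    using C.B.Dom_Obj[of i] C.B.Cod_Obj[of i] by auto
  have sl: "(h \<diamondop> Ide C Y) \<cdot> (Ide D M \<diamondop> i) = (Ide D N \<diamondop> i) \<cdot> (h \<diamondop> Ide C X)"
    if "h \<in> Hom D M N" for h M N
    using slide_D[of h i] that by (auto simp: in_Hom)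
  have "coequalizer D (f \<diamondop> Ide C X) (g \<diamondop> Ide C X) (q \<diamondop> Ide C X)"
    using X q by (simp add: coflat_def)
  then show "coequalizer D (f \<diamondop> Ide C Y) (g \<diamondop> Ide C Y) (q \<diamondop> Ide C Y)"
    by (rule B.coequalizer_transport[where u = "Ide D (Dom D f) \<diamondop> i" and u' = "Ide D (Dom D f) \<diamondop> j"
          and v = "Ide D (Cod D f) \<diamondop> i" and v' = "Ide D (Cod D f) \<diamondop> j"
          and w = "Ide D (Cod D q) \<diamondop> i" and w' = "Ide D (Cod D q) \<diamondop> j"])
      (use Q in \<open>auto simp: in_Hom whisker_D_left i sl\<close>)
qed

end

section \<open>Left linear maps between free modules\<close>

locale algebra_in = strict_monoidal_category C
  for C :: "('o, 'm) moncat" (structure) +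
  fixes A :: 'o and m e :: 'm
  assumes alg: "algebra C A m e"
begin

lemma A_Obj [simp]: "A \<in> Obj C"
  using alg by (simp add: algebra_def)

lemma alg_typing [simp]:
  "m \<in> Arr C" "Dom C m = A \<odot> A" "Cod C m = A" "e \<in> Arr C" "Dom C e = \<one>" "Cod C e = A"
  using alg by (auto simp: algebra_def in_Hom)

lemma m_assoc: "m \<cdot> (m \<otimes> Ide C A) = m \<cdot> (Ide C A \<otimes> m)"
  using alg by (simp add: algebra_def Assoc_Ide assoc)

lemma m_unit: "m \<cdot> (e \<otimes> Ide C A) = Ide C A" "m \<cdot> (Ide C A \<otimes> e) = Ide C A"
  using alg by (auto simp: algebra_def LUnit_Ide RUnit_Ide)

text \<open>The Kleisli extension of \<open>\<rho> : V \<rightarrow> A \<odot> W\<close> for the monad \<open>A \<odot> -\<close>. The object \<open>W\<close> is an argument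
  because it cannot be recovered from the codomain \<open>A \<odot> W\<close>.\<close>

definition lift :: "'o \<Rightarrow> 'm \<Rightarrow> 'm" where
  "lift W \<rho> = (m \<otimes> Ide C W) \<cdot> (Ide C A \<otimes> \<rho>)"

lemma lift_typing [simp]:
  assumes "\<rho> \<in> Arr C" "Cod C \<rho> = A \<odot> W" "W \<in> Obj C"
  shows "lift W \<rho> \<in> Arr C" "Dom C (lift W \<rho>) = A \<odot> Dom C \<rho>" "Cod C (lift W \<rho>) = A \<odot> W"
  using assms by (auto simp: lift_def)

lemma m_unit_whiskered:
  assumes "W \<in> Obj C"
  shows "(m \<otimes> Ide C W) \<cdot> (e \<otimes> Ide C (A \<odot> W)) = Ide C (A \<odot> W)"
    "(m \<otimes> Ide C W) \<cdot> (Ide C A \<otimes> e \<otimes> Ide C W) = Ide C (A \<odot> W)"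
  using arg_cong[OF m_unit(1), of "\<lambda>z. z \<otimes> Ide C W"] arg_cong[OF m_unit(2), of "\<lambda>z. z \<otimes> Ide C W"] assms
  by (simp_all add: whisker_right)

lemma m_assoc_whiskered:
  assumes "W \<in> Obj C"
  shows "(m \<otimes> Ide C W) \<cdot> (m \<otimes> Ide C (A \<odot> W)) = (m \<otimes> Ide C W) \<cdot> (Ide C A \<otimes> m \<otimes> Ide C W)"
  using arg_cong[OF m_assoc, of "\<lambda>z. z \<otimes> Ide C W"] assms
  by (simp add: whisker_right)

lemma lift_unit:
  assumes "\<rho> \<in> Arr C" "Cod C \<rho> = A \<odot> W" "W \<in> Obj C" "Dom C \<rho> = V"
  shows "lift W \<rho> \<cdot> (e \<otimes> Ide C V) = \<rho>"
proof -
  have "lift W \<rho> \<cdot> (e \<otimes> Ide C V) = (m \<otimes> Ide C W) \<cdot> (Ide C A \<otimes> \<rho>) \<cdot> (e \<otimes> Ide C V)"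
    using assms by (auto simp: lift_def assoc)
  also have "\<dots> = (m \<otimes> Ide C W) \<cdot> (e \<otimes> Ide C (A \<odot> W)) \<cdot> \<rho>"
    using assms by (simp add: slide)
  also have "\<dots> = \<rho>"
    using assms by (simp add: assoc[symmetric] m_unit_whiskered)
  finally show ?thesis .
qed

lemma lift_linear:
  assumes "\<rho> \<in> Arr C" "Cod C \<rho> = A \<odot> W" "W \<in> Obj C" "Dom C \<rho> = V"
  shows "lift W \<rho> \<cdot> (m \<otimes> Ide C V) = (m \<otimes> Ide C W) \<cdot> (Ide C A \<otimes> lift W \<rho>)"
proof -
  have V: "V \<in> Obj C" using assms by auto
  have "lift W \<rho> \<cdot> (m \<otimes> Ide C V) = (m \<otimes> Ide C W) \<cdot> (Ide C A \<otimes> \<rho>) \<cdot> (m \<otimes> Ide C V)"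
    using assms V by (simp add: lift_def assoc)
  also have "\<dots> = ((m \<otimes> Ide C W) \<cdot> (m \<otimes> Ide C (A \<odot> W))) \<cdot> (Ide C (A \<odot> A) \<otimes> \<rho>)"
    using assms by (simp add: slide assoc)
  also have "\<dots> = (m \<otimes> Ide C W) \<cdot> (Ide C A \<otimes> lift W \<rho>)"
    using assms by (simp add: m_assoc_whiskered lift_def whisker_left assoc)
  finally show ?thesis .
qed

lemma lift_Comp_whisker:
  assumes "\<rho> \<in> Arr C" "Cod C \<rho> = A \<odot> W" "W \<in> Obj C" "g \<in> Arr C" "Dom C \<rho> = Cod C g"
  shows "lift W \<rho> \<cdot> (Ide C A \<otimes> g) = lift W (\<rho> \<cdot> g)"
  using assms by (simp add: lift_def whisker_left assoc)

lemma lift_lift: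
  assumes "\<rho> \<in> Arr C" "Cod C \<rho> = A \<odot> W" "W \<in> Obj C" "\<sigma> \<in> Arr C" "Cod C \<sigma> = A \<odot> V" "Dom C \<rho> = V"
  shows "lift W \<rho> \<cdot> lift V \<sigma> = lift W (lift W \<rho> \<cdot> \<sigma>)"
proof -
  have V: "V \<in> Obj C" using assms by auto
  have "lift W \<rho> \<cdot> lift V \<sigma> = (lift W \<rho> \<cdot> (m \<otimes> Ide C V)) \<cdot> (Ide C A \<otimes> \<sigma>)"
    using assms V by (simp add: lift_def[of V] assoc)
  also have "\<dots> = (m \<otimes> Ide C W) \<cdot> (Ide C A \<otimes> lift W \<rho>) \<cdot> (Ide C A \<otimes> \<sigma>)"
    using assms V by (simp add: lift_linear assoc)
  also have "\<dots> = lift W (lift W \<rho> \<cdot> \<sigma>)"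
    using assms V by (simp add: lift_def[of W "lift W \<rho> \<cdot> \<sigma>"] whisker_left)
  finally show ?thesis .
qed

lemma lift_of_unit: "W \<in> Obj C \<Longrightarrow> lift W (e \<otimes> Ide C W) = Ide C (A \<odot> W)"
  by (simp add: lift_def m_unit_whiskered)

lemma lift_whisker_right:
  assumes "\<rho> \<in> Arr C" "Cod C \<rho> = A \<odot> W" "W \<in> Obj C" "Z \<in> Obj C"
  shows "lift W \<rho> \<otimes> Ide C Z = lift (W \<odot> Z) (\<rho> \<otimes> Ide C Z)"
  using assms by (simp add: lift_def whisker_right)

text \<open>A left linear map out of \<open>A \<odot> V\<close> is determined by its restriction along the unit, since
  \<open>f = f \<cdot> (m \<otimes> V) \<cdot> (A \<otimes> e \<otimes> V)\<close> and linearity moves \<open>f\<close> inside.\<close>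

lemma linear_is_lift:
  assumes "f \<in> Hom C (A \<odot> V) (A \<odot> W)" "V \<in> Obj C" "W \<in> Obj C"
    and "f \<cdot> (m \<otimes> Ide C V) = (m \<otimes> Ide C W) \<cdot> (Ide C A \<otimes> f)"
  shows "lift W (f \<cdot> (e \<otimes> Ide C V)) = f"
proof -
  have "lift W (f \<cdot> (e \<otimes> Ide C V)) = ((m \<otimes> Ide C W) \<cdot> (Ide C A \<otimes> f)) \<cdot> (Ide C A \<otimes> e \<otimes> Ide C V)"
    using assms by (simp add: lift_def whisker_left assoc in_Hom)
  also have "\<dots> = f \<cdot> (m \<otimes> Ide C V) \<cdot> (Ide C A \<otimes> e \<otimes> Ide C V)"
    using assms(1-3) by (simp add: assms(4)[symmetric] assoc in_Hom)
  also have "\<dots> = f"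
    using assms by (simp add: m_unit_whiskered in_Hom)
  finally show ?thesis .
qed

lemma lift_inject:
  assumes "\<rho> \<in> Hom C V (A \<odot> W)" "\<sigma> \<in> Hom C V (A \<odot> W)" "W \<in> Obj C"
  shows "lift W \<rho> = lift W \<sigma> \<longleftrightarrow> \<rho> = \<sigma>"
proof
  assume eq: "lift W \<rho> = lift W \<sigma>"
  have "\<rho> = lift W \<rho> \<cdot> (e \<otimes> Ide C V)" using assms by (simp add: lift_unit in_Hom)
  also have "\<dots> = \<sigma>" unfolding eq using assms by (simp add: lift_unit in_Hom)
  finally show "\<rho> = \<sigma>" .
qed simp

end

section \<open>The category EM in Kleisli form\<close>

context algebra_in
begin

text \<open>The axioms of \<open>EM\<close> rewritten with \<open>lift\<close>, so that the laws of Kleisli extension apply.\<close>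

lemma em_objects_iff:
  "(X, \<psi>) \<in> em_objects C A m e \<longleftrightarrow> X \<in> Obj C \<and> \<psi> \<in> Hom C (X \<odot> A) (A \<odot> X) \<and>
    \<psi> \<cdot> (Ide C X \<otimes> m) = lift X \<psi> \<cdot> (\<psi> \<otimes> Ide C A) \<and> \<psi> \<cdot> (Ide C X \<otimes> e) = e \<otimes> Ide C X"
  by (auto simp: em_objects_def in_Hom lift_def assoc)

lemma em_objectD:
  assumes "(X, \<psi>) \<in> em_objects C A m e"
  shows "X \<in> Obj C" "\<psi> \<in> Arr C" "Dom C \<psi> = X \<odot> A" "Cod C \<psi> = A \<odot> X"
    and "\<psi> \<cdot> (Ide C X \<otimes> m) = lift X \<psi> \<cdot> (\<psi> \<otimes> Ide C A)" "\<psi> \<cdot> (Ide C X \<otimes> e) = e \<otimes> Ide C X"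
  using assms by (auto simp: em_objects_iff in_Hom)

lemma em_arrow_iff:
  assumes "(X, \<psi>) \<in> em_objects C A m e" "(Y, \<phi>) \<in> em_objects C A m e"
  shows "em_arrow C A m (X, \<psi>) (Y, \<phi>) \<rho> \<longleftrightarrow> \<rho> \<in> Hom C X (A \<odot> Y) \<and>
    lift Y \<rho> \<cdot> \<psi> = lift Y \<phi> \<cdot> (\<rho> \<otimes> Ide C A)"
  using em_objectD(1-4)[OF assms(1)] em_objectD(1-4)[OF assms(2)]
  by (auto simp: em_arrow_def in_Hom lift_def assoc)

lemma em_unit_object: "(\<one>, Ide C A) \<in> em_objects C A m e"
  by (simp add: em_objects_iff in_Hom lift_def)

text \<open>The first axiom on \<open>\<psi>\<close> says that tensoring with \<open>X\<close> on the left extends to Kleisli maps. This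
  is the law behind the tensor product of \<open>EM\<close>.\<close>

lemma em_distributes:
  assumes K: "(X, \<psi>) \<in> em_objects C A m e" and Y: "Y \<in> Obj C"
    and g: "g \<in> Arr C" "Dom C g = V" "Cod C g = A \<odot> Y"
  shows "(\<psi> \<otimes> Ide C Y) \<cdot> (Ide C X \<otimes> lift Y g) = lift (X \<odot> Y) ((\<psi> \<otimes> Ide C Y) \<cdot> (Ide C X \<otimes> g)) \<cdot> (\<psi> \<otimes> Ide C V)"
proof -
  note [simp] = em_objectD(1-4)[OF K] Y g(1,3)
  have [simp]: "V \<in> Obj C" "Dom C g = V" using g by auto
  have "(\<psi> \<otimes> Ide C Y) \<cdot> (Ide C X \<otimes> lift Y g)
      = ((\<psi> \<cdot> (Ide C X \<otimes> m)) \<otimes> Ide C Y) \<cdot> (Ide C (X \<odot> A) \<otimes> g)"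
    by (simp add: lift_def whisker_left whisker_right assoc)
  also have "\<dots> = lift (X \<odot> Y) (\<psi> \<otimes> Ide C Y) \<cdot> (\<psi> \<otimes> Ide C (A \<odot> Y)) \<cdot> (Ide C (X \<odot> A) \<otimes> g)"
    unfolding em_objectD(5)[OF K] by (simp add: whisker_right lift_whisker_right assoc)
  also have "\<dots> = lift (X \<odot> Y) (\<psi> \<otimes> Ide C Y) \<cdot> (Ide C (A \<odot> X) \<otimes> g) \<cdot> (\<psi> \<otimes> Ide C V)"
    by (simp add: slide)
  also have "\<dots> = (lift (X \<odot> Y) (\<psi> \<otimes> Ide C Y) \<cdot> (Ide C A \<otimes> Ide C X \<otimes> g)) \<cdot> (\<psi> \<otimes> Ide C V)"
    by (simp add: assoc)
  also have "\<dots> = lift (X \<odot> Y) ((\<psi> \<otimes> Ide C Y) \<cdot> (Ide C X \<otimes> g)) \<cdot> (\<psi> \<otimes> Ide C V)"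
    by (subst lift_Comp_whisker) auto
  finally show ?thesis .
qed

lemma em_tensor_object:
  assumes K: "(X, \<psi>) \<in> em_objects C A m e" and L: "(Y, \<phi>) \<in> em_objects C A m e"
  shows "em_tensor C (X, \<psi>) (Y, \<phi>) \<in> em_objects C A m e"
proof -
  note [simp] = em_objectD(1-4)[OF K] em_objectD(1-4)[OF L]
  let ?\<psi> = "(\<psi> \<otimes> Ide C Y) \<cdot> (Ide C X \<otimes> \<phi>)"
  have "?\<psi> \<cdot> (Ide C (X \<odot> Y) \<otimes> m) = (\<psi> \<otimes> Ide C Y) \<cdot> (Ide C X \<otimes> (\<phi> \<cdot> (Ide C Y \<otimes> m)))"
    by (simp add: whisker_left assoc)
  also have "\<dots> = ((\<psi> \<otimes> Ide C Y) \<cdot> (Ide C X \<otimes> lift Y \<phi>)) \<cdot> (Ide C X \<otimes> \<phi> \<otimes> Ide C A)"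
    unfolding em_objectD(5)[OF L] by (simp add: whisker_left assoc)
  also have "\<dots> = lift (X \<odot> Y) ?\<psi> \<cdot> (?\<psi> \<otimes> Ide C A)"
    by (simp add: em_distributes[OF K] whisker_right assoc)
  finally have 1: "?\<psi> \<cdot> (Ide C (X \<odot> Y) \<otimes> m) = lift (X \<odot> Y) ?\<psi> \<cdot> (?\<psi> \<otimes> Ide C A)" .
  have "?\<psi> \<cdot> (Ide C (X \<odot> Y) \<otimes> e) = (\<psi> \<otimes> Ide C Y) \<cdot> (Ide C X \<otimes> (\<phi> \<cdot> (Ide C Y \<otimes> e)))"
    by (simp add: whisker_left assoc)
  also have "\<dots> = (\<psi> \<cdot> (Ide C X \<otimes> e)) \<otimes> Ide C Y"
    unfolding em_objectD(6)[OF L] by (simp add: whisker_right)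
  also have "\<dots> = e \<otimes> Ide C (X \<odot> Y)"
    unfolding em_objectD(6)[OF K] by simp
  finally show ?thesis
    using 1 by (simp add: em_tensor_def em_objects_iff in_Hom)
qed

abbreviation "EM \<equiv> EM_cat C A m e"

lemma EM_Comp:
  assumes "\<rho> \<in> Arr C" "\<rho>' \<in> Arr C" "Cod C \<rho> = A \<odot> Dom C \<rho>'" "Cod C \<rho>' = A \<odot> Z" "Z \<in> Obj C"
  shows "SArr t (Z, \<gamma>) \<rho>' \<cdot>\<^bsub>EM\<^esub> SArr s t' \<rho> = SArr s (Z, \<gamma>) (lift Z \<rho>' \<cdot> \<rho>)"
  using assms by (simp add: EM_cat_def lift_def assoc)

text \<open>In the tensor product of \<open>\<rho>\<close> with an identity the entwining \<open>\<beta>\<close> only meets a unit of \<open>A\<close>, and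
  the unit axiom makes it disappear.\<close>

lemma EM_whisker_right:
  assumes L: "(W, \<beta>) \<in> em_objects C A m e" and "X \<in> Obj C" "\<rho> \<in> Arr C" "Cod C \<rho> = A \<odot> W"
  shows "SArr s (W, \<beta>) \<rho> \<otimes>\<^bsub>EM\<^esub> em_ide C e (X, \<psi>)
    = SArr (em_tensor C s (X, \<psi>)) (em_tensor C (W, \<beta>) (X, \<psi>)) (\<rho> \<otimes> Ide C X)"
proof -
  note [simp] = em_objectD(1-4)[OF L] assms(2-4)
  have [simp]: "Dom C \<rho> \<in> Obj C" by simp
  have "\<rho> \<otimes> e \<otimes> Ide C X = (Ide C A \<otimes> Ide C W \<otimes> e \<otimes> Ide C X) \<cdot> (\<rho> \<otimes> Ide C X)"
    using interchange[of \<rho> "Ide C X" "Ide C (A \<odot> W)" "e \<otimes> Ide C X"] by simp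
  then have "(m \<otimes> Ide C W \<otimes> Ide C X) \<cdot> (Ide C A \<otimes> \<beta> \<otimes> Ide C X) \<cdot> (\<rho> \<otimes> e \<otimes> Ide C X)
      = (lift (W \<odot> X) (\<beta> \<otimes> Ide C X) \<cdot> (Ide C A \<otimes> Ide C W \<otimes> e \<otimes> Ide C X)) \<cdot> (\<rho> \<otimes> Ide C X)"
    by (simp add: lift_def assoc)
  also have "\<dots> = lift (W \<odot> X) ((\<beta> \<cdot> (Ide C W \<otimes> e)) \<otimes> Ide C X) \<cdot> (\<rho> \<otimes> Ide C X)"
    by (subst lift_Comp_whisker) (auto simp: whisker_right)
  also have "\<dots> = \<rho> \<otimes> Ide C X"
    unfolding em_objectD(6)[OF L] by (simp add: lift_of_unit)
  finally show ?thesis by (simp add: EM_cat_def em_ide_def)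
qed

lemma EM_whisker_left:
  assumes K: "(X, \<psi>) \<in> em_objects C A m e" and "W \<in> Obj C" "\<rho> \<in> Arr C" "Cod C \<rho> = A \<odot> W"
  shows "em_ide C e (X, \<psi>) \<otimes>\<^bsub>EM\<^esub> SArr s (W, \<beta>) \<rho>
    = SArr (em_tensor C (X, \<psi>) s) (em_tensor C (X, \<psi>) (W, \<beta>)) ((\<psi> \<otimes> Ide C W) \<cdot> (Ide C X \<otimes> \<rho>))"
proof -
  note [simp] = em_objectD(1-4)[OF K] assms(2-4)
  have [simp]: "Dom C \<rho> \<in> Obj C" by simp
  have "e \<otimes> Ide C X \<otimes> \<rho> = (e \<otimes> Ide C (X \<odot> A \<odot> W)) \<cdot> (Ide C X \<otimes> \<rho>)"
    using interchange[of "Ide C \<one>" "Ide C X \<otimes> \<rho>" e "Ide C (X \<odot> A \<odot> W)"] by simp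
  then have "(m \<otimes> Ide C X \<otimes> Ide C W) \<cdot> (Ide C A \<otimes> \<psi> \<otimes> Ide C W) \<cdot> (e \<otimes> Ide C X \<otimes> \<rho>)
      = (lift (X \<odot> W) (\<psi> \<otimes> Ide C W) \<cdot> (e \<otimes> Ide C (X \<odot> A \<odot> W))) \<cdot> (Ide C X \<otimes> \<rho>)"
    by (simp add: lift_def assoc)
  also have "\<dots> = (\<psi> \<otimes> Ide C W) \<cdot> (Ide C X \<otimes> \<rho>)"
    by (subst lift_unit) auto
  finally show ?thesis by (simp add: EM_cat_def em_ide_def)
qed

lemma em_tensor_unit:
  assumes "(X, \<psi>) \<in> em_objects C A m e"
  shows "em_tensor C (\<one>, Ide C A) (X, \<psi>) = (X, \<psi>)" "em_tensor C (X, \<psi>) (\<one>, Ide C A) = (X, \<psi>)"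
  using em_objectD(1-4)[OF assms] by (simp_all add: em_tensor_def)

lemma em_tensor_assoc:
  assumes "(X, \<psi>) \<in> em_objects C A m e" "(Y, \<phi>) \<in> em_objects C A m e" "(Z, \<gamma>) \<in> em_objects C A m e"
  shows "em_tensor C (em_tensor C (X, \<psi>) (Y, \<phi>)) (Z, \<gamma>) = em_tensor C (X, \<psi>) (em_tensor C (Y, \<phi>) (Z, \<gamma>))"
  using em_objectD(1-4)[OF assms(1)] em_objectD(1-4)[OF assms(2)] em_objectD(1-4)[OF assms(3)]
  by (simp add: em_tensor_def whisker_left whisker_right assoc)

lemma EM_arrow:
  "f \<in> Hom EM K L \<longleftrightarrow> K \<in> em_objects C A m e \<and> L \<in> em_objects C A m e \<and>
    (\<exists>\<rho>. f = SArr K L \<rho> \<and> em_arrow C A m K L \<rho>)"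
  by (cases f) (auto simp: in_Hom EM_cat_def)

lemma EM_simps:
  "Obj EM = em_objects C A m e" "Ide EM = em_ide C e" "\<one>\<^bsub>EM\<^esub> = (\<one>, Ide C A)"
  "TensO EM = em_tensor C" "LUnit EM = em_ide C e" "RUnit EM = em_ide C e"
  "Assoc EM K L M = em_ide C e (em_tensor C K (em_tensor C L M))"
  by (simp_all add: EM_cat_def)

text \<open>Associativity and unit constraints of \<open>EM\<close> are identities, so the axioms of an algebra reduce
  to Kleisli equations.\<close>

lemma EM_algebra_iff:
  assumes K: "(X, \<psi>) \<in> em_objects C A m e"
    and \<sigma>: "em_arrow C A m (em_tensor C (X, \<psi>) (X, \<psi>)) (X, \<psi>) \<sigma>"
    and u: "em_arrow C A m (\<one>, Ide C A) (X, \<psi>) u"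
  shows "algebra EM (X, \<psi>) (SArr (em_tensor C (X, \<psi>) (X, \<psi>)) (X, \<psi>) \<sigma>) (SArr (\<one>, Ide C A) (X, \<psi>) u)
    \<longleftrightarrow> lift X \<sigma> \<cdot> (\<sigma> \<otimes> Ide C X) = lift X \<sigma> \<cdot> (\<psi> \<otimes> Ide C X) \<cdot> (Ide C X \<otimes> \<sigma>) \<and>
      lift X \<sigma> \<cdot> (u \<otimes> Ide C X) = e \<otimes> Ide C X \<and>
      lift X \<sigma> \<cdot> (\<psi> \<otimes> Ide C X) \<cdot> (Ide C X \<otimes> u) = e \<otimes> Ide C X"
proof -
  note [simp] = em_objectD(1-4)[OF K]
  note K2 = em_tensor_object[OF K K]
  have [simp]: "\<sigma> \<in> Arr C" "Dom C \<sigma> = X \<odot> X" "Cod C \<sigma> = A \<odot> X" "u \<in> Arr C" "Dom C u = \<one>" "Cod C u = A \<odot> X"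
    using \<sigma> u by (auto simp: em_arrow_def em_tensor_def in_Hom)
  let ?K = "(X, \<psi>)" let ?K2 = "em_tensor C ?K ?K" let ?K3 = "em_tensor C ?K ?K2"
  let ?m = "SArr ?K2 ?K \<sigma>" and ?u = "SArr (\<one>, Ide C A) ?K u"
  have 1: "?m \<cdot>\<^bsub>EM\<^esub> (?m \<otimes>\<^bsub>EM\<^esub> em_ide C e ?K) = SArr ?K3 ?K (lift X \<sigma> \<cdot> (\<sigma> \<otimes> Ide C X))"
    by (simp add: EM_whisker_right[OF K] EM_Comp em_tensor_assoc[OF K K K])
  have "lift (X \<odot> X) ((\<psi> \<otimes> Ide C X) \<cdot> (Ide C X \<otimes> \<sigma>)) \<cdot> (e \<otimes> Ide C (X \<odot> X \<odot> X)) = (\<psi> \<otimes> Ide C X) \<cdot> (Ide C X \<otimes> \<sigma>)"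
    by (simp add: lift_unit)
  then have 2: "?m \<cdot>\<^bsub>EM\<^esub> ((em_ide C e ?K \<otimes>\<^bsub>EM\<^esub> ?m) \<cdot>\<^bsub>EM\<^esub> em_ide C e ?K3)
      = SArr ?K3 ?K (lift X \<sigma> \<cdot> (\<psi> \<otimes> Ide C X) \<cdot> (Ide C X \<otimes> \<sigma>))"
    by (simp add: EM_whisker_left[OF K]) (simp add: em_tensor_def em_ide_def EM_Comp)
  have 3: "?m \<cdot>\<^bsub>EM\<^esub> (?u \<otimes>\<^bsub>EM\<^esub> em_ide C e ?K) = SArr ?K ?K (lift X \<sigma> \<cdot> (u \<otimes> Ide C X))"
    by (simp add: EM_whisker_right[OF K] EM_Comp em_tensor_unit[OF K])
  have 4: "?m \<cdot>\<^bsub>EM\<^esub> (em_ide C e ?K \<otimes>\<^bsub>EM\<^esub> ?u)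
      = SArr ?K ?K (lift X \<sigma> \<cdot> (\<psi> \<otimes> Ide C X) \<cdot> (Ide C X \<otimes> u))"
    by (simp add: EM_whisker_left[OF K] EM_Comp em_tensor_unit[OF K])
  show ?thesis
    unfolding algebra_def EM_simps 1 2 3 4
    using K K2 \<sigma> u em_unit_object by (auto simp: EM_arrow em_ide_def)
qed

lemma EM_coalgebra_iff:
  assumes K: "(X, \<psi>) \<in> em_objects C A m e"
    and \<rho>: "em_arrow C A m (X, \<psi>) (em_tensor C (X, \<psi>) (X, \<psi>)) \<rho>"
    and \<omega>: "em_arrow C A m (X, \<psi>) (\<one>, Ide C A) \<omega>"
  shows "coalgebra EM (X, \<psi>) (SArr (X, \<psi>) (em_tensor C (X, \<psi>) (X, \<psi>)) \<rho>) (SArr (X, \<psi>) (\<one>, Ide C A) \<omega>)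
    \<longleftrightarrow> lift (X \<odot> X \<odot> X) (\<rho> \<otimes> Ide C X) \<cdot> \<rho> = lift (X \<odot> X \<odot> X) ((\<psi> \<otimes> Ide C (X \<odot> X)) \<cdot> (Ide C X \<otimes> \<rho>)) \<cdot> \<rho> \<and>
      lift X (\<omega> \<otimes> Ide C X) \<cdot> \<rho> = e \<otimes> Ide C X \<and>
      lift X (\<psi> \<cdot> (Ide C X \<otimes> \<omega>)) \<cdot> \<rho> = e \<otimes> Ide C X"
proof -
  note [simp] = em_objectD(1-4)[OF K]
  note K2 = em_tensor_object[OF K K]
  have [simp]: "\<rho> \<in> Arr C" "Dom C \<rho> = X" "Cod C \<rho> = A \<odot> X \<odot> X" "\<omega> \<in> Arr C" "Dom C \<omega> = X" "Cod C \<omega> = A"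
    using \<rho> \<omega> by (auto simp: em_arrow_def em_tensor_def in_Hom)
  let ?K = "(X, \<psi>)" let ?K2 = "em_tensor C ?K ?K" let ?K3 = "em_tensor C ?K ?K2"
  let ?d = "SArr ?K ?K2 \<rho>" and ?w = "SArr ?K (\<one>, Ide C A) \<omega>"
  have K2': "(X \<odot> X, (\<psi> \<otimes> Ide C X) \<cdot> (Ide C X \<otimes> \<psi>)) \<in> em_objects C A m e"
    using K2 by (simp add: em_tensor_def)
  have 0: "?d \<otimes>\<^bsub>EM\<^esub> em_ide C e ?K = SArr ?K2 (em_tensor C ?K2 ?K) (\<rho> \<otimes> Ide C X)"
    using EM_whisker_right[OF K2', of X \<rho> ?K \<psi>] by (simp add: em_tensor_def)
  have 1: "em_ide C e ?K3 \<cdot>\<^bsub>EM\<^esub> ((?d \<otimes>\<^bsub>EM\<^esub> em_ide C e ?K) \<cdot>\<^bsub>EM\<^esub> ?d)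
      = SArr ?K ?K3 (lift (X \<odot> X \<odot> X) (\<rho> \<otimes> Ide C X) \<cdot> \<rho>)"
    unfolding 0 by (simp add: em_tensor_def em_ide_def EM_Comp lift_of_unit)
  have 2: "(em_ide C e ?K \<otimes>\<^bsub>EM\<^esub> ?d) \<cdot>\<^bsub>EM\<^esub> ?d
      = SArr ?K ?K3 (lift (X \<odot> X \<odot> X) ((\<psi> \<otimes> Ide C (X \<odot> X)) \<cdot> (Ide C X \<otimes> \<rho>)) \<cdot> \<rho>)"
    using EM_whisker_left[OF K, of "X \<odot> X" \<rho> ?K] by (simp add: em_tensor_def EM_Comp)
  have 3: "em_ide C e ?K \<cdot>\<^bsub>EM\<^esub> ((?w \<otimes>\<^bsub>EM\<^esub> em_ide C e ?K) \<cdot>\<^bsub>EM\<^esub> ?d)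
      = SArr ?K ?K (lift X (\<omega> \<otimes> Ide C X) \<cdot> \<rho>)"
    using EM_whisker_right[OF em_unit_object, of X \<omega> ?K \<psi>]
    by (simp add: em_tensor_unit[OF K] em_ide_def EM_Comp lift_of_unit)
  have 4: "em_ide C e ?K \<cdot>\<^bsub>EM\<^esub> ((em_ide C e ?K \<otimes>\<^bsub>EM\<^esub> ?w) \<cdot>\<^bsub>EM\<^esub> ?d)
      = SArr ?K ?K (lift X (\<psi> \<cdot> (Ide C X \<otimes> \<omega>)) \<cdot> \<rho>)"
    using EM_whisker_left[OF K, of \<one> \<omega> ?K "Ide C A"]
    by (simp add: em_tensor_unit[OF K] em_ide_def EM_Comp lift_of_unit)
  show ?thesis
    unfolding coalgebra_def EM_simps 1 2 3 4
    using K K2 \<rho> \<omega> em_unit_object by (auto simp: EM_arrow em_ide_def)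
qed

end

section \<open>Tensoring over A with a free module\<close>

context algebra_in
begin

lemma right_module_iff:
  "right_module C A m e (regular C) M \<nu> \<longleftrightarrow> M \<in> Obj C \<and> \<nu> \<in> Hom C (M \<odot> A) M \<and>
    \<nu> \<cdot> (\<nu> \<otimes> Ide C A) = \<nu> \<cdot> (Ide C M \<otimes> m) \<and> \<nu> \<cdot> (Ide C M \<otimes> e) = Ide C M"
  by (auto simp: right_module_def)

lemma right_moduleD:
  assumes "right_module C A m e (regular C) M \<nu>"
  shows "M \<in> Obj C" "\<nu> \<in> Arr C" "Dom C \<nu> = M \<odot> A" "Cod C \<nu> = M"
  using assms by (auto simp: right_module_iff in_Hom)

lemma right_module_assoc_whiskered:
  assumes "right_module C A m e (regular C) M \<nu>" "W \<in> Obj C"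
  shows "(\<nu> \<otimes> Ide C W) \<cdot> (\<nu> \<otimes> Ide C (A \<odot> W)) = (\<nu> \<otimes> Ide C W) \<cdot> (Ide C M \<otimes> m \<otimes> Ide C W)"
    "(\<nu> \<otimes> Ide C W) \<cdot> (Ide C M \<otimes> e \<otimes> Ide C W) = Ide C (M \<odot> W)"
proof -
  have [simp]: "M \<in> Obj C" "\<nu> \<in> Arr C" "Dom C \<nu> = M \<odot> A" "Cod C \<nu> = M"
    and ax: "\<nu> \<cdot> (\<nu> \<otimes> Ide C A) = \<nu> \<cdot> (Ide C M \<otimes> m)" "\<nu> \<cdot> (Ide C M \<otimes> e) = Ide C M"
    using assms(1) by (auto simp: right_module_iff in_Hom)
  show "(\<nu> \<otimes> Ide C W) \<cdot> (\<nu> \<otimes> Ide C (A \<odot> W)) = (\<nu> \<otimes> Ide C W) \<cdot> (Ide C M \<otimes> m \<otimes> Ide C W)"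
    using arg_cong[OF ax(1), of "\<lambda>z. z \<otimes> Ide C W"] assms(2) by (simp add: whisker_right)
  show "(\<nu> \<otimes> Ide C W) \<cdot> (Ide C M \<otimes> e \<otimes> Ide C W) = Ide C (M \<odot> W)"
    using arg_cong[OF ax(2), of "\<lambda>z. z \<otimes> Ide C W"] assms(2) by (simp add: whisker_right)
qed

text \<open>For a right module \<open>M\<close> the action plays the part of \<open>m\<close>: associativity of the action turns a
  whiskered Kleisli extension into an action before and after \<open>\<sigma>\<close>.\<close>

lemma act_lift:
  assumes M: "right_module C A m e (regular C) M \<nu>" and "V \<in> Obj C"
    and "\<sigma> \<in> Arr C" "Dom C \<sigma> = W" "Cod C \<sigma> = A \<odot> V"
  shows "(\<nu> \<otimes> Ide C V) \<cdot> (Ide C M \<otimes> lift V \<sigma>) = (\<nu> \<otimes> Ide C V) \<cdot> (Ide C M \<otimes> \<sigma>) \<cdot> (\<nu> \<otimes> Ide C W)"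
proof -
  note [simp] = assms(2,3,5) right_moduleD[OF M]
  have [simp]: "W \<in> Obj C" "Dom C \<sigma> = W" using assms by auto
  have "(\<nu> \<otimes> Ide C V) \<cdot> (Ide C M \<otimes> lift V \<sigma>)
      = ((\<nu> \<otimes> Ide C V) \<cdot> (Ide C M \<otimes> m \<otimes> Ide C V)) \<cdot> (Ide C (M \<odot> A) \<otimes> \<sigma>)"
    by (simp add: lift_def whisker_left assoc)
  also have "\<dots> = (\<nu> \<otimes> Ide C V) \<cdot> (\<nu> \<otimes> Ide C (A \<odot> V)) \<cdot> (Ide C (M \<odot> A) \<otimes> \<sigma>)"
    by (simp add: right_module_assoc_whiskered[OF M, symmetric] assoc)
  also have "\<dots> = (\<nu> \<otimes> Ide C V) \<cdot> (Ide C M \<otimes> \<sigma>) \<cdot> (\<nu> \<otimes> Ide C W)"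
    by (simp add: slide)
  finally show ?thesis .
qed

text \<open>An isomorphism \<open>\<theta>\<close>, with inverse \<open>\<theta>'\<close>, of a left module \<open>(Q, \<mu>)\<close> with the free module
  \<open>A \<odot> W\<close>. Linearity of \<open>\<theta>\<close> is expressed by saying that \<open>\<mu>\<close> is the transported action. Modules
  isomorphic to free ones are needed, and not only free ones, because a tensor product over \<open>A\<close> of
  free bimodules is a chosen object.\<close>

definition frame :: "'o \<Rightarrow> 'm \<Rightarrow> 'o \<Rightarrow> 'm \<Rightarrow> 'm \<Rightarrow> bool" where
  "frame Q \<mu> W \<theta> \<theta>' \<longleftrightarrow> W \<in> Obj C \<and> \<theta> \<in> Hom C (A \<odot> W) Q \<and> \<theta>' \<in> Hom C Q (A \<odot> W) \<and>
    \<theta>' \<cdot> \<theta> = Ide C (A \<odot> W) \<and> \<theta> \<cdot> \<theta>' = Ide C Q \<and>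
    \<mu> = \<theta> \<cdot> (m \<otimes> Ide C W) \<cdot> (Ide C A \<otimes> \<theta>')"

lemma frame_typing:
  assumes "frame Q \<mu> W \<theta> \<theta>'"
  shows "W \<in> Obj C" "Q \<in> Obj C" "\<theta> \<in> Arr C" "Dom C \<theta> = A \<odot> W" "Cod C \<theta> = Q"
    "\<theta>' \<in> Arr C" "Dom C \<theta>' = Q" "Cod C \<theta>' = A \<odot> W" "\<mu> \<in> Arr C" "Dom C \<mu> = A \<odot> Q" "Cod C \<mu> = Q"
    "\<theta>' \<cdot> \<theta> = Ide C (A \<odot> W)" "\<theta> \<cdot> \<theta>' = Ide C Q"
    "\<And>f. f \<in> Arr C \<Longrightarrow> Cod C f = A \<odot> W \<Longrightarrow> \<theta>' \<cdot> \<theta> \<cdot> f = f"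
    "\<And>f. f \<in> Arr C \<Longrightarrow> Cod C f = Q \<Longrightarrow> \<theta> \<cdot> \<theta>' \<cdot> f = f"
    "\<mu> = \<theta> \<cdot> (m \<otimes> Ide C W) \<cdot> (Ide C A \<otimes> \<theta>')"
  using assms B.Cod_Obj[of \<theta>] by (auto simp: frame_def in_Hom assoc[symmetric])

text \<open>If \<open>\<theta>\<close> is an identity, the maps are the action \<open>M \<odot> A \<odot> W \<rightarrow> M \<odot> W\<close>, the insertion
  \<open>M \<otimes> e \<otimes> W\<close>, and the insertion of \<open>e\<close> into \<open>M \<odot> A \<odot> W\<close> between \<open>A\<close> and \<open>W\<close>. The four equations
  are then associativity of the action, its unit law, the unit law of \<open>A\<close>, and the fact that the
  action and the insertion concern different factors.\<close>

lemma frame_split_coequalizer: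
  assumes M: "right_module C A m e (regular C) M \<nu>" and Q: "frame Q \<mu> W \<theta> \<theta>'"
  shows "split_coequalizer C (\<nu> \<otimes> Ide C Q) (Ide C M \<otimes> \<mu>) ((\<nu> \<otimes> Ide C W) \<cdot> (Ide C M \<otimes> \<theta>'))
    ((Ide C M \<otimes> \<theta>) \<cdot> (Ide C M \<otimes> e \<otimes> Ide C W))
    ((Ide C (M \<odot> A) \<otimes> \<theta>) \<cdot> (Ide C (M \<odot> A) \<otimes> e \<otimes> Ide C W) \<cdot> (Ide C M \<otimes> \<theta>'))"
proof -
  note [simp] = frame_typing(1-15)[OF Q] and \<mu> = frame_typing(16)[OF Q]
  have N [simp]: "M \<in> Obj C" "\<nu> \<in> Arr C" "Dom C \<nu> = M \<odot> A" "Cod C \<nu> = M"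
    using M by (auto simp: right_module_iff in_Hom)
  note act = right_module_assoc_whiskered[OF M, of W, simplified]
  have cancel: "(Ide C M \<otimes> \<theta>') \<cdot> (Ide C M \<otimes> \<theta>) \<cdot> f = f" if "f \<in> Arr C" "Cod C f = M \<odot> A \<odot> W" for f
    using that by (simp add: assoc[symmetric] whisker_left[symmetric])
  have 1: "((\<nu> \<otimes> Ide C W) \<cdot> (Ide C M \<otimes> \<theta>')) \<cdot> (\<nu> \<otimes> Ide C Q)
      = ((\<nu> \<otimes> Ide C W) \<cdot> (Ide C M \<otimes> \<theta>')) \<cdot> (Ide C M \<otimes> \<mu>)"
  proof -
    have "((\<nu> \<otimes> Ide C W) \<cdot> (Ide C M \<otimes> \<theta>')) \<cdot> (\<nu> \<otimes> Ide C Q)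
        = ((\<nu> \<otimes> Ide C W) \<cdot> (\<nu> \<otimes> Ide C (A \<odot> W))) \<cdot> (Ide C (M \<odot> A) \<otimes> \<theta>')"
      by (simp add: assoc slide)
    also have "\<dots> = (\<nu> \<otimes> Ide C W) \<cdot> (Ide C M \<otimes> m \<otimes> Ide C W) \<cdot> (Ide C (M \<odot> A) \<otimes> \<theta>')"
      by (simp add: act(1) assoc)
    also have "\<dots> = ((\<nu> \<otimes> Ide C W) \<cdot> (Ide C M \<otimes> \<theta>')) \<cdot> (Ide C M \<otimes> \<mu>)"
      by (simp add: \<mu> whisker_left assoc cancel)
    finally show ?thesis .
  qed
  have 2: "((\<nu> \<otimes> Ide C W) \<cdot> (Ide C M \<otimes> \<theta>')) \<cdot> (Ide C M \<otimes> \<theta>) \<cdot> (Ide C M \<otimes> e \<otimes> Ide C W) = Ide C (M \<odot> W)"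
    by (simp add: assoc cancel act)
  have 3: "(Ide C M \<otimes> \<mu>) \<cdot> (Ide C (M \<odot> A) \<otimes> \<theta>) \<cdot> (Ide C (M \<odot> A) \<otimes> e \<otimes> Ide C W) \<cdot> (Ide C M \<otimes> \<theta>')
      = Ide C (M \<odot> Q)"
  proof -
    have "\<mu> \<cdot> (Ide C A \<otimes> \<theta>) \<cdot> (Ide C A \<otimes> e \<otimes> Ide C W) \<cdot> \<theta>'
        = \<theta> \<cdot> (m \<otimes> Ide C W) \<cdot> ((Ide C A \<otimes> \<theta>') \<cdot> (Ide C A \<otimes> \<theta>)) \<cdot> (Ide C A \<otimes> e \<otimes> Ide C W) \<cdot> \<theta>'"
      by (simp add: \<mu> assoc)
    also have "\<dots> = \<theta> \<cdot> ((m \<otimes> Ide C W) \<cdot> (Ide C A \<otimes> e \<otimes> Ide C W)) \<cdot> \<theta>'"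
      by (simp add: whisker_left[symmetric] assoc)
    also have "\<dots> = Ide C Q" by (simp add: m_unit_whiskered)
    finally have "Ide C M \<otimes> (\<mu> \<cdot> (Ide C A \<otimes> \<theta>) \<cdot> (Ide C A \<otimes> e \<otimes> Ide C W) \<cdot> \<theta>') = Ide C M \<otimes> Ide C Q"
      by simp
    then show ?thesis by (simp add: whisker_left)
  qed
  have 4: "(\<nu> \<otimes> Ide C Q) \<cdot> (Ide C (M \<odot> A) \<otimes> \<theta>) \<cdot> (Ide C (M \<odot> A) \<otimes> e \<otimes> Ide C W) \<cdot> (Ide C M \<otimes> \<theta>')
      = ((Ide C M \<otimes> \<theta>) \<cdot> (Ide C M \<otimes> e \<otimes> Ide C W)) \<cdot> (\<nu> \<otimes> Ide C W) \<cdot> (Ide C M \<otimes> \<theta>')"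
    using slide_Comp[of \<nu> "\<theta> \<cdot> (e \<otimes> Ide C W)" M W "Ide C M \<otimes> \<theta>'"]
    by (simp add: whisker_left assoc)
  show ?thesis
    using 1 2 3 4 by (simp add: split_coequalizer_def in_Hom)
qed

end

locale algebra_right_category = algebra_in C A m e + R: right_category C D
  for C :: "('o, 'm) moncat" and A :: 'o and m e :: 'm and D :: "('p, 'q, 'o, 'm) actcat"

text \<open>Both sides of the canonical morphism are coequalizers of the same pair: on the right hand
  side because \<open>M \<star> -\<close> preserves the splitting.\<close>

lemma (in algebra_right_category) robust_of_frame:
  assumes hC: "has_coequalizers C" and hD: "has_coequalizers D" and Q: "frame Q \<mu> W \<theta> \<theta>'"
  shows "robust C A m e D Q \<mu>"
  unfolding robust_def
proof (intro allI impI)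
  fix M Z \<zeta> assume "M \<in> Obj D \<and> right_module C A m e (regular C) Z \<zeta>"
  then have M [simp]: "M \<in> Obj D" and Z: "right_module C A m e (regular C) Z \<zeta>" by auto
  have [simp]: "Z \<in> Obj C" "\<zeta> \<in> Arr C" "Dom C \<zeta> = Z \<odot>\<^bsub>C\<^esub> A" "Cod C \<zeta> = Z"
    using Z by (auto simp: right_module_iff in_Hom)
  note [simp] = frame_typing(1-13)[OF Q]
  let ?f = "\<zeta> \<otimes>\<^bsub>C\<^esub> Ide C Q" and ?g = "Ide C Z \<otimes>\<^bsub>C\<^esub> \<mu>"
  have "coequalizer C ?f ?g (coeq C ?f ?g)"
    by (rule coeq_is_coequalizer[OF hC]) (auto simp: in_Hom)
  then obtain s t where st: "split_coequalizer C ?f ?g (coeq C ?f ?g) s t"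
    using B.coequalizer_of_split_pair[OF frame_split_coequalizer[OF Z Q]] by metis
  have 1: "coequalizer D (Ide D M \<diamondop>\<^bsub>D\<^esub> ?f) (Ide D M \<diamondop>\<^bsub>D\<^esub> ?g) (Ide D M \<diamondop>\<^bsub>D\<^esub> coeq C ?f ?g)"
    by (rule R.B.split_coequalizer_is_coequalizer[OF R.ActM_split_coequalizer[OF st M]])
  have 2: "coequalizer D (Ide D M \<diamondop>\<^bsub>D\<^esub> ?f) (Ide D M \<diamondop>\<^bsub>D\<^esub> ?g) (coeq D (Ide D M \<diamondop>\<^bsub>D\<^esub> ?f) (Ide D M \<diamondop>\<^bsub>D\<^esub> ?g))"
    by (rule coeq_is_coequalizer[OF hD]) (auto simp: in_Hom)
  have "iso D (induced D (coeq D (Ide D M \<diamondop>\<^bsub>D\<^esub> ?f) (Ide D M \<diamondop>\<^bsub>D\<^esub> ?g)) (Ide D M \<diamondop>\<^bsub>D\<^esub> coeq C ?f ?g))"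
    by (rule R.B.induced_between_coequalizers_iso[OF 2 1])
  then show "iso D (robust_can C D M Z \<zeta> Q \<mu>)"
    by (simp add: robust_can_def bal_def R.ActM_assoc R.ActM_Ide[symmetric] del: R.ActM_Ide)
qed

section \<open>Bimodules presented by objects of EM\<close>

context algebra_in
begin

text \<open>The bimodule \<open>P\<close> is isomorphic along \<open>\<theta>\<close> to the free left module \<open>A \<odot> X\<close> with the right action
  \<open>lift X \<psi>\<close> that \<open>(X, \<psi>)\<close> determines.\<close>

definition presented ::
  "('o, 'm) bimod \<Rightarrow> 'o \<Rightarrow> 'm \<Rightarrow> 'm \<Rightarrow> 'm \<Rightarrow> bool" where
  "presented P X \<psi> \<theta> \<theta>' \<longleftrightarrow> (X, \<psi>) \<in> em_objects C A m e \<and> frame (bcar P) (lact P) X \<theta> \<theta>' \<and>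
    ract P = \<theta> \<cdot> lift X \<psi> \<cdot> (\<theta>' \<otimes> Ide C A)"

lemma lift_action:
  assumes "(X, \<psi>) \<in> em_objects C A m e"
  shows "lift X \<psi> \<cdot> (lift X \<psi> \<otimes> Ide C A) = lift X \<psi> \<cdot> (Ide C (A \<odot> X) \<otimes> m)"
    "lift X \<psi> \<cdot> (Ide C (A \<odot> X) \<otimes> e) = Ide C (A \<odot> X)"
proof -
  note [simp] = em_objectD(1-4)[OF assms]
  have "lift X \<psi> \<cdot> (lift X \<psi> \<otimes> Ide C A) = lift X \<psi> \<cdot> (Ide C A \<otimes> Ide C X \<otimes> m)"
    by (subst lift_Comp_whisker) (auto simp: lift_whisker_right lift_lift em_objectD(5)[OF assms])
  then show "lift X \<psi> \<cdot> (lift X \<psi> \<otimes> Ide C A) = lift X \<psi> \<cdot> (Ide C (A \<odot> X) \<otimes> m)"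
    by simp
  have "lift X \<psi> \<cdot> (Ide C A \<otimes> Ide C X \<otimes> e) = Ide C (A \<odot> X)"
    by (subst lift_Comp_whisker) (auto simp: em_objectD(6)[OF assms] lift_of_unit)
  then show "lift X \<psi> \<cdot> (Ide C (A \<odot> X) \<otimes> e) = Ide C (A \<odot> X)" by simp
qed

lemma presentedD:
  assumes "presented P X \<psi> \<theta> \<theta>'"
  shows "(X, \<psi>) \<in> em_objects C A m e" "frame (bcar P) (lact P) X \<theta> \<theta>'"
    "ract P = \<theta> \<cdot> lift X \<psi> \<cdot> (\<theta>' \<otimes> Ide C A)"
    "ract P \<in> Arr C" "Dom C (ract P) = bcar P \<odot> A" "Cod C (ract P) = bcar P"
proof -
  show K: "(X, \<psi>) \<in> em_objects C A m e" and F: "frame (bcar P) (lact P) X \<theta> \<theta>'"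
    and r: "ract P = \<theta> \<cdot> lift X \<psi> \<cdot> (\<theta>' \<otimes> Ide C A)"
    using assms by (auto simp: presented_def)
  note [simp] = em_objectD(1-4)[OF K] frame_typing(1-15)[OF F]
  show "ract P \<in> Arr C" "Dom C (ract P) = bcar P \<odot> A" "Cod C (ract P) = bcar P"
    by (auto simp: r)
qed

lemma presented_bimodule:
  assumes "presented P X \<psi> \<theta> \<theta>'"
  shows "bimodule C A m e P"
proof -
  note P = presentedD(1-3)[OF assms]
  note [simp] = em_objectD(1-4)[OF P(1)] frame_typing(1-15)[OF P(2)] presentedD(4-6)[OF assms]
    and \<mu> = frame_typing(16)[OF P(2)] and act = lift_action[OF P(1)]
  have 1: "(\<theta>' \<otimes> Ide C Z) \<cdot> (\<theta> \<otimes> Ide C Z) \<cdot> f = f"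
    if "f \<in> Arr C" "Cod C f = A \<odot> X \<odot> Z" "Z \<in> Obj C" for f Z
    using that by (simp add: assoc[symmetric] whisker_right[symmetric])
  have 2: "(Ide C Z \<otimes> \<theta>') \<cdot> (Ide C Z \<otimes> \<theta>) \<cdot> f = f"
    if "f \<in> Arr C" "Cod C f = Z \<odot> A \<odot> X" "Z \<in> Obj C" for f Z
    using that by (simp add: assoc[symmetric] whisker_left[symmetric])
  have "left_module C A m e (bcar P) (lact P)"
  proof -
    have "lact P \<cdot> (Ide C A \<otimes> lact P)
        = \<theta> \<cdot> ((m \<otimes> Ide C X) \<cdot> (Ide C A \<otimes> m \<otimes> Ide C X)) \<cdot> (Ide C (A \<odot> A) \<otimes> \<theta>')"
      by (simp add: \<mu> whisker_left assoc 2)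
    also have "\<dots> = \<theta> \<cdot> (m \<otimes> Ide C X) \<cdot> (m \<otimes> Ide C (A \<odot> X)) \<cdot> (Ide C (A \<odot> A) \<otimes> \<theta>')"
      by (simp add: m_assoc_whiskered[symmetric] assoc)
    also have "\<dots> = lact P \<cdot> (m \<otimes> Ide C (bcar P))"
      by (simp add: \<mu> assoc slide)
    finally have a: "lact P \<cdot> (Ide C A \<otimes> lact P) = lact P \<cdot> (m \<otimes> Ide C (bcar P))" .
    have "lact P \<cdot> (e \<otimes> Ide C (bcar P)) = \<theta> \<cdot> ((m \<otimes> Ide C X) \<cdot> (e \<otimes> Ide C (A \<odot> X))) \<cdot> \<theta>'"
      by (simp add: \<mu> assoc slide)
    also have "\<dots> = Ide C (bcar P)" by (simp add: m_unit_whiskered)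
    finally show ?thesis using a by (simp add: left_module_def in_Hom)
  qed
  moreover have "right_module C A m e (regular C) (bcar P) (ract P)"
  proof -
    have "ract P \<cdot> (ract P \<otimes> Ide C A) = \<theta> \<cdot> (lift X \<psi> \<cdot> (lift X \<psi> \<otimes> Ide C A)) \<cdot> (\<theta>' \<otimes> Ide C (A \<odot> A))"
      by (simp add: P(3) whisker_right assoc 1)
    also have "\<dots> = \<theta> \<cdot> lift X \<psi> \<cdot> (Ide C (A \<odot> X) \<otimes> m) \<cdot> (\<theta>' \<otimes> Ide C (A \<odot> A))"
      by (simp add: act assoc)
    also have "\<dots> = ract P \<cdot> (Ide C (bcar P) \<otimes> m)"
      by (simp add: P(3) assoc slide)
    finally have a: "ract P \<cdot> (ract P \<otimes> Ide C A) = ract P \<cdot> (Ide C (bcar P) \<otimes> m)" .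
    have "ract P \<cdot> (Ide C (bcar P) \<otimes> e) = \<theta> \<cdot> lift X \<psi> \<cdot> (\<theta>' \<otimes> Ide C A) \<cdot> (Ide C (bcar P) \<otimes> e)"
      by (simp add: P(3) assoc)
    also have "\<dots> = \<theta> \<cdot> (lift X \<psi> \<cdot> (Ide C (A \<odot> X) \<otimes> e)) \<cdot> \<theta>'"
      using slide[of \<theta>' e "A \<odot> X" \<one>] by (simp add: assoc)
    also have "\<dots> = Ide C (bcar P)" by (simp add: act)
    finally show ?thesis using a by (simp add: right_module_iff in_Hom)
  qed
  moreover have "ract P \<cdot> (lact P \<otimes> Ide C A) = lact P \<cdot> (Ide C A \<otimes> ract P)"
  proof -
    have "ract P \<cdot> (lact P \<otimes> Ide C A)
        = \<theta> \<cdot> (lift X \<psi> \<cdot> (m \<otimes> Ide C (X \<odot> A))) \<cdot> (Ide C A \<otimes> \<theta>' \<otimes> Ide C A)"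
      by (simp add: P(3) \<mu> whisker_right assoc 1)
    also have "\<dots> = \<theta> \<cdot> (m \<otimes> Ide C X) \<cdot> (Ide C A \<otimes> lift X \<psi>) \<cdot> (Ide C A \<otimes> \<theta>' \<otimes> Ide C A)"
      by (simp add: lift_linear assoc)
    also have "\<dots> = lact P \<cdot> (Ide C A \<otimes> ract P)"
      by (simp add: P(3) \<mu> whisker_left assoc 2)
    finally show ?thesis .
  qed
  ultimately show ?thesis by (simp add: bimodule_def)
qed

text \<open>The defining equation of a morphism \<open>\<rho>\<close> in \<open>EM\<close> is right linearity of \<open>lift Y \<rho>\<close> restricted
  along the unit of \<open>A\<close>; as both sides are left linear, the restriction implies the full
  equation.\<close>

lemma presented_bim_arrow:
  assumes "presented P X \<psi> \<theta> \<theta>'" "presented Q Y \<phi> \<kappa> \<kappa>'" "em_arrow C A m (X, \<psi>) (Y, \<phi>) \<rho>"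
  shows "bim_arrow C A P Q (\<kappa> \<cdot> lift Y \<rho> \<cdot> \<theta>')"
proof -
  note P = presentedD(1-3)[OF assms(1)] and Q = presentedD(1-3)[OF assms(2)]
  note [simp] = em_objectD(1-4)[OF P(1)] frame_typing(1-15)[OF P(2)] presentedD(4-6)[OF assms(1)]
    em_objectD(1-4)[OF Q(1)] frame_typing(1-15)[OF Q(2)] presentedD(4-6)[OF assms(2)]
  note \<mu> = frame_typing(16)[OF P(2)] frame_typing(16)[OF Q(2)]
  have [simp]: "\<rho> \<in> Arr C" "Dom C \<rho> = X" "Cod C \<rho> = A \<odot> Y"
    and comm: "lift Y \<rho> \<cdot> \<psi> = lift Y \<phi> \<cdot> (\<rho> \<otimes> Ide C A)"
    using assms(3) em_arrow_iff[OF P(1) Q(1)] by (auto simp: in_Hom)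
  have 1: "(\<kappa>' \<otimes> Ide C A) \<cdot> (\<kappa> \<otimes> Ide C A) \<cdot> f = f"
    if "f \<in> Arr C" "Cod C f = A \<odot> Y \<odot> A" for f
    using that by (simp add: assoc[symmetric] whisker_right[symmetric])
  have 2: "(Ide C A \<otimes> \<kappa>') \<cdot> (Ide C A \<otimes> \<kappa>) \<cdot> f = f"
    if "f \<in> Arr C" "Cod C f = A \<odot> A \<odot> Y" for f
    using that by (simp add: assoc[symmetric] whisker_left[symmetric])
  have "(\<kappa> \<cdot> lift Y \<rho> \<cdot> \<theta>') \<cdot> lact P = \<kappa> \<cdot> (lift Y \<rho> \<cdot> (m \<otimes> Ide C X)) \<cdot> (Ide C A \<otimes> \<theta>')"
    by (simp add: \<mu> assoc)
  also have "\<dots> = \<kappa> \<cdot> (m \<otimes> Ide C Y) \<cdot> (Ide C A \<otimes> lift Y \<rho>) \<cdot> (Ide C A \<otimes> \<theta>')"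
    by (simp add: lift_linear assoc)
  also have "\<dots> = lact Q \<cdot> (Ide C A \<otimes> (\<kappa> \<cdot> lift Y \<rho> \<cdot> \<theta>'))"
    by (simp add: \<mu> whisker_left assoc 2)
  finally have l: "(\<kappa> \<cdot> lift Y \<rho> \<cdot> \<theta>') \<cdot> lact P = lact Q \<cdot> (Ide C A \<otimes> (\<kappa> \<cdot> lift Y \<rho> \<cdot> \<theta>'))" .
  have "(\<kappa> \<cdot> lift Y \<rho> \<cdot> \<theta>') \<cdot> ract P = \<kappa> \<cdot> (lift Y \<rho> \<cdot> lift X \<psi>) \<cdot> (\<theta>' \<otimes> Ide C A)"
    by (simp add: P(3) assoc)
  also have "\<dots> = \<kappa> \<cdot> (lift Y \<phi> \<cdot> (lift Y \<rho> \<otimes> Ide C A)) \<cdot> (\<theta>' \<otimes> Ide C A)"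
    by (simp add: lift_lift comm lift_whisker_right)
  also have "\<dots> = ract Q \<cdot> ((\<kappa> \<cdot> lift Y \<rho> \<cdot> \<theta>') \<otimes> Ide C A)"
    by (simp add: Q(3) whisker_right assoc 1)
  finally show ?thesis using l by (simp add: bim_arrow_def in_Hom)
qed

text \<open>Left linearity makes every bimodule map an extension, whose restriction along the unit is a
  morphism in \<open>EM\<close>.\<close>

lemma presented_bim_arrow_exists:
  assumes "presented P X \<psi> \<theta> \<theta>'" "presented Q Y \<phi> \<kappa> \<kappa>'" "bim_arrow C A P Q f"
  obtains \<rho> where "em_arrow C A m (X, \<psi>) (Y, \<phi>) \<rho>" "f = \<kappa> \<cdot> lift Y \<rho> \<cdot> \<theta>'"
proof -
  note P = presentedD(1-3)[OF assms(1)] and Q = presentedD(1-3)[OF assms(2)]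
  note [simp] = em_objectD(1-4)[OF P(1)] frame_typing(1-15)[OF P(2)] presentedD(4-6)[OF assms(1)]
    em_objectD(1-4)[OF Q(1)] frame_typing(1-15)[OF Q(2)] presentedD(4-6)[OF assms(2)]
  note \<mu> = frame_typing(16)[OF P(2)] frame_typing(16)[OF Q(2)]
  have [simp]: "f \<in> Arr C" "Dom C f = bcar P" "Cod C f = bcar Q"
    and lin: "f \<cdot> lact P = lact Q \<cdot> (Ide C A \<otimes> f)" "f \<cdot> ract P = ract Q \<cdot> (f \<otimes> Ide C A)"
    using assms(3) by (auto simp: bim_arrow_def in_Hom)
  let ?g = "\<kappa>' \<cdot> f \<cdot> \<theta>" and ?\<rho> = "\<kappa>' \<cdot> f \<cdot> \<theta> \<cdot> (e \<otimes> Ide C X)"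
  have f: "f = \<kappa> \<cdot> ?g \<cdot> \<theta>'" by (simp add: assoc)
  have 1: "(\<theta>' \<otimes> Ide C A) \<cdot> (\<theta> \<otimes> Ide C A) = Ide C (A \<odot> X \<odot> A)"
    by (simp add: whisker_right[symmetric])
  have 2: "(Ide C A \<otimes> \<theta>') \<cdot> (Ide C A \<otimes> \<theta>) = Ide C (A \<odot> A \<odot> X)"
    by (simp add: whisker_left[symmetric])
  have "?g \<cdot> (m \<otimes> Ide C X) = \<kappa>' \<cdot> (f \<cdot> lact P) \<cdot> (Ide C A \<otimes> \<theta>)"
    by (simp add: \<mu> assoc 2)
  also have "\<dots> = (m \<otimes> Ide C Y) \<cdot> (Ide C A \<otimes> ?g)"
    unfolding lin by (simp add: \<mu> assoc whisker_left)
  finally have "lift Y (?g \<cdot> (e \<otimes> Ide C X)) = ?g"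
    by (intro linear_is_lift) (simp_all add: in_Hom)
  then have \<rho>: "lift Y ?\<rho> = ?g" by (simp add: assoc)
  have "lift Y ?\<rho> \<cdot> lift X \<psi> = \<kappa>' \<cdot> (f \<cdot> ract P) \<cdot> (\<theta> \<otimes> Ide C A)"
    unfolding \<rho> by (simp add: P(3) assoc 1)
  also have "\<dots> = lift Y \<phi> \<cdot> (?g \<otimes> Ide C A)"
    unfolding lin by (simp add: Q(3) assoc whisker_right)
  finally have "(lift Y ?\<rho> \<cdot> lift X \<psi>) \<cdot> (e \<otimes> Ide C (X \<odot> A)) = (lift Y \<phi> \<cdot> (?g \<otimes> Ide C A)) \<cdot> (e \<otimes> Ide C (X \<odot> A))"
    by simp
  moreover have "(lift Y ?\<rho> \<cdot> lift X \<psi>) \<cdot> (e \<otimes> Ide C (X \<odot> A)) = lift Y ?\<rho> \<cdot> \<psi>"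
    by (simp add: lift_lift lift_unit)
  moreover have "(lift Y \<phi> \<cdot> (?g \<otimes> Ide C A)) \<cdot> (e \<otimes> Ide C (X \<odot> A)) = lift Y \<phi> \<cdot> (?\<rho> \<otimes> Ide C A)"
    by (simp add: assoc whisker_right)
  ultimately have "em_arrow C A m (X, \<psi>) (Y, \<phi>) ?\<rho>"
    by (simp add: em_arrow_iff[OF P(1) Q(1)] in_Hom)
  then show ?thesis using that f \<rho> by simp
qed

definition free_bimodule :: "'o \<Rightarrow> 'm \<Rightarrow> ('o, 'm) bimod" where
  "free_bimodule X \<psi> = Bimod (A \<odot> X) (m \<otimes> Ide C X) (lift X \<psi>)"

lemma free_bimodule_presented:
  assumes "(X, \<psi>) \<in> em_objects C A m e"
  shows "presented (free_bimodule X \<psi>) X \<psi> (Ide C (A \<odot> X)) (Ide C (A \<odot> X))"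
  using assms em_objectD(1-4)[OF assms] by (simp add: presented_def free_bimodule_def frame_def in_Hom)

lemma unit_bimodule_free: "Bimod A m m = free_bimodule \<one> (Ide C A)"
  by (simp add: free_bimodule_def lift_def)

text \<open>Compatibility with the left action makes \<open>\<nu>\<close> a left linear map between free modules, so it
  is an extension \<open>lift X \<psi>\<close>. Both axioms on \<open>\<psi>\<close> are then module axioms, read off by injectivity of
  \<open>lift\<close>.\<close>

lemma bimodule_is_free:
  assumes P: "bimodule C A m e (Bimod (A \<odot> X) (m \<otimes> Ide C X) \<nu>)" and X: "X \<in> Obj C"
  obtains \<psi> where "(X, \<psi>) \<in> em_objects C A m e" "\<nu> = lift X \<psi>"
proof -
  have [simp]: "X \<in> Obj C" "\<nu> \<in> Arr C" "Dom C \<nu> = A \<odot> X \<odot> A" "Cod C \<nu> = A \<odot> X"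
    and ax: "\<nu> \<cdot> (\<nu> \<otimes> Ide C A) = \<nu> \<cdot> (Ide C (A \<odot> X) \<otimes> m)" "\<nu> \<cdot> (Ide C (A \<odot> X) \<otimes> e) = Ide C (A \<odot> X)"
      "\<nu> \<cdot> (m \<otimes> Ide C (X \<odot> A)) = (m \<otimes> Ide C X) \<cdot> (Ide C A \<otimes> \<nu>)"
    using P X by (auto simp: bimodule_def right_module_iff in_Hom)
  let ?\<psi> = "\<nu> \<cdot> (e \<otimes> Ide C (X \<odot> A))"
  have \<nu>: "\<nu> = lift X ?\<psi>"
    using linear_is_lift[of \<nu> "X \<odot> A" X] ax(3) by (simp add: in_Hom)
  have t [simp]: "?\<psi> \<in> Arr C" "Dom C ?\<psi> = X \<odot> A" "Cod C ?\<psi> = A \<odot> X" by auto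
  define \<psi> where "\<psi> = ?\<psi>"
  have [simp]: "\<psi> \<in> Arr C" "Dom C \<psi> = X \<odot> A" "Cod C \<psi> = A \<odot> X" using t by (auto simp: \<psi>_def)
  have \<nu>: "\<nu> = lift X \<psi>" using \<nu> by (simp add: \<psi>_def)
  have "lift X (lift X \<psi> \<cdot> (\<psi> \<otimes> Ide C A)) = \<nu> \<cdot> (\<nu> \<otimes> Ide C A)"
    unfolding \<nu> by (simp add: lift_whisker_right lift_lift)
  also have "\<dots> = lift X \<psi> \<cdot> (Ide C A \<otimes> Ide C X \<otimes> m)" unfolding ax(1) unfolding \<nu> by simp
  also have "\<dots> = lift X (\<psi> \<cdot> (Ide C X \<otimes> m))" by (subst lift_Comp_whisker) auto
  finally have 1: "\<psi> \<cdot> (Ide C X \<otimes> m) = lift X \<psi> \<cdot> (\<psi> \<otimes> Ide C A)"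
    by (subst (asm) lift_inject[where V = "X \<odot> A \<odot> A"]) (auto simp: in_Hom)
  have "lift X (\<psi> \<cdot> (Ide C X \<otimes> e)) = lift X \<psi> \<cdot> (Ide C A \<otimes> Ide C X \<otimes> e)"
    by (subst lift_Comp_whisker) auto
  also have "\<dots> = lift X (e \<otimes> Ide C X)" using ax(2) unfolding \<nu> by (simp add: lift_of_unit)
  finally have 2: "\<psi> \<cdot> (Ide C X \<otimes> e) = e \<otimes> Ide C X"
    by (subst (asm) lift_inject[where V = X]) (auto simp: in_Hom)
  show ?thesis
    using 1 2 \<nu> by (intro that[of \<psi>]) (auto simp: em_objects_iff in_Hom)
qed

end

section \<open>Tensor products over A in coordinates\<close>

locale coequalizer_algebra = algebra_in C A m e
  for C :: "('o, 'm) moncat" (structure) and A :: 'o and m e :: 'm +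
  assumes has_coeq: "has_coequalizers C"
begin

text \<open>If \<open>\<theta>' : Q \<rightarrow> A \<odot> W\<close> is the inverse half of a frame of \<open>Q\<close>, then \<open>c\<close> identifies the chosen
  tensor product of \<open>P\<close> and \<open>Q\<close> over \<open>A\<close> with \<open>P \<odot> W\<close>, by comparison with the split coequalizer
  above.\<close>

definition chart ::
  "('o, 'm) bimod \<Rightarrow> ('o, 'm) bimod \<Rightarrow> 'o \<Rightarrow> 'm \<Rightarrow> 'm \<Rightarrow> 'm \<Rightarrow> bool" where
  "chart P Q W \<theta>' c c' \<longleftrightarrow>
    c \<in> Hom C (bcar (bim_tensor C A P Q)) (bcar P \<odot> W) \<and> c' \<in> Hom C (bcar P \<odot> W) (bcar (bim_tensor C A P Q)) \<and>
    c' \<cdot> c = Ide C (bcar (bim_tensor C A P Q)) \<and> c \<cdot> c' = Ide C (bcar P \<odot> W) \<and>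
    c \<cdot> bim_proj C P Q = (ract P \<otimes> Ide C W) \<cdot> (Ide C (bcar P) \<otimes> \<theta>')"

lemma proj_coequalizer:
  assumes P: "right_module C A m e (regular C) (bcar P) (ract P)" and Q: "frame (bcar Q) (lact Q) W \<theta> \<theta>'"
  shows "coequalizer C (ract P \<otimes> Ide C (bcar Q)) (Ide C (bcar P) \<otimes> lact Q) (bim_proj C P Q)"
proof -
  note [simp] = frame_typing(1-13)[OF Q] right_moduleD[OF P]
  show ?thesis
    unfolding bim_proj_def bal_def regular_simps regular_coequalizers
    by (rule coeq_is_coequalizer[OF has_coeq]) (auto simp: in_Hom)
qed

lemma chart_exists:
  assumes P: "right_module C A m e (regular C) (bcar P) (ract P)" and Q: "frame (bcar Q) (lact Q) W \<theta> \<theta>'"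
  obtains c c' where "chart P Q W \<theta>' c c'"
proof -
  note [simp] = frame_typing(1-13)[OF Q] right_moduleD[OF P]
  from B.coequalizer_of_split_pair[OF frame_split_coequalizer[OF P Q] proj_coequalizer[OF P Q]] show ?thesis
  proof cases
    case (1 c c')
    then show ?thesis using that[of c c'] by (simp add: chart_def bim_tensor_def)
  qed
qed

lemma proj_split:
  assumes P: "right_module C A m e (regular C) (bcar P) (ract P)" and Q: "frame (bcar Q) (lact Q) W \<theta> \<theta>'"
  obtains r where "bim_proj C P Q \<in> Hom C (bcar P \<odot> bcar Q) (bcar (bim_tensor C A P Q))"
    "r \<in> Hom C (bcar (bim_tensor C A P Q)) (bcar P \<odot> bcar Q)"
    "bim_proj C P Q \<cdot> r = Ide C (bcar (bim_tensor C A P Q))"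
proof -
  note [simp] = frame_typing(1-13)[OF Q] right_moduleD[OF P]
  from B.coequalizer_of_split_pair[OF frame_split_coequalizer[OF P Q] proj_coequalizer[OF P Q]] obtain s t where
    "split_coequalizer C (ract P \<otimes> Ide C (bcar Q)) (Ide C (bcar P) \<otimes> lact Q) (bim_proj C P Q) s t"
    by metis
  then show ?thesis using that[of s] by (simp add: split_coequalizer_def in_Hom bim_tensor_def)
qed

lemma chartD:
  assumes "chart P Q W \<theta>' c c'"
  shows "c \<in> Arr C" "Dom C c = bcar (bim_tensor C A P Q)" "Cod C c = bcar P \<odot> W"
    "c' \<in> Arr C" "Dom C c' = bcar P \<odot> W" "Cod C c' = bcar (bim_tensor C A P Q)"
    "c' \<cdot> c = Ide C (bcar (bim_tensor C A P Q))" "c \<cdot> c' = Ide C (bcar P \<odot> W)"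
    "bcar (bim_tensor C A P Q) \<in> Obj C"
    "\<And>f. f \<in> Arr C \<Longrightarrow> Cod C f = bcar (bim_tensor C A P Q) \<Longrightarrow> c' \<cdot> c \<cdot> f = f"
    "\<And>f. f \<in> Arr C \<Longrightarrow> Cod C f = bcar P \<odot> W \<Longrightarrow> c \<cdot> c' \<cdot> f = f"
    "c \<cdot> bim_proj C P Q = (ract P \<otimes> Ide C W) \<cdot> (Ide C (bcar P) \<otimes> \<theta>')"
  using assms B.Dom_Obj[of c] by (auto simp: chart_def in_Hom assoc[symmetric])

definition tensor_arrow ::
  "('o, 'm) bimod \<Rightarrow> ('o, 'm) bimod \<Rightarrow> ('o, 'm) bimod \<Rightarrow> ('o, 'm) bimod \<Rightarrow> 'm \<Rightarrow> 'm \<Rightarrow> 'm" where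
  "tensor_arrow P Q P' Q' f g = induced C (bim_proj C P Q) (bim_proj C P' Q' \<cdot> (f \<otimes> g))"

text \<open>In charts the tensor product of \<open>f\<close> and \<open>g\<close> over \<open>A\<close> is the map \<open>P \<odot> W \<rightarrow> P' \<odot> V\<close> which applies
  \<open>f\<close>, then \<open>\<sigma>\<close>, and lets the new factor \<open>A\<close> act on \<open>P'\<close>. Both sides agree after the projection, by
  right linearity of \<open>f\<close> and \<open>act_lift\<close>.\<close>

lemma tensor_arrow_in_charts:
  assumes P: "right_module C A m e (regular C) (bcar P) (ract P)"
    and P': "right_module C A m e (regular C) (bcar P') (ract P')"
    and Q: "frame (bcar Q) (lact Q) W \<theta> \<theta>'" and Q': "frame (bcar Q') (lact Q') V \<kappa> \<kappa>'"
    and c: "chart P Q W \<theta>' c c'" and d: "chart P' Q' V \<kappa>' d d'"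
    and f: "f \<in> Hom C (bcar P) (bcar P')" "f \<cdot> ract P = ract P' \<cdot> (f \<otimes> Ide C A)"
    and g: "g \<in> Hom C (bcar Q) (bcar Q')" and \<sigma>: "\<sigma> \<in> Hom C W (A \<odot> V)" "\<kappa>' \<cdot> g = lift V \<sigma> \<cdot> \<theta>'"
  shows "tensor_arrow P Q P' Q' f g \<in> Hom C (bcar (bim_tensor C A P Q)) (bcar (bim_tensor C A P' Q'))"
    and "d \<cdot> tensor_arrow P Q P' Q' f g = (ract P' \<otimes> Ide C V) \<cdot> (Ide C (bcar P') \<otimes> \<sigma>) \<cdot> (f \<otimes> Ide C W) \<cdot> c"
proof -
  note [simp] = right_moduleD[OF P] right_moduleD[OF P'] frame_typing(1-11)[OF Q] frame_typing(1-11)[OF Q']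
    chartD(1-11)[OF c] chartD(1-11)[OF d]
  have [simp]: "f \<in> Arr C" "Dom C f = bcar P" "Cod C f = bcar P'" "g \<in> Arr C" "Dom C g = bcar Q" "Cod C g = bcar Q'"
    "\<sigma> \<in> Arr C" "Dom C \<sigma> = W" "Cod C \<sigma> = A \<odot> V"
    using f g \<sigma> by (auto simp: in_Hom)
  obtain r where r: "bim_proj C P Q \<in> Hom C (bcar P \<odot> bcar Q) (bcar (bim_tensor C A P Q))"
    "r \<in> Hom C (bcar (bim_tensor C A P Q)) (bcar P \<odot> bcar Q)"
    "bim_proj C P Q \<cdot> r = Ide C (bcar (bim_tensor C A P Q))" by (rule proj_split[OF P Q])
  obtain r' where r': "bim_proj C P' Q' \<in> Hom C (bcar P' \<odot> bcar Q') (bcar (bim_tensor C A P' Q'))"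
    by (rule proj_split[OF P' Q'])
  have [simp]: "bim_proj C P Q \<in> Arr C" "Dom C (bim_proj C P Q) = bcar P \<odot> bcar Q"
    "Cod C (bim_proj C P Q) = bcar (bim_tensor C A P Q)"
    "bim_proj C P' Q' \<in> Arr C" "Dom C (bim_proj C P' Q') = bcar P' \<odot> bcar Q'"
    "Cod C (bim_proj C P' Q') = bcar (bim_tensor C A P' Q')"
    using r r' by (auto simp: in_Hom)
  let ?k = "(ract P' \<otimes> Ide C V) \<cdot> (Ide C (bcar P') \<otimes> \<sigma>) \<cdot> (f \<otimes> Ide C W) \<cdot> c"
  have "?k \<cdot> bim_proj C P Q = (ract P' \<otimes> Ide C V) \<cdot> (Ide C (bcar P') \<otimes> \<sigma>) \<cdot>
      ((f \<cdot> ract P) \<otimes> Ide C W) \<cdot> (Ide C (bcar P) \<otimes> \<theta>')"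
    by (simp add: assoc chartD(12)[OF c] whisker_right)
  also have "\<dots> = ((ract P' \<otimes> Ide C V) \<cdot> (Ide C (bcar P') \<otimes> \<sigma>) \<cdot> (ract P' \<otimes> Ide C W)) \<cdot>
      (f \<otimes> Ide C (A \<odot> W)) \<cdot> (Ide C (bcar P) \<otimes> \<theta>')"
    unfolding f(2) by (simp add: assoc whisker_right)
  also have "\<dots> = (ract P' \<otimes> Ide C V) \<cdot> (Ide C (bcar P') \<otimes> lift V \<sigma>) \<cdot>
      (f \<otimes> Ide C (A \<odot> W)) \<cdot> (Ide C (bcar P) \<otimes> \<theta>')"
    using act_lift[OF P', of V \<sigma> W] by (simp add: assoc[symmetric])
  also have "\<dots> = (ract P' \<otimes> Ide C V) \<cdot> (Ide C (bcar P') \<otimes> lift V \<sigma>) \<cdot>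
      (Ide C (bcar P') \<otimes> \<theta>') \<cdot> (f \<otimes> Ide C (bcar Q))"
    by (simp add: slide)
  also have "\<dots> = (ract P' \<otimes> Ide C V) \<cdot> (Ide C (bcar P') \<otimes> (lift V \<sigma> \<cdot> \<theta>')) \<cdot> (f \<otimes> Ide C (bcar Q))"
    by (simp add: whisker_left assoc)
  also have "\<dots> = ((ract P' \<otimes> Ide C V) \<cdot> (Ide C (bcar P') \<otimes> \<kappa>')) \<cdot> (Ide C (bcar P') \<otimes> g) \<cdot> (f \<otimes> Ide C (bcar Q))"
    unfolding \<sigma>(2)[symmetric] by (simp add: whisker_left assoc)
  also have "\<dots> = d \<cdot> bim_proj C P' Q' \<cdot> (f \<otimes> g)"
    unfolding chartD(12)[OF d, symmetric] by (simp add: interchange assoc)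
  finally have k: "?k \<cdot> bim_proj C P Q = d \<cdot> bim_proj C P' Q' \<cdot> (f \<otimes> g)" .
  have "(d' \<cdot> ?k) \<cdot> bim_proj C P Q = d' \<cdot> (?k \<cdot> bim_proj C P Q)"
    by (rule assoc) auto
  also have "\<dots> = bim_proj C P' Q' \<cdot> (f \<otimes> g)"
    unfolding k by simp
  finally have K: "tensor_arrow P Q P' Q' f g = d' \<cdot> ?k"
    unfolding tensor_arrow_def using r by (intro B.induced_along_split_epi[of _ r]) (auto simp: in_Hom)
  show "tensor_arrow P Q P' Q' f g \<in> Hom C (bcar (bim_tensor C A P Q)) (bcar (bim_tensor C A P' Q'))"
    "d \<cdot> tensor_arrow P Q P' Q' f g = ?k"
    unfolding K by (auto simp: in_Hom)
qed

lemma bim_tensor_actions: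
  "lact (bim_tensor C A P Q)
    = induced C (Ide C A \<otimes> bim_proj C P Q) (bim_proj C P Q \<cdot> (lact P \<otimes> Ide C (bcar Q)))"
  "ract (bim_tensor C A P Q)
    = induced C (bim_proj C P Q \<otimes> Ide C A) (bim_proj C P Q \<cdot> (Ide C (bcar P) \<otimes> ract Q))"
  by (simp_all add: bim_tensor_def)

text \<open>The projection, followed by the frames, is \<open>lift (X \<odot> Y) (\<psi> \<otimes> Y)\<close> up to isomorphism. Hence
  the left action on the tensor product is the free one by linearity of \<open>lift\<close>, and the right action is
  the one that belongs to the tensor product in \<open>EM\<close> by \<open>em_distributes\<close>. The last equation is the
  description of the right action of a tensor product that its definition aims at.\<close>

lemma tensor_presented:
  assumes P: "presented P X \<psi> \<theta> \<theta>'" and Q: "presented Q Y \<phi> \<kappa> \<kappa>'" and c: "chart P Q Y \<kappa>' c c'"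
  shows "presented (bim_tensor C A P Q) (X \<odot> Y) ((\<psi> \<otimes> Ide C Y) \<cdot> (Ide C X \<otimes> \<phi>))
    (c' \<cdot> (\<theta> \<otimes> Ide C Y)) ((\<theta>' \<otimes> Ide C Y) \<cdot> c)"
    and "ract (bim_tensor C A P Q) \<cdot> (bim_proj C P Q \<otimes> Ide C A) = bim_proj C P Q \<cdot> (Ide C (bcar P) \<otimes> ract Q)"
proof -
  note p = presentedD(1-3)[OF P] and q = presentedD(1-3)[OF Q]
  note [simp] = em_objectD(1-4)[OF p(1)] frame_typing(1-15)[OF p(2)] presentedD(4-6)[OF P]
    em_objectD(1-4)[OF q(1)] frame_typing(1-15)[OF q(2)] presentedD(4-6)[OF Q] chartD(1-11)[OF c]
  note \<mu> = frame_typing(16)[OF p(2)] frame_typing(16)[OF q(2)]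
  let ?T = "bim_tensor C A P Q" and ?q = "bim_proj C P Q" and ?\<psi> = "(\<psi> \<otimes> Ide C Y) \<cdot> (Ide C X \<otimes> \<phi>)"
  let ?\<theta> = "c' \<cdot> (\<theta> \<otimes> Ide C Y)" and ?\<theta>' = "(\<theta>' \<otimes> Ide C Y) \<cdot> c"
  have RP: "right_module C A m e (regular C) (bcar P) (ract P)"
    using presented_bimodule[OF P] by (simp add: bimodule_def)
  obtain r where r: "?q \<in> Hom C (bcar P \<odot> bcar Q) (bcar ?T)"
    "r \<in> Hom C (bcar ?T) (bcar P \<odot> bcar Q)" "?q \<cdot> r = Ide C (bcar ?T)" by (rule proj_split[OF RP q(2)])
  have [simp]: "?q \<in> Arr C" "Dom C ?q = bcar P \<odot> bcar Q" "Cod C ?q = bcar ?T"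
    "r \<in> Arr C" "Dom C r = bcar ?T" "Cod C r = bcar P \<odot> bcar Q"
    using r by (auto simp: in_Hom)
  have r_left: "(Ide C A \<otimes> ?q) \<cdot> (Ide C A \<otimes> r) = Ide C (A \<odot> bcar ?T)"
    and r_right: "(?q \<otimes> Ide C A) \<cdot> (r \<otimes> Ide C A) = Ide C (bcar ?T \<odot> A)"
    by (simp_all add: whisker_left[symmetric] whisker_right[symmetric] r(3))
  have cancel: "(\<theta>' \<otimes> Ide C Z) \<cdot> (\<theta> \<otimes> Ide C Z) \<cdot> f = f"
    if "f \<in> Arr C" "Cod C f = A \<odot> X \<odot> Z" "Z \<in> Obj C" for f Z
    using that by (simp add: assoc[symmetric] whisker_right[symmetric])
  have cancel': "(\<theta> \<otimes> Ide C Z) \<cdot> (\<theta>' \<otimes> Ide C Z) \<cdot> f = f"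
    if "f \<in> Arr C" "Cod C f = bcar P \<odot> Z" "Z \<in> Obj C" for f Z
    using that by (simp add: assoc[symmetric] whisker_right[symmetric])
  have cancel0: "(\<theta>' \<otimes> Ide C Y) \<cdot> (\<theta> \<otimes> Ide C Y) = Ide C (A \<odot> X \<odot> Y)"
    "(\<theta> \<otimes> Ide C Y) \<cdot> (\<theta>' \<otimes> Ide C Y) = Ide C (bcar P \<odot> Y)"
    by (simp_all add: whisker_right[symmetric])
  have inv: "?\<theta>' \<cdot> ?\<theta> = Ide C (A \<odot> X \<odot> Y)" "?\<theta> \<cdot> ?\<theta>' = Ide C (bcar ?T)"
    by (simp_all add: assoc cancel cancel' cancel0)
  have \<theta>'_q: "?\<theta>' \<cdot> ?q = lift (X \<odot> Y) (\<psi> \<otimes> Ide C Y) \<cdot> (\<theta>' \<otimes> \<kappa>')"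
  proof -
    have "?\<theta>' \<cdot> ?q = (\<theta>' \<otimes> Ide C Y) \<cdot> (ract P \<otimes> Ide C Y) \<cdot> (Ide C (bcar P) \<otimes> \<kappa>')"
      by (simp add: assoc chartD(12)[OF c])
    also have "\<dots> = lift (X \<odot> Y) (\<psi> \<otimes> Ide C Y) \<cdot> (\<theta>' \<otimes> Ide C (A \<odot> Y)) \<cdot> (Ide C (bcar P) \<otimes> \<kappa>')"
      by (simp add: p(3) whisker_right assoc cancel lift_whisker_right)
    also have "\<dots> = lift (X \<odot> Y) (\<psi> \<otimes> Ide C Y) \<cdot> (\<theta>' \<otimes> \<kappa>')"
      by (simp add: interchange)
    finally show ?thesis .
  qed
  have q_eq: "?q = ?\<theta> \<cdot> lift (X \<odot> Y) (\<psi> \<otimes> Ide C Y) \<cdot> (\<theta>' \<otimes> \<kappa>')"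
  proof -
    have "?q = (?\<theta> \<cdot> ?\<theta>') \<cdot> ?q" unfolding inv by simp
    also have "\<dots> = ?\<theta> \<cdot> (?\<theta>' \<cdot> ?q)" by (rule assoc) auto
    finally show ?thesis unfolding \<theta>'_q .
  qed
  let ?l = "?\<theta> \<cdot> (m \<otimes> Ide C (X \<odot> Y)) \<cdot> (Ide C A \<otimes> ?\<theta>')"
  have "?l \<cdot> (Ide C A \<otimes> ?q) = ?\<theta> \<cdot> (m \<otimes> Ide C (X \<odot> Y)) \<cdot> (Ide C A \<otimes> (?\<theta>' \<cdot> ?q))"
    by (simp add: assoc whisker_left)
  also have "\<dots> = ?\<theta> \<cdot> ((m \<otimes> Ide C (X \<odot> Y)) \<cdot> (Ide C A \<otimes> lift (X \<odot> Y) (\<psi> \<otimes> Ide C Y))) \<cdot> (Ide C A \<otimes> \<theta>' \<otimes> \<kappa>')"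
    unfolding \<theta>'_q by (simp add: assoc whisker_left)
  also have "\<dots> = ?\<theta> \<cdot> lift (X \<odot> Y) (\<psi> \<otimes> Ide C Y) \<cdot> (m \<otimes> Ide C (X \<odot> A \<odot> Y)) \<cdot> (Ide C A \<otimes> \<theta>' \<otimes> \<kappa>')"
    by (simp add: lift_linear[symmetric] assoc)
  also have "(m \<otimes> Ide C (X \<odot> A \<odot> Y)) \<cdot> (Ide C A \<otimes> \<theta>' \<otimes> \<kappa>') = ((m \<otimes> Ide C X) \<cdot> (Ide C A \<otimes> \<theta>')) \<otimes> \<kappa>'"
    using interchange[of "Ide C A \<otimes> \<theta>'" \<kappa>' "m \<otimes> Ide C X" "Ide C (A \<odot> Y)"] by simp
  also have "\<dots> = (\<theta>' \<otimes> \<kappa>') \<cdot> (lact P \<otimes> Ide C (bcar Q))"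
    by (simp add: \<mu> interchange)
  also have "?\<theta> \<cdot> lift (X \<odot> Y) (\<psi> \<otimes> Ide C Y) \<cdot> (\<theta>' \<otimes> \<kappa>') \<cdot> (lact P \<otimes> Ide C (bcar Q))
      = (?\<theta> \<cdot> lift (X \<odot> Y) (\<psi> \<otimes> Ide C Y) \<cdot> (\<theta>' \<otimes> \<kappa>')) \<cdot> (lact P \<otimes> Ide C (bcar Q))"
    by (simp add: assoc)
  also have "\<dots> = ?q \<cdot> (lact P \<otimes> Ide C (bcar Q))" unfolding q_eq[symmetric] ..
  finally have l: "?l \<cdot> (Ide C A \<otimes> ?q) = ?q \<cdot> (lact P \<otimes> Ide C (bcar Q))" .
  have "induced C (Ide C A \<otimes> ?q) (?q \<cdot> (lact P \<otimes> Ide C (bcar Q))) = ?l"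
    using l by (rule B.induced_along_split_epi[of _ "Ide C A \<otimes> r", rotated 5]) (simp_all add: in_Hom r_left)
  then have lact: "lact ?T = ?l" unfolding bim_tensor_actions .
  let ?r = "?\<theta> \<cdot> lift (X \<odot> Y) ?\<psi> \<cdot> (?\<theta>' \<otimes> Ide C A)"
  \<comment> \<open>The right action of \<open>Y\<close>, moved past \<open>X\<close> by \<open>\<psi>\<close>, is the action belonging to the tensor product.\<close>
  have key: "lift (X \<odot> Y) ?\<psi> \<cdot> (lift (X \<odot> Y) (\<psi> \<otimes> Ide C Y) \<otimes> Ide C A)
      = lift (X \<odot> Y) (\<psi> \<otimes> Ide C Y) \<cdot> (Ide C (A \<odot> X) \<otimes> lift Y \<phi>)"
  proof -
    have "lift (X \<odot> Y) ?\<psi> \<cdot> (lift (X \<odot> Y) (\<psi> \<otimes> Ide C Y) \<otimes> Ide C A)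
        = lift (X \<odot> Y) ((\<psi> \<otimes> Ide C Y) \<cdot> (Ide C X \<otimes> lift Y \<phi>))"
      by (simp add: lift_whisker_right lift_lift em_distributes[OF p(1)])
    also have "\<dots> = lift (X \<odot> Y) (\<psi> \<otimes> Ide C Y) \<cdot> (Ide C A \<otimes> Ide C X \<otimes> lift Y \<phi>)"
      by (subst lift_Comp_whisker) auto
    finally show ?thesis by simp
  qed
  have "?r \<cdot> (?q \<otimes> Ide C A) = ?\<theta> \<cdot> lift (X \<odot> Y) ?\<psi> \<cdot> ((?\<theta>' \<cdot> ?q) \<otimes> Ide C A)"
    by (simp add: assoc whisker_right)
  also have "\<dots> = ?\<theta> \<cdot> (lift (X \<odot> Y) ?\<psi> \<cdot> (lift (X \<odot> Y) (\<psi> \<otimes> Ide C Y) \<otimes> Ide C A)) \<cdot> (\<theta>' \<otimes> \<kappa>' \<otimes> Ide C A)"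
    unfolding \<theta>'_q by (simp add: assoc whisker_right)
  also have "\<dots> = ?\<theta> \<cdot> lift (X \<odot> Y) (\<psi> \<otimes> Ide C Y) \<cdot> (Ide C (A \<odot> X) \<otimes> lift Y \<phi>) \<cdot> (\<theta>' \<otimes> \<kappa>' \<otimes> Ide C A)"
    unfolding key by (simp add: assoc)
  also have "(Ide C (A \<odot> X) \<otimes> lift Y \<phi>) \<cdot> (\<theta>' \<otimes> \<kappa>' \<otimes> Ide C A) = (\<theta>' \<otimes> \<kappa>') \<cdot> (Ide C (bcar P) \<otimes> ract Q)"
    by (simp add: interchange q(3))
  also have "?\<theta> \<cdot> lift (X \<odot> Y) (\<psi> \<otimes> Ide C Y) \<cdot> (\<theta>' \<otimes> \<kappa>') \<cdot> (Ide C (bcar P) \<otimes> ract Q)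
      = (?\<theta> \<cdot> lift (X \<odot> Y) (\<psi> \<otimes> Ide C Y) \<cdot> (\<theta>' \<otimes> \<kappa>')) \<cdot> (Ide C (bcar P) \<otimes> ract Q)"
    by (simp add: assoc)
  also have "\<dots> = ?q \<cdot> (Ide C (bcar P) \<otimes> ract Q)" unfolding q_eq[symmetric] ..
  finally have rq: "?r \<cdot> (?q \<otimes> Ide C A) = ?q \<cdot> (Ide C (bcar P) \<otimes> ract Q)" .
  have "induced C (?q \<otimes> Ide C A) (?q \<cdot> (Ide C (bcar P) \<otimes> ract Q)) = ?r"
    using rq by (rule B.induced_along_split_epi[of _ "r \<otimes> Ide C A", rotated 5]) (simp_all add: in_Hom r_right)
  then have ract: "ract ?T = ?r" unfolding bim_tensor_actions .
  show "ract ?T \<cdot> (?q \<otimes> Ide C A) = ?q \<cdot> (Ide C (bcar P) \<otimes> ract Q)"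
    unfolding ract by (rule rq)
  have "(X \<odot> Y, ?\<psi>) \<in> em_objects C A m e"
    using em_tensor_object[OF p(1) q(1)] by (simp add: em_tensor_def)
  then show "presented ?T (X \<odot> Y) ?\<psi> ?\<theta> ?\<theta>'"
    using inv lact ract by (simp add: presented_def frame_def in_Hom)
qed

text \<open>Both bracketings of the tensor product of \<open>P\<close>, \<open>Q\<close> and \<open>R\<close> are identified with \<open>P \<odot> W \<odot> V\<close>, and
  the two composites from \<open>P \<odot> Q \<odot> R\<close> coincide because the right action on the tensor product of \<open>P\<close>
  and \<open>Q\<close> comes from \<open>Q\<close>. So the constraint exists and is an identity in these charts.\<close>

lemma associator_in_charts:
  assumes P: "right_module C A m e (regular C) (bcar P) (ract P)"
    and Q: "right_module C A m e (regular C) (bcar Q) (ract Q)" "frame (bcar Q) (lact Q) W \<theta> \<theta>'"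
    and R: "frame (bcar R) (lact R) V \<kappa> \<kappa>'"
    and T: "right_module C A m e (regular C) (bcar (bim_tensor C A P Q)) (ract (bim_tensor C A P Q))"
      "ract (bim_tensor C A P Q) \<cdot> (bim_proj C P Q \<otimes> Ide C A) = bim_proj C P Q \<cdot> (Ide C (bcar P) \<otimes> ract Q)"
    and c: "chart P Q W \<theta>' c c'" and b: "chart Q R V \<kappa>' b b'"
    and d: "chart (bim_tensor C A P Q) R V \<kappa>' d d'"
    and S: "frame (bcar (bim_tensor C A Q R)) (lact (bim_tensor C A Q R)) (W \<odot> V) \<tau> ((\<theta>' \<otimes> Ide C V) \<cdot> b)"
    and h: "chart P (bim_tensor C A Q R) (W \<odot> V) ((\<theta>' \<otimes> Ide C V) \<cdot> b) h h'"
  defines "a \<equiv> induced C (bim_proj C (bim_tensor C A P Q) R \<cdot> (bim_proj C P Q \<otimes> Ide C (bcar R)))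
          (bim_proj C P (bim_tensor C A Q R) \<cdot> (Ide C (bcar P) \<otimes> bim_proj C Q R))"
  shows "a \<in> Hom C (bcar (bim_tensor C A (bim_tensor C A P Q) R)) (bcar (bim_tensor C A P (bim_tensor C A Q R)))"
    and "h \<cdot> a = (c \<otimes> Ide C V) \<cdot> d"
proof -
  let ?T = "bim_tensor C A P Q" and ?S = "bim_tensor C A Q R"
  let ?pq = "bim_proj C P Q" and ?qr = "bim_proj C Q R" and ?tr = "bim_proj C ?T R" and ?ps = "bim_proj C P ?S"
  note [simp] = right_moduleD[OF P] right_moduleD[OF Q(1)] right_moduleD[OF T(1)]
    frame_typing(1-11)[OF Q(2)] frame_typing(1-11)[OF R]
    chartD(1-11)[OF c] chartD(1-11)[OF b] chartD(1-11)[OF d] chartD(1-11)[OF h]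
  obtain r where r: "?pq \<in> Hom C (bcar P \<odot> bcar Q) (bcar ?T)"
    "r \<in> Hom C (bcar ?T) (bcar P \<odot> bcar Q)" "?pq \<cdot> r = Ide C (bcar ?T)" by (rule proj_split[OF P Q(2)])
  obtain s where s: "?tr \<in> Hom C (bcar ?T \<odot> bcar R) (bcar (bim_tensor C A ?T R))"
    "s \<in> Hom C (bcar (bim_tensor C A ?T R)) (bcar ?T \<odot> bcar R)" "?tr \<cdot> s = Ide C (bcar (bim_tensor C A ?T R))"
    by (rule proj_split[OF T(1) R])
  have u: "?qr \<in> Hom C (bcar Q \<odot> bcar R) (bcar ?S)" "?ps \<in> Hom C (bcar P \<odot> bcar ?S) (bcar (bim_tensor C A P ?S))"
    by (rule proj_split[OF Q(1) R], assumption) (rule proj_split[OF P S], assumption)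
  have [simp]: "?pq \<in> Arr C" "Dom C ?pq = bcar P \<odot> bcar Q" "Cod C ?pq = bcar ?T"
    "?tr \<in> Arr C" "Dom C ?tr = bcar ?T \<odot> bcar R" "Cod C ?tr = bcar (bim_tensor C A ?T R)"
    "?qr \<in> Arr C" "Dom C ?qr = bcar Q \<odot> bcar R" "Cod C ?qr = bcar ?S"
    "?ps \<in> Arr C" "Dom C ?ps = bcar P \<odot> bcar ?S" "Cod C ?ps = bcar (bim_tensor C A P ?S)"
    "r \<in> Arr C" "Dom C r = bcar ?T" "Cod C r = bcar P \<odot> bcar Q"
    "s \<in> Arr C" "Dom C s = bcar (bim_tensor C A ?T R)" "Cod C s = bcar ?T \<odot> bcar R"
    using r s u by (auto simp: in_Hom)
  let ?k = "(c \<otimes> Ide C V) \<cdot> d"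
  have "?k \<cdot> ?tr \<cdot> (?pq \<otimes> Ide C (bcar R))
      = (c \<otimes> Ide C V) \<cdot> (d \<cdot> ?tr) \<cdot> (?pq \<otimes> Ide C (bcar R))"
    by (simp add: assoc)
  also have "\<dots> = (c \<otimes> Ide C V) \<cdot> (ract ?T \<otimes> Ide C V) \<cdot> (Ide C (bcar ?T) \<otimes> \<kappa>') \<cdot> (?pq \<otimes> Ide C (bcar R))"
    unfolding chartD(12)[OF d] by (simp add: assoc)
  also have "\<dots> = (c \<otimes> Ide C V) \<cdot> ((ract ?T \<cdot> (?pq \<otimes> Ide C A)) \<otimes> Ide C V) \<cdot> (Ide C (bcar P \<odot> bcar Q) \<otimes> \<kappa>')"
    by (simp add: assoc slide whisker_right)
  also have "\<dots> = ((c \<cdot> ?pq) \<otimes> Ide C V) \<cdot> (Ide C (bcar P) \<otimes> ract Q \<otimes> Ide C V) \<cdot> (Ide C (bcar P \<odot> bcar Q) \<otimes> \<kappa>')"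
    unfolding T(2) by (simp add: assoc whisker_right)
  also have "\<dots> = (ract P \<otimes> Ide C (W \<odot> V)) \<cdot> (Ide C (bcar P) \<otimes> \<theta>' \<otimes> Ide C V) \<cdot>
      (Ide C (bcar P) \<otimes> ((ract Q \<otimes> Ide C V) \<cdot> (Ide C (bcar Q) \<otimes> \<kappa>')))"
    unfolding chartD(12)[OF c] by (simp add: assoc whisker_right whisker_left)
  also have "\<dots> = ((ract P \<otimes> Ide C (W \<odot> V)) \<cdot> (Ide C (bcar P) \<otimes> ((\<theta>' \<otimes> Ide C V) \<cdot> b))) \<cdot> (Ide C (bcar P) \<otimes> ?qr)"
    unfolding chartD(12)[OF b, symmetric] by (simp add: assoc whisker_left)
  also have "\<dots> = h \<cdot> ?ps \<cdot> (Ide C (bcar P) \<otimes> ?qr)"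
    unfolding chartD(12)[OF h, symmetric] by (simp add: assoc)
  finally have k: "?k \<cdot> ?tr \<cdot> (?pq \<otimes> Ide C (bcar R)) = h \<cdot> ?ps \<cdot> (Ide C (bcar P) \<otimes> ?qr)" .
  have "(h' \<cdot> ?k) \<cdot> ?tr \<cdot> (?pq \<otimes> Ide C (bcar R)) = h' \<cdot> (?k \<cdot> ?tr \<cdot> (?pq \<otimes> Ide C (bcar R)))"
    by (rule assoc) auto
  also have "\<dots> = ?ps \<cdot> (Ide C (bcar P) \<otimes> ?qr)"
    unfolding k by simp
  finally have k': "(h' \<cdot> ?k) \<cdot> ?tr \<cdot> (?pq \<otimes> Ide C (bcar R)) = ?ps \<cdot> (Ide C (bcar P) \<otimes> ?qr)" .
  \<comment> \<open>Both projections split, hence so does the composite along which the constraint is induced.\<close>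
  have "(?tr \<cdot> (?pq \<otimes> Ide C (bcar R))) \<cdot> (r \<otimes> Ide C (bcar R)) \<cdot> s
      = ?tr \<cdot> ((?pq \<cdot> r) \<otimes> Ide C (bcar R)) \<cdot> s"
    by (simp add: assoc whisker_right)
  also have "\<dots> = Ide C (bcar (bim_tensor C A ?T R))" by (simp add: r s)
  finally have "a = h' \<cdot> ?k"
    unfolding a_def using k'
    by (intro B.induced_along_split_epi[of _ "(r \<otimes> Ide C (bcar R)) \<cdot> s"]) (auto simp: in_Hom)
  then show "a \<in> Hom C (bcar (bim_tensor C A ?T R)) (bcar (bim_tensor C A P ?S))" "h \<cdot> a = (c \<otimes> Ide C V) \<cdot> d"
    by (auto simp: in_Hom)
qed

lemma tensor_arrow_Ide_right:
  assumes P: "right_module C A m e (regular C) (bcar P) (ract P)"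
    and P': "right_module C A m e (regular C) (bcar P') (ract P')"
    and Q: "frame (bcar Q) (lact Q) W \<theta> \<theta>'"
    and c: "chart P Q W \<theta>' c c'" and d: "chart P' Q W \<theta>' d d'"
    and f: "f \<in> Hom C (bcar P) (bcar P')" "f \<cdot> ract P = ract P' \<cdot> (f \<otimes> Ide C A)"
  shows "tensor_arrow P Q P' Q f (Ide C (bcar Q)) \<in> Hom C (bcar (bim_tensor C A P Q)) (bcar (bim_tensor C A P' Q))"
    and "d \<cdot> tensor_arrow P Q P' Q f (Ide C (bcar Q)) = (f \<otimes> Ide C W) \<cdot> c"
proof -
  note [simp] = right_moduleD[OF P] right_moduleD[OF P'] frame_typing(1-11)[OF Q] chartD(1-11)[OF c]
  have [simp]: "f \<in> Arr C" "Dom C f = bcar P" "Cod C f = bcar P'" using f by (auto simp: in_Hom)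
  have g: "Ide C (bcar Q) \<in> Hom C (bcar Q) (bcar Q)" "e \<otimes> Ide C W \<in> Hom C W (A \<odot> W)"
    "\<theta>' \<cdot> Ide C (bcar Q) = lift W (e \<otimes> Ide C W) \<cdot> \<theta>'"
    by (auto simp: in_Hom lift_of_unit)
  note * = tensor_arrow_in_charts[OF P P' Q Q c d f g]
  show "tensor_arrow P Q P' Q f (Ide C (bcar Q)) \<in> Hom C (bcar (bim_tensor C A P Q)) (bcar (bim_tensor C A P' Q))"
    by (rule *)
  have "(ract P' \<otimes> Ide C W) \<cdot> (Ide C (bcar P') \<otimes> e \<otimes> Ide C W) \<cdot> (f \<otimes> Ide C W) \<cdot> c
      = ((ract P' \<otimes> Ide C W) \<cdot> (Ide C (bcar P') \<otimes> e \<otimes> Ide C W)) \<cdot> (f \<otimes> Ide C W) \<cdot> c"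
    by (simp add: assoc)
  also have "\<dots> = (f \<otimes> Ide C W) \<cdot> c"
    using right_module_assoc_whiskered(2)[OF P', of W] by simp
  finally show "d \<cdot> tensor_arrow P Q P' Q f (Ide C (bcar Q)) = (f \<otimes> Ide C W) \<cdot> c"
    using *(2) by simp
qed

lemma tensor_arrow_Ide_left:
  assumes P: "right_module C A m e (regular C) (bcar P) (ract P)"
    and Q: "frame (bcar Q) (lact Q) W \<theta> \<theta>'" and Q': "frame (bcar Q') (lact Q') V \<kappa> \<kappa>'"
    and c: "chart P Q W \<theta>' c c'" and d: "chart P Q' V \<kappa>' d d'"
    and g: "g \<in> Hom C (bcar Q) (bcar Q')" and \<sigma>: "\<sigma> \<in> Hom C W (A \<odot> V)" "\<kappa>' \<cdot> g = lift V \<sigma> \<cdot> \<theta>'"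
  shows "tensor_arrow P Q P Q' (Ide C (bcar P)) g \<in> Hom C (bcar (bim_tensor C A P Q)) (bcar (bim_tensor C A P Q'))"
    and "d \<cdot> tensor_arrow P Q P Q' (Ide C (bcar P)) g = (ract P \<otimes> Ide C V) \<cdot> (Ide C (bcar P) \<otimes> \<sigma>) \<cdot> c"
proof -
  note [simp] = right_moduleD[OF P] frame_typing(1-11)[OF Q] chartD(1-11)[OF c]
  have f: "Ide C (bcar P) \<in> Hom C (bcar P) (bcar P)" "Ide C (bcar P) \<cdot> ract P = ract P \<cdot> (Ide C (bcar P) \<otimes> Ide C A)"
    by (auto simp: in_Hom)
  note * = tensor_arrow_in_charts[OF P P Q Q' c d f g \<sigma>]
  show "tensor_arrow P Q P Q' (Ide C (bcar P)) g \<in> Hom C (bcar (bim_tensor C A P Q)) (bcar (bim_tensor C A P Q'))"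
    "d \<cdot> tensor_arrow P Q P Q' (Ide C (bcar P)) g = (ract P \<otimes> Ide C V) \<cdot> (Ide C (bcar P) \<otimes> \<sigma>) \<cdot> c"
    using * by simp_all
qed

lemma chart_cancel:
  assumes "chart P Q W \<theta>' c c'" "x \<in> Arr C" "y \<in> Arr C" "Dom C x = bcar P \<odot> W" "Dom C y = bcar P \<odot> W"
  shows "x \<cdot> c = y \<cdot> c \<longleftrightarrow> x = y"
  using B.split_epi_cancel[of c c' x y] chartD(1-8)[OF assms(1)] assms(2-) by (auto simp: in_Hom)

end

section \<open>Rings and corings on a free module\<close>

text \<open>The bimodule \<open>P\<close> that belongs to \<open>(X, \<psi>)\<close>, with charts for all tensor products in the
  axioms: \<open>c\<close> for two factors \<open>P\<close>, with values in \<open>A \<odot> X \<odot> X\<close>; \<open>d\<close> and \<open>h\<close> for the two bracketings of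
  three factors; \<open>l\<close> and \<open>k\<close> for the products with the unit object. In \<open>h\<close> the chart \<open>c\<close> serves as the
  frame of the second factor.\<close>

locale charted_free_bimodule = coequalizer_algebra C A m e
  for C :: "('o, 'm) moncat" (structure) and A :: 'o and m e :: 'm +
  fixes X :: 'o and \<psi> c c' d d' h h' l l' k k' :: 'm
  assumes K: "(X, \<psi>) \<in> em_objects C A m e"
    and c: "chart (free_bimodule X \<psi>) (free_bimodule X \<psi>) X (Ide C (A \<odot> X)) c c'"
    and d: "chart (bim_tensor C A (free_bimodule X \<psi>) (free_bimodule X \<psi>)) (free_bimodule X \<psi>)
      X (Ide C (A \<odot> X)) d d'"
    and h: "chart (free_bimodule X \<psi>) (bim_tensor C A (free_bimodule X \<psi>) (free_bimodule X \<psi>))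
      (X \<odot> X) c h h'"
    and l: "chart (Bimod A m m) (free_bimodule X \<psi>) X (Ide C (A \<odot> X)) l l'"
    and k: "chart (free_bimodule X \<psi>) (Bimod A m m) \<one> (Ide C A) k k'"
begin

abbreviation "P \<equiv> free_bimodule X \<psi>"
abbreviation "T \<equiv> bim_tensor C A P P"
abbreviation "U \<equiv> Bimod A m m"
abbreviation "K1 \<equiv> (X, \<psi>)"
abbreviation "K2 \<equiv> em_tensor C K1 K1"
abbreviation "K0 \<equiv> (\<one>, Ide C A)"

lemma P_sel [simp]: "bcar P = A \<odot> X" "lact P = m \<otimes> Ide C X" "ract P = lift X \<psi>"
  by (simp_all add: free_bimodule_def)

lemmas K_typing [simp] = em_objectD(1-4)[OF K]

lemma K2_eq: "K2 = (X \<odot> X, (\<psi> \<otimes> Ide C X) \<cdot> (Ide C X \<otimes> \<psi>))"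
  by (simp add: em_tensor_def)

lemma chart_typing [simp]:
  "c \<in> Arr C" "Dom C c = bcar T" "Cod C c = A \<odot> X \<odot> X"
  "c' \<in> Arr C" "Dom C c' = A \<odot> X \<odot> X" "Cod C c' = bcar T" "bcar T \<in> Obj C"
  "d \<in> Arr C" "Dom C d = bcar (bim_tensor C A T P)" "Cod C d = bcar T \<odot> X"
  "h \<in> Arr C" "Dom C h = bcar (bim_tensor C A P T)" "Cod C h = A \<odot> X \<odot> X \<odot> X"
  "l \<in> Arr C" "Dom C l = bcar (bim_tensor C A U P)" "Cod C l = A \<odot> X"
  "k \<in> Arr C" "Dom C k = bcar (bim_tensor C A P U)" "Cod C k = A \<odot> X"
  using chartD(1-9)[OF c] chartD(1-3)[OF d] chartD(1-3)[OF h] chartD(1-3)[OF l] chartD(1-3)[OF k] by simp_all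

lemma c_inverse [simp]:
  "c' \<cdot> c = Ide C (bcar T)" "c \<cdot> c' = Ide C (A \<odot> X \<odot> X)"
  "f \<in> Arr C \<Longrightarrow> Cod C f = bcar T \<Longrightarrow> c' \<cdot> c \<cdot> f = f"
  "f \<in> Arr C \<Longrightarrow> Cod C f = A \<odot> X \<odot> X \<Longrightarrow> c \<cdot> c' \<cdot> f = f"
  using chartD(7-11)[OF c] by simp_all

lemma presented_P: "presented P X \<psi> (Ide C (A \<odot> X)) (Ide C (A \<odot> X))"
  by (rule free_bimodule_presented[OF K])

lemma presented_U: "presented U \<one> (Ide C A) (Ide C A) (Ide C A)"
  using free_bimodule_presented[OF em_unit_object] unfolding unit_bimodule_free[symmetric] by simp

lemma presented_T: "presented T (X \<odot> X) ((\<psi> \<otimes> Ide C X) \<cdot> (Ide C X \<otimes> \<psi>)) c' c"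
  using tensor_presented(1)[OF presented_P presented_P c] by simp

lemmas frames = presentedD(2)[OF presented_P] presentedD(2)[OF presented_T] presentedD(2)[OF presented_U]

lemma right_modules:
  "right_module C A m e (regular C) (bcar P) (ract P)"
  "right_module C A m e (regular C) (bcar T) (ract T)"
  "right_module C A m e (regular C) (bcar U) (ract U)"
  using presented_bimodule[OF presented_P] presented_bimodule[OF presented_T] presented_bimodule[OF presented_U]
  by (simp_all only: bimodule_def)

definition "associator = induced C (bim_proj C T P \<cdot> (bim_proj C P P \<otimes> Ide C (bcar P)))
          (bim_proj C P T \<cdot> (Ide C (bcar P) \<otimes> bim_proj C P P))"

lemma associator_in_free_charts:
  "associator \<in> Arr C" "Dom C associator = bcar (bim_tensor C A T P)" "Cod C associator = bcar (bim_tensor C A P T)" "h \<cdot> associator = (c \<otimes> Ide C X) \<cdot> d"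
proof -
  have cX: "(Ide C (A \<odot> X) \<otimes> Ide C X) \<cdot> c = c" by simp
  note * = associator_in_charts[OF right_modules(1) right_modules(1) frames(1) frames(1) right_modules(2)
      tensor_presented(2)[OF presented_P presented_P c] c c d, unfolded cX, OF frames(2) h, folded associator_def]
  show "associator \<in> Arr C" "Dom C associator = bcar (bim_tensor C A T P)" "Cod C associator = bcar (bim_tensor C A P T)" "h \<cdot> associator = (c \<otimes> Ide C X) \<cdot> d"
    using * by (auto simp: in_Hom)
qed

lemma left_unitor: "induced C (bim_proj C U P) (lact P) = l"
proof -
  obtain r where r: "bim_proj C U P \<in> Hom C (bcar U \<odot> bcar P) (bcar (bim_tensor C A U P))"
    "r \<in> Hom C (bcar (bim_tensor C A U P)) (bcar U \<odot> bcar P)"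
    "bim_proj C U P \<cdot> r = Ide C (bcar (bim_tensor C A U P))" by (rule proj_split[OF right_modules(3) frames(1)])
  have "l \<cdot> bim_proj C U P = lact P" using chartD(12)[OF l] by simp
  then show ?thesis using r by (intro B.induced_along_split_epi[of _ r]) (auto simp: in_Hom)
qed

lemma right_unitor: "induced C (bim_proj C P U) (ract P) = k"
proof -
  obtain r where r: "bim_proj C P U \<in> Hom C (bcar P \<odot> bcar U) (bcar (bim_tensor C A P U))"
    "r \<in> Hom C (bcar (bim_tensor C A P U)) (bcar P \<odot> bcar U)"
    "bim_proj C P U \<cdot> r = Ide C (bcar (bim_tensor C A P U))" by (rule proj_split[OF right_modules(1) frames(3)])
  have "k \<cdot> bim_proj C P U = ract P" using chartD(12)[OF k] by simp
  then show ?thesis using r by (intro B.induced_along_split_epi[of _ r]) (auto simp: in_Hom)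
qed

lemma free_act:
  assumes "\<sigma> \<in> Arr C" "Cod C \<sigma> = A \<odot> V" "V \<in> Obj C" "f \<in> Arr C" "Cod C f = A \<odot> X \<odot> Dom C \<sigma>"
  shows "(lift X \<psi> \<otimes> Ide C V) \<cdot> (Ide C (A \<odot> X) \<otimes> \<sigma>) \<cdot> f = lift (X \<odot> V) ((\<psi> \<otimes> Ide C V) \<cdot> (Ide C X \<otimes> \<sigma>)) \<cdot> f"
proof -
  have "(lift X \<psi> \<otimes> Ide C V) \<cdot> (Ide C (A \<odot> X) \<otimes> \<sigma>) = lift (X \<odot> V) (\<psi> \<otimes> Ide C V) \<cdot> (Ide C A \<otimes> Ide C X \<otimes> \<sigma>)"
    using assms by (simp add: lift_whisker_right)
  also have "\<dots> = lift (X \<odot> V) ((\<psi> \<otimes> Ide C V) \<cdot> (Ide C X \<otimes> \<sigma>))"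
    using assms by (subst lift_Comp_whisker) auto
  finally have eq: "(lift X \<psi> \<otimes> Ide C V) \<cdot> (Ide C (A \<odot> X) \<otimes> \<sigma>) = lift (X \<odot> V) ((\<psi> \<otimes> Ide C V) \<cdot> (Ide C X \<otimes> \<sigma>))" .
  have "(lift X \<psi> \<otimes> Ide C V) \<cdot> (Ide C (A \<odot> X) \<otimes> \<sigma>) \<cdot> f = ((lift X \<psi> \<otimes> Ide C V) \<cdot> (Ide C (A \<odot> X) \<otimes> \<sigma>)) \<cdot> f"
    using assms by (subst assoc) auto
  then show ?thesis unfolding eq .
qed

text \<open>Each side of an axiom is computed in charts and comes out as \<open>lift X _\<close> followed by one and
  the same isomorphism. Cancelling the isomorphism and the injective \<open>lift\<close> leaves the Kleisli
  equation.\<close>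

lemma algebra_equations:
  assumes \<sigma>: "em_arrow C A m K2 K1 \<sigma>" and u: "em_arrow C A m K0 K1 u"
  defines "f \<equiv> lift X \<sigma> \<cdot> c" and "g \<equiv> lift X u"
  shows "f \<cdot> tensor_arrow T P P P f (Ide C (A \<odot> X)) = f \<cdot> tensor_arrow P T P P (Ide C (A \<odot> X)) f \<cdot> associator
      \<longleftrightarrow> lift X \<sigma> \<cdot> (\<sigma> \<otimes> Ide C X) = lift X \<sigma> \<cdot> (\<psi> \<otimes> Ide C X) \<cdot> (Ide C X \<otimes> \<sigma>)"
    and "f \<cdot> tensor_arrow U P P P g (Ide C (A \<odot> X)) = l \<longleftrightarrow> lift X \<sigma> \<cdot> (u \<otimes> Ide C X) = e \<otimes> Ide C X"
    and "f \<cdot> tensor_arrow P U P P (Ide C (A \<odot> X)) g = k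
      \<longleftrightarrow> lift X \<sigma> \<cdot> (\<psi> \<otimes> Ide C X) \<cdot> (Ide C X \<otimes> u) = e \<otimes> Ide C X"
proof -
  have [simp]: "\<sigma> \<in> Arr C" "Dom C \<sigma> = X \<odot> X" "Cod C \<sigma> = A \<odot> X" "u \<in> Arr C" "Dom C u = \<one>" "Cod C u = A \<odot> X"
    using \<sigma> u by (auto simp: em_arrow_def em_tensor_def in_Hom)
  have f: "bim_arrow C A T P f"
    using presented_bim_arrow[OF presented_T presented_P \<sigma>[unfolded K2_eq]] by (simp add: f_def)
  have g: "bim_arrow C A U P g"
    using presented_bim_arrow[OF presented_U presented_P u] by (simp add: g_def)
  note f' = f[unfolded bim_arrow_def P_sel] and g' = g[unfolded bim_arrow_def P_sel]
  have \<sigma>H: "\<sigma> \<in> Hom C (X \<odot> X) (A \<odot> X)" and uH: "u \<in> Hom C \<one> (A \<odot> X)" by (auto simp: in_Hom)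
  let ?t1 = "tensor_arrow T P P P f (Ide C (A \<odot> X))" and ?t2 = "tensor_arrow P T P P (Ide C (A \<odot> X)) f"
    and ?t3 = "tensor_arrow U P P P g (Ide C (A \<odot> X))" and ?t4 = "tensor_arrow P U P P (Ide C (A \<odot> X)) g"
  have t1: "?t1 \<in> Hom C (bcar (bim_tensor C A T P)) (bcar T)" "c \<cdot> ?t1 = (f \<otimes> Ide C X) \<cdot> d"
    using f' tensor_arrow_Ide_right[OF right_modules(2) right_modules(1) frames(1) d c, unfolded P_sel] by blast+
  have t2: "?t2 \<in> Hom C (bcar (bim_tensor C A P T)) (bcar T)"
    "c \<cdot> ?t2 = (lift X \<psi> \<otimes> Ide C X) \<cdot> (Ide C (A \<odot> X) \<otimes> \<sigma>) \<cdot> h"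
    using f' tensor_arrow_Ide_left[OF right_modules(1) frames(2) frames(1) h c _ \<sigma>H, of f, unfolded P_sel] by (auto simp: f_def)
  have t3: "?t3 \<in> Hom C (bcar (bim_tensor C A U P)) (bcar T)" "c \<cdot> ?t3 = (g \<otimes> Ide C X) \<cdot> l"
    using g' tensor_arrow_Ide_right[OF right_modules(3) right_modules(1) frames(1) l c, unfolded P_sel] by blast+
  have t4: "?t4 \<in> Hom C (bcar (bim_tensor C A P U)) (bcar T)"
    "c \<cdot> ?t4 = (lift X \<psi> \<otimes> Ide C X) \<cdot> (Ide C (A \<odot> X) \<otimes> u) \<cdot> k"
    using g' tensor_arrow_Ide_left[OF right_modules(1) frames(3) frames(1) k c _ uH, of g, unfolded P_sel] by (auto simp: g_def)
  have [simp]: "?t1 \<in> Arr C" "Dom C ?t1 = bcar (bim_tensor C A T P)" "Cod C ?t1 = bcar T"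
    "?t2 \<in> Arr C" "Dom C ?t2 = bcar (bim_tensor C A P T)" "Cod C ?t2 = bcar T"
    "?t3 \<in> Arr C" "Dom C ?t3 = bcar (bim_tensor C A U P)" "Cod C ?t3 = bcar T"
    "?t4 \<in> Arr C" "Dom C ?t4 = bcar (bim_tensor C A P U)" "Cod C ?t4 = bcar T"
    using t1(1) t2(1) t3(1) t4(1) by (auto simp: in_Hom)
  note [simp] = associator_in_free_charts(1-3)
  have f_comp: "f \<cdot> t = lift X \<sigma> \<cdot> (c \<cdot> t)" if "t \<in> Arr C" "Cod C t = bcar T" for t
    using that by (simp add: f_def assoc)
  let ?n = "(c \<otimes> Ide C X) \<cdot> d"
  have 1: "f \<cdot> ?t1 = lift X (lift X \<sigma> \<cdot> (\<sigma> \<otimes> Ide C X)) \<cdot> (c \<otimes> Ide C X) \<cdot> d"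
  proof -
    have "f \<cdot> ?t1 = lift X \<sigma> \<cdot> (f \<otimes> Ide C X) \<cdot> d" by (simp add: f_comp t1(2))
    also have "\<dots> = (lift X \<sigma> \<cdot> lift (X \<odot> X) (\<sigma> \<otimes> Ide C X)) \<cdot> (c \<otimes> Ide C X) \<cdot> d"
      by (simp add: f_def whisker_right lift_whisker_right assoc)
    finally show ?thesis by (simp add: lift_lift)
  qed
  have 2: "f \<cdot> ?t2 \<cdot> associator = lift X (lift X \<sigma> \<cdot> (\<psi> \<otimes> Ide C X) \<cdot> (Ide C X \<otimes> \<sigma>)) \<cdot> (c \<otimes> Ide C X) \<cdot> d"
  proof -
    have "f \<cdot> ?t2 \<cdot> associator = lift X \<sigma> \<cdot> (c \<cdot> ?t2) \<cdot> associator" by (simp add: f_comp assoc)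
    also have "\<dots> = (lift X \<sigma> \<cdot> lift (X \<odot> X) ((\<psi> \<otimes> Ide C X) \<cdot> (Ide C X \<otimes> \<sigma>))) \<cdot> h \<cdot> associator"
      by (simp add: t2(2) free_act assoc)
    also have "\<dots> = lift X (lift X \<sigma> \<cdot> (\<psi> \<otimes> Ide C X) \<cdot> (Ide C X \<otimes> \<sigma>)) \<cdot> (c \<otimes> Ide C X) \<cdot> d"
      by (simp add: lift_lift associator_in_free_charts(4))
    finally show ?thesis .
  qed
  have cX: "x \<cdot> (c \<otimes> Ide C X) = y \<cdot> (c \<otimes> Ide C X) \<longleftrightarrow> x = y"
    if "x \<in> Arr C" "y \<in> Arr C" "Dom C x = A \<odot> X \<odot> X \<odot> X" "Dom C y = A \<odot> X \<odot> X \<odot> X" for x y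
    using B.split_epi_cancel[of "c \<otimes> Ide C X" "c' \<otimes> Ide C X" x y] that
    by (auto simp: in_Hom whisker_right[symmetric])
  have cancel: "x \<cdot> (c \<otimes> Ide C X) \<cdot> d = y \<cdot> (c \<otimes> Ide C X) \<cdot> d \<longleftrightarrow> x = y"
    if "x \<in> Arr C" "y \<in> Arr C" "Dom C x = A \<odot> X \<odot> X \<odot> X" "Dom C y = A \<odot> X \<odot> X \<odot> X" for x y
    using chart_cancel[OF d, of "x \<cdot> (c \<otimes> Ide C X)" "y \<cdot> (c \<otimes> Ide C X)"] cX[OF that] that
    by (simp add: assoc)
  show "f \<cdot> ?t1 = f \<cdot> ?t2 \<cdot> associator \<longleftrightarrow> lift X \<sigma> \<cdot> (\<sigma> \<otimes> Ide C X) = lift X \<sigma> \<cdot> (\<psi> \<otimes> Ide C X) \<cdot> (Ide C X \<otimes> \<sigma>)"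
    unfolding 1 2 by (subst cancel) (auto simp: lift_inject[where V = "X \<odot> X \<odot> X"] in_Hom)
  have 3: "f \<cdot> ?t3 = lift X (lift X \<sigma> \<cdot> (u \<otimes> Ide C X)) \<cdot> l"
  proof -
    have "f \<cdot> ?t3 = lift X \<sigma> \<cdot> (g \<otimes> Ide C X) \<cdot> l" by (simp add: f_comp t3(2))
    also have "\<dots> = (lift X \<sigma> \<cdot> lift (X \<odot> X) (u \<otimes> Ide C X)) \<cdot> l"
      by (simp add: g_def lift_whisker_right assoc)
    finally show ?thesis by (simp add: lift_lift)
  qed
  have "f \<cdot> ?t3 = l \<longleftrightarrow> lift X (lift X \<sigma> \<cdot> (u \<otimes> Ide C X)) \<cdot> l = lift X (e \<otimes> Ide C X) \<cdot> l"
    unfolding 3 by (simp add: lift_of_unit)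
  also have "\<dots> \<longleftrightarrow> lift X \<sigma> \<cdot> (u \<otimes> Ide C X) = e \<otimes> Ide C X"
    by (subst chart_cancel[OF l]) (auto simp: lift_inject[where V = X] in_Hom)
  finally show "f \<cdot> ?t3 = l \<longleftrightarrow> lift X \<sigma> \<cdot> (u \<otimes> Ide C X) = e \<otimes> Ide C X" .
  have 4: "f \<cdot> ?t4 = lift X (lift X \<sigma> \<cdot> (\<psi> \<otimes> Ide C X) \<cdot> (Ide C X \<otimes> u)) \<cdot> k"
  proof -
    have "f \<cdot> ?t4 = (lift X \<sigma> \<cdot> lift (X \<odot> X) ((\<psi> \<otimes> Ide C X) \<cdot> (Ide C X \<otimes> u))) \<cdot> k"
      by (simp add: f_comp t4(2) free_act assoc)
    then show ?thesis by (simp add: lift_lift)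
  qed
  have "f \<cdot> ?t4 = k \<longleftrightarrow> lift X (lift X \<sigma> \<cdot> (\<psi> \<otimes> Ide C X) \<cdot> (Ide C X \<otimes> u)) \<cdot> k = lift X (e \<otimes> Ide C X) \<cdot> k"
    unfolding 4 by (simp add: lift_of_unit)
  also have "\<dots> \<longleftrightarrow> lift X \<sigma> \<cdot> (\<psi> \<otimes> Ide C X) \<cdot> (Ide C X \<otimes> u) = e \<otimes> Ide C X"
    by (subst chart_cancel[OF k]) (auto simp: lift_inject[where V = X] in_Hom)
  finally show "f \<cdot> ?t4 = k \<longleftrightarrow> lift X \<sigma> \<cdot> (\<psi> \<otimes> Ide C X) \<cdot> (Ide C X \<otimes> u) = e \<otimes> Ide C X" .
qed

text \<open>Dual to the above: here the charts are composed on the left, and the domain \<open>A \<odot> X\<close> needs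
  no chart.\<close>

lemma coalgebra_equations:
  assumes \<rho>: "em_arrow C A m K1 K2 \<rho>" and \<omega>: "em_arrow C A m K1 K0 \<omega>"
  defines "f \<equiv> c' \<cdot> lift (X \<odot> X) \<rho>" and "g \<equiv> lift \<one> \<omega>"
  shows "associator \<cdot> tensor_arrow P P T P f (Ide C (A \<odot> X)) \<cdot> f = tensor_arrow P P P T (Ide C (A \<odot> X)) f \<cdot> f
      \<longleftrightarrow> lift (X \<odot> X \<odot> X) (\<rho> \<otimes> Ide C X) \<cdot> \<rho> = lift (X \<odot> X \<odot> X) ((\<psi> \<otimes> Ide C (X \<odot> X)) \<cdot> (Ide C X \<otimes> \<rho>)) \<cdot> \<rho>"
    and "l \<cdot> tensor_arrow P P U P g (Ide C (A \<odot> X)) \<cdot> f = Ide C (A \<odot> X)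
      \<longleftrightarrow> lift X (\<omega> \<otimes> Ide C X) \<cdot> \<rho> = e \<otimes> Ide C X"
    and "k \<cdot> tensor_arrow P P P U (Ide C (A \<odot> X)) g \<cdot> f = Ide C (A \<odot> X)
      \<longleftrightarrow> lift X (\<psi> \<cdot> (Ide C X \<otimes> \<omega>)) \<cdot> \<rho> = e \<otimes> Ide C X"
proof -
  have [simp]: "\<rho> \<in> Arr C" "Dom C \<rho> = X" "Cod C \<rho> = A \<odot> X \<odot> X" "\<omega> \<in> Arr C" "Dom C \<omega> = X" "Cod C \<omega> = A"
    using \<rho> \<omega> by (auto simp: em_arrow_def em_tensor_def in_Hom)
  have f: "bim_arrow C A P T f"
    using presented_bim_arrow[OF presented_P presented_T \<rho>[unfolded K2_eq]] by (simp add: f_def)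
  have g: "bim_arrow C A P U g"
    using presented_bim_arrow[OF presented_P presented_U \<omega>] by (simp add: g_def)
  note f' = f[unfolded bim_arrow_def P_sel] and g' = g[unfolded bim_arrow_def P_sel]
  have \<rho>H: "\<rho> \<in> Hom C X (A \<odot> X \<odot> X)" and \<omega>H: "\<omega> \<in> Hom C X (A \<odot> \<one>)" by (auto simp: in_Hom)
  let ?t1 = "tensor_arrow P P T P f (Ide C (A \<odot> X))" and ?t2 = "tensor_arrow P P P T (Ide C (A \<odot> X)) f"
    and ?t3 = "tensor_arrow P P U P g (Ide C (A \<odot> X))" and ?t4 = "tensor_arrow P P P U (Ide C (A \<odot> X)) g"
  have t1: "?t1 \<in> Hom C (bcar T) (bcar (bim_tensor C A T P))" "d \<cdot> ?t1 = (f \<otimes> Ide C X) \<cdot> c"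
    using f' tensor_arrow_Ide_right[OF right_modules(1) right_modules(2) frames(1) c d, unfolded P_sel] by blast+
  have t2: "?t2 \<in> Hom C (bcar T) (bcar (bim_tensor C A P T))"
    "h \<cdot> ?t2 = (lift X \<psi> \<otimes> Ide C (X \<odot> X)) \<cdot> (Ide C (A \<odot> X) \<otimes> \<rho>) \<cdot> c"
    using f' tensor_arrow_Ide_left[OF right_modules(1) frames(1) frames(2) c h _ \<rho>H, of f, unfolded P_sel] by (auto simp: f_def)
  have t3: "?t3 \<in> Hom C (bcar T) (bcar (bim_tensor C A U P))" "l \<cdot> ?t3 = (g \<otimes> Ide C X) \<cdot> c"
    using g' tensor_arrow_Ide_right[OF right_modules(1) right_modules(3) frames(1) c l, unfolded P_sel] by blast+
  have t4: "?t4 \<in> Hom C (bcar T) (bcar (bim_tensor C A P U))"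
    "k \<cdot> ?t4 = (lift X \<psi> \<otimes> Ide C \<one>) \<cdot> (Ide C (A \<odot> X) \<otimes> \<omega>) \<cdot> c"
    using g' tensor_arrow_Ide_left[OF right_modules(1) frames(1) frames(3) c k _ \<omega>H, of g, unfolded P_sel] by (auto simp: g_def)
  have [simp]: "?t1 \<in> Arr C" "Dom C ?t1 = bcar T" "Cod C ?t1 = bcar (bim_tensor C A T P)"
    "?t2 \<in> Arr C" "Dom C ?t2 = bcar T" "Cod C ?t2 = bcar (bim_tensor C A P T)"
    "?t3 \<in> Arr C" "Dom C ?t3 = bcar T" "Cod C ?t3 = bcar (bim_tensor C A U P)"
    "?t4 \<in> Arr C" "Dom C ?t4 = bcar T" "Cod C ?t4 = bcar (bim_tensor C A P U)"
    using t1(1) t2(1) t3(1) t4(1) by (auto simp: in_Hom)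
  note [simp] = associator_in_free_charts(1-3)
  have [simp]: "f \<in> Arr C" "Dom C f = A \<odot> X" "Cod C f = bcar T" by (auto simp: f_def)
  have cf: "c \<cdot> f = lift (X \<odot> X) \<rho>" by (simp add: f_def)
  have 1: "h \<cdot> associator \<cdot> ?t1 \<cdot> f = lift (X \<odot> X \<odot> X) (lift (X \<odot> X \<odot> X) (\<rho> \<otimes> Ide C X) \<cdot> \<rho>)"
  proof -
    have "h \<cdot> associator \<cdot> ?t1 \<cdot> f = (h \<cdot> associator) \<cdot> ?t1 \<cdot> f" by (simp add: assoc)
    also have "\<dots> = (c \<otimes> Ide C X) \<cdot> (d \<cdot> ?t1) \<cdot> f" unfolding associator_in_free_charts(4) by (simp add: assoc)
    also have "\<dots> = ((c \<cdot> f) \<otimes> Ide C X) \<cdot> (c \<cdot> f)" unfolding t1(2) by (simp add: assoc whisker_right)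
    also have "\<dots> = lift (X \<odot> X \<odot> X) (lift (X \<odot> X \<odot> X) (\<rho> \<otimes> Ide C X) \<cdot> \<rho>)"
      unfolding cf by (simp add: lift_whisker_right lift_lift)
    finally show ?thesis .
  qed
  have 2: "h \<cdot> ?t2 \<cdot> f
      = lift (X \<odot> X \<odot> X) (lift (X \<odot> X \<odot> X) ((\<psi> \<otimes> Ide C (X \<odot> X)) \<cdot> (Ide C X \<otimes> \<rho>)) \<cdot> \<rho>)"
  proof -
    have "h \<cdot> ?t2 \<cdot> f = (h \<cdot> ?t2) \<cdot> f" by (simp add: assoc)
    also have "\<dots> = lift (X \<odot> X \<odot> X) ((\<psi> \<otimes> Ide C (X \<odot> X)) \<cdot> (Ide C X \<otimes> \<rho>)) \<cdot> (c \<cdot> f)"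
      unfolding t2(2) by (simp add: free_act assoc)
    finally show ?thesis unfolding cf by (simp add: lift_lift)
  qed
  have "associator \<cdot> ?t1 \<cdot> f = ?t2 \<cdot> f \<longleftrightarrow> h \<cdot> associator \<cdot> ?t1 \<cdot> f = h \<cdot> ?t2 \<cdot> f"
  proof
    assume eq: "h \<cdot> associator \<cdot> ?t1 \<cdot> f = h \<cdot> ?t2 \<cdot> f"
    have "associator \<cdot> ?t1 \<cdot> f = h' \<cdot> h \<cdot> associator \<cdot> ?t1 \<cdot> f" by (rule chartD(10)[OF h, symmetric]) auto
    also have "\<dots> = ?t2 \<cdot> f" unfolding eq by (rule chartD(10)[OF h]) auto
    finally show "associator \<cdot> ?t1 \<cdot> f = ?t2 \<cdot> f" .
  qed simp
  also have "\<dots> \<longleftrightarrow> lift (X \<odot> X \<odot> X) (\<rho> \<otimes> Ide C X) \<cdot> \<rho>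
      = lift (X \<odot> X \<odot> X) ((\<psi> \<otimes> Ide C (X \<odot> X)) \<cdot> (Ide C X \<otimes> \<rho>)) \<cdot> \<rho>"
    unfolding 1 2 by (rule lift_inject[where V = X]) (auto simp: in_Hom)
  finally show "associator \<cdot> ?t1 \<cdot> f = ?t2 \<cdot> f \<longleftrightarrow> lift (X \<odot> X \<odot> X) (\<rho> \<otimes> Ide C X) \<cdot> \<rho>
      = lift (X \<odot> X \<odot> X) ((\<psi> \<otimes> Ide C (X \<odot> X)) \<cdot> (Ide C X \<otimes> \<rho>)) \<cdot> \<rho>" .
  have Ide_lift: "Ide C (A \<odot> X) = lift X (e \<otimes> Ide C X)" by (simp add: lift_of_unit)
  have "l \<cdot> ?t3 \<cdot> f = (l \<cdot> ?t3) \<cdot> f" by (simp add: assoc)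
  also have "\<dots> = (g \<otimes> Ide C X) \<cdot> (c \<cdot> f)" unfolding t3(2) by (simp add: assoc g_def)
  also have "\<dots> = lift X (lift X (\<omega> \<otimes> Ide C X) \<cdot> \<rho>)"
    unfolding cf g_def by (simp add: lift_whisker_right lift_lift)
  finally have 3: "l \<cdot> ?t3 \<cdot> f = lift X (lift X (\<omega> \<otimes> Ide C X) \<cdot> \<rho>)" .
  show "l \<cdot> ?t3 \<cdot> f = Ide C (A \<odot> X) \<longleftrightarrow> lift X (\<omega> \<otimes> Ide C X) \<cdot> \<rho> = e \<otimes> Ide C X"
    unfolding 3 unfolding Ide_lift by (rule lift_inject[where V = X]) (auto simp: in_Hom)
  have "k \<cdot> ?t4 \<cdot> f = (k \<cdot> ?t4) \<cdot> f" by (simp add: assoc)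
  also have "\<dots> = lift X (\<psi> \<cdot> (Ide C X \<otimes> \<omega>)) \<cdot> (c \<cdot> f)"
    unfolding t4(2) using free_act[of \<omega> \<one> c] by (simp add: assoc)
  also have "\<dots> = lift X (lift X (\<psi> \<cdot> (Ide C X \<otimes> \<omega>)) \<cdot> \<rho>)"
    unfolding cf by (simp add: lift_lift)
  finally have 4: "k \<cdot> ?t4 \<cdot> f = lift X (lift X (\<psi> \<cdot> (Ide C X \<otimes> \<omega>)) \<cdot> \<rho>)" .
  show "k \<cdot> ?t4 \<cdot> f = Ide C (A \<odot> X) \<longleftrightarrow> lift X (\<psi> \<cdot> (Ide C X \<otimes> \<omega>)) \<cdot> \<rho> = e \<otimes> Ide C X"
    unfolding 4 unfolding Ide_lift by (rule lift_inject[where V = X]) (auto simp: in_Hom)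
qed

end

context coequalizer_algebra
begin

lemma charts_exist:
  assumes K: "(X, \<psi>) \<in> em_objects C A m e"
  obtains c c' d d' h h' l l' k k' where "charted_free_bimodule C A m e X \<psi> c c' d d' h h' l l' k k'"
proof -
  let ?P = "free_bimodule X \<psi>"
  note P = free_bimodule_presented[OF K]
  have U: "presented (Bimod A m m) \<one> (Ide C A) (Ide C A) (Ide C A)"
    using free_bimodule_presented[OF em_unit_object] unfolding unit_bimodule_free[symmetric] by simp
  have right: "right_module C A m e (regular C) (bcar Q) (ract Q)" if "presented Q Y \<phi> \<theta> \<theta>'" for Q Y \<phi> \<theta> \<theta>'
    using presented_bimodule[OF that] by (simp add: bimodule_def)
  note F = presentedD(2)[OF P] and R = right[OF P]
  obtain c c' where c: "chart ?P ?P X (Ide C (A \<odot> X)) c c'" by (rule chart_exists[OF R F])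
  note T = tensor_presented(1)[OF P P c]
  have "(Ide C (A \<odot> X) \<otimes> Ide C X) \<cdot> c = c"
    using chartD(1-3)[OF c] em_objectD(1)[OF K] by (simp add: free_bimodule_def)
  note FT = presentedD(2)[OF T, unfolded this]
  obtain d d' where d: "chart (bim_tensor C A ?P ?P) ?P X (Ide C (A \<odot> X)) d d'"
    by (rule chart_exists[OF right[OF T] F])
  obtain h h' where h: "chart ?P (bim_tensor C A ?P ?P) (X \<odot> X) c h h'" by (rule chart_exists[OF R FT])
  obtain l l' where l: "chart (Bimod A m m) ?P X (Ide C (A \<odot> X)) l l'" by (rule chart_exists[OF right[OF U] F])
  obtain k k' where k: "chart ?P (Bimod A m m) \<one> (Ide C A) k k'" by (rule chart_exists[OF R presentedD(2)[OF U]])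
  have "charted_free_bimodule C A m e X \<psi> c c' d d' h h' l l' k k'"
    by unfold_locales (fact K c d h l k)+
  then show ?thesis by (rule that)
qed

end

lemma bim_cat_arrow:
  "f \<in> Hom (bim_cat C D A m e) P Q \<longleftrightarrow> P \<in> bim_objects C D A m e \<and> Q \<in> bim_objects C D A m e \<and>
    (\<exists>\<phi>. f = SArr P Q \<phi> \<and> bim_arrow C A P Q \<phi>)"
  by (cases f) (auto simp: in_Hom bim_cat_def)

locale flat_algebra = coequalizer_algebra C A m e + algebra_right_category C A m e D
  for C :: "('o, 'm) moncat" and A :: 'o and m e :: 'm and D :: "('p, 'q, 'o, 'm) actcat" +
  assumes D_has_coeq: "has_coequalizers D"
    and A_flat: "coflat C (regular C) A" "coflat C D A"
begin

text \<open>Coflatness of \<open>A\<close> and \<open>X\<close> passes to \<open>A \<odot> X\<close> and along the frame; robustness comes with the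
  frame.\<close>

lemma presented_bim_object:
  assumes P: "presented P X \<psi> \<theta> \<theta>'" and X: "coflat C (regular C) X" "coflat C D X"
  shows "P \<in> bim_objects C D A m e"
proof -
  interpret regular: algebra_right_category C A m e "regular C"
    by (intro algebra_right_category.intro right_category_regular algebra_in_axioms)
  note F = presentedD(2)[OF P]
  note \<theta> = frame_typing(1-8,12,13)[OF F]
  have \<theta>H: "\<theta> \<in> Hom C (A \<odot>\<^bsub>C\<^esub> X) (bcar P)" "\<theta>' \<in> Hom C (bcar P) (A \<odot>\<^bsub>C\<^esub> X)"
    using \<theta> by (auto simp: in_Hom)
  have "coflat C (regular C) (bcar P)" "coflat C D (bcar P)"
    using regular.R.coflat_iso[OF regular.R.coflat_TensO[OF A_flat(1) X(1) A_Obj \<theta>(1)] \<theta>H \<theta>(9,10)]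
      R.coflat_iso[OF R.coflat_TensO[OF A_flat(2) X(2) A_Obj \<theta>(1)] \<theta>H \<theta>(9,10)] .
  moreover have "robust C A m e (regular C) (bcar P) (lact P)" "robust C A m e D (bcar P) (lact P)"
    using regular.robust_of_frame[OF has_coeq _ F] robust_of_frame[OF has_coeq D_has_coeq F] has_coeq by simp_all
  ultimately show ?thesis
    using presented_bimodule[OF P] by (simp add: bim_objects_def)
qed

text \<open>The correspondences of structure maps, \<open>\<sigma> \<mapsto> lift X \<sigma> \<cdot> c\<close> and \<open>\<rho> \<mapsto> c' \<cdot> lift (X \<odot> X) \<rho>\<close>, are
  bijective and translate the axioms into each other.\<close>

lemma ring_coring_iff:
  assumes K: "(X, \<psi>) \<in> em_objects C A m e" and X: "coflat C (regular C) X" "coflat C D X"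
  shows "(\<exists>f g. algebra (bim_cat C D A m e) (free_bimodule X \<psi>) f g) \<longleftrightarrow> (\<exists>\<sigma> u. algebra EM (X, \<psi>) \<sigma> u)"
    and "(\<exists>f g. coalgebra (bim_cat C D A m e) (free_bimodule X \<psi>) f g) \<longleftrightarrow> (\<exists>\<sigma> u. coalgebra EM (X, \<psi>) \<sigma> u)"
proof -
  obtain c c' d d' h h' l l' k k' where "charted_free_bimodule C A m e X \<psi> c c' d d' h h' l l' k k'"
    by (rule charts_exist[OF K])
  then interpret charted_free_bimodule C A m e X \<psi> c c' d d' h h' l l' k k' .
  interpret regular: algebra_right_category C A m e "regular C"
    by (intro algebra_right_category.intro right_category_regular algebra_in_axioms)
  let ?B = "bim_cat C D A m e"
  have XX: "coflat C (regular C) (X \<odot>\<^bsub>C\<^esub> X)" "coflat C D (X \<odot>\<^bsub>C\<^esub> X)"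
    using regular.R.coflat_TensO R.coflat_TensO X by auto
  have obj: "P \<in> bim_objects C D A m e" "T \<in> bim_objects C D A m e" "U \<in> bim_objects C D A m e"
    using presented_bim_object[OF presented_P X] presented_bim_object[OF presented_T XX]
      presented_bim_object[OF presented_U regular.R.coflat_Unit R.coflat_Unit] .
  have alg: "algebra ?B P (SArr T P (lift X \<sigma> \<cdot>\<^bsub>C\<^esub> c)) (SArr U P (lift X u))
      \<longleftrightarrow> algebra EM K1 (SArr K2 K1 \<sigma>) (SArr K0 K1 u)"
    if \<sigma>: "em_arrow C A m K2 K1 \<sigma>" and u: "em_arrow C A m K0 K1 u" for \<sigma> u
  proof -
    have "bim_arrow C A T P (lift X \<sigma> \<cdot>\<^bsub>C\<^esub> c)" "bim_arrow C A U P (lift X u)"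
      using presented_bim_arrow[OF presented_T presented_P \<sigma>[unfolded K2_eq]]
        presented_bim_arrow[OF presented_U presented_P u] \<sigma> u
      by (auto simp: em_arrow_def em_tensor_def in_Hom)
    then show ?thesis
      unfolding EM_algebra_iff[OF K \<sigma> u] algebra_equations[OF \<sigma> u, symmetric]
      using obj left_unitor right_unitor
      by (simp add: algebra_def bim_cat_arrow) (simp add: bim_cat_def tensor_arrow_def associator_def)
  qed
  have coalg: "coalgebra ?B P (SArr P T (c' \<cdot>\<^bsub>C\<^esub> lift (X \<odot>\<^bsub>C\<^esub> X) \<rho>)) (SArr P U (lift \<one>\<^bsub>C\<^esub> \<omega>))
      \<longleftrightarrow> coalgebra EM K1 (SArr K1 K2 \<rho>) (SArr K1 K0 \<omega>)"
    if \<rho>: "em_arrow C A m K1 K2 \<rho>" and \<omega>: "em_arrow C A m K1 K0 \<omega>" for \<rho> \<omega>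
  proof -
    have "bim_arrow C A P T (c' \<cdot>\<^bsub>C\<^esub> lift (X \<odot>\<^bsub>C\<^esub> X) \<rho>)" "bim_arrow C A P U (lift \<one>\<^bsub>C\<^esub> \<omega>)"
      using presented_bim_arrow[OF presented_P presented_T \<rho>[unfolded K2_eq]]
        presented_bim_arrow[OF presented_P presented_U \<omega>] \<rho> \<omega>
      by (auto simp: em_arrow_def em_tensor_def in_Hom)
    then show ?thesis
      unfolding EM_coalgebra_iff[OF K \<rho> \<omega>] coalgebra_equations[OF \<rho> \<omega>, symmetric]
      using obj left_unitor right_unitor
      by (simp add: coalgebra_def bim_cat_arrow) (simp add: bim_cat_def tensor_arrow_def associator_def)
  qed
  show "(\<exists>f g. algebra ?B P f g) \<longleftrightarrow> (\<exists>\<sigma> u. algebra EM K1 \<sigma> u)"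
  proof
    assume "\<exists>f g. algebra ?B P f g"
    then obtain f g where fg: "algebra ?B P f g" by blast
    then have "f \<in> Hom ?B T P" "g \<in> Hom ?B U P" by (auto simp: algebra_def bim_cat_def)
    then obtain f' g' where f: "f = SArr T P f'" "bim_arrow C A T P f'" and g: "g = SArr U P g'" "bim_arrow C A U P g'"
      by (auto simp: bim_cat_arrow)
    obtain \<sigma> where \<sigma>: "em_arrow C A m K2 K1 \<sigma>" "f' = lift X \<sigma> \<cdot>\<^bsub>C\<^esub> c"
      by (rule presented_bim_arrow_exists[OF presented_T presented_P f(2), folded K2_eq])
        (auto simp: em_arrow_def em_tensor_def in_Hom)
    obtain u where u: "em_arrow C A m K0 K1 u" "g' = lift X u"
      by (rule presented_bim_arrow_exists[OF presented_U presented_P g(2)])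
        (auto simp: em_arrow_def in_Hom)
    show "\<exists>\<sigma> u. algebra EM K1 \<sigma> u"
      using fg alg[OF \<sigma>(1) u(1)] unfolding f g \<sigma>(2) u(2) by blast
  next
    assume "\<exists>\<sigma> u. algebra EM K1 \<sigma> u"
    then obtain f g where fg: "algebra EM K1 f g" by blast
    then have "f \<in> Hom EM K2 K1" "g \<in> Hom EM K0 K1" by (auto simp: algebra_def EM_simps)
    then obtain \<sigma> u where "f = SArr K2 K1 \<sigma>" "em_arrow C A m K2 K1 \<sigma>" "g = SArr K0 K1 u" "em_arrow C A m K0 K1 u"
      by (auto simp only: EM_arrow)
    with fg alg show "\<exists>f g. algebra ?B P f g" by blast
  qed
  show "(\<exists>f g. coalgebra ?B P f g) \<longleftrightarrow> (\<exists>\<sigma> u. coalgebra EM K1 \<sigma> u)"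
  proof
    assume "\<exists>f g. coalgebra ?B P f g"
    then obtain f g where fg: "coalgebra ?B P f g" by blast
    then have "f \<in> Hom ?B P T" "g \<in> Hom ?B P U" by (auto simp: coalgebra_def bim_cat_def)
    then obtain f' g' where f: "f = SArr P T f'" "bim_arrow C A P T f'" and g: "g = SArr P U g'" "bim_arrow C A P U g'"
      by (auto simp: bim_cat_arrow)
    obtain \<rho> where \<rho>: "em_arrow C A m K1 K2 \<rho>" "f' = c' \<cdot>\<^bsub>C\<^esub> lift (X \<odot>\<^bsub>C\<^esub> X) \<rho>"
      by (rule presented_bim_arrow_exists[OF presented_P presented_T f(2), folded K2_eq])
        (auto simp: em_arrow_def em_tensor_def in_Hom)
    obtain \<omega> where \<omega>: "em_arrow C A m K1 K0 \<omega>" "g' = lift \<one>\<^bsub>C\<^esub> \<omega>"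
      by (rule presented_bim_arrow_exists[OF presented_P presented_U g(2)])
        (auto simp: em_arrow_def in_Hom)
    show "\<exists>\<sigma> u. coalgebra EM K1 \<sigma> u"
      using fg coalg[OF \<rho>(1) \<omega>(1)] unfolding f g \<rho>(2) \<omega>(2) by blast
  next
    assume "\<exists>\<sigma> u. coalgebra EM K1 \<sigma> u"
    then obtain f g where fg: "coalgebra EM K1 f g" by blast
    then have "f \<in> Hom EM K1 K2" "g \<in> Hom EM K1 K0" by (auto simp: coalgebra_def EM_simps)
    then obtain \<rho> \<omega> where "f = SArr K1 K2 \<rho>" "em_arrow C A m K1 K2 \<rho>" "g = SArr K1 K0 \<omega>" "em_arrow C A m K1 K0 \<omega>"
      by (auto simp only: EM_arrow)
    with fg coalg show "\<exists>f g. coalgebra ?B P f g" by blast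
  qed
qed

end

theorem theorem3p3:
  fixes C :: "('o, 'm) moncat" and D :: "('p, 'q, 'o, 'm) actcat"
    and A X :: 'o and mA eA :: 'm
  assumes "strict_monoidal_category C" and "has_coequalizers C"
    and "algebra C A mA eA"
    and "right_category C D" and "has_coequalizers D"
    and "X \<in> Obj C"
    and "coflat C D A" and "coflat C D X"
    and "coflat C (regular C) A" and "coflat C (regular C) X"
  shows "((\<exists>\<nu> m e. compatible_ring C D A mA eA
            (Bimod (A \<odot>\<^bsub>C\<^esub> X) (mA \<otimes>\<^bsub>C\<^esub> Ide C X) \<nu>) m e)
          \<longleftrightarrow> (\<exists>\<psi> m e. algebra (EM_cat C A mA eA) (X, \<psi>) m e))
       \<and> ((\<exists>\<nu> \<Delta> \<epsilon>. compatible_coring C D A mA eA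
            (Bimod (A \<odot>\<^bsub>C\<^esub> X) (mA \<otimes>\<^bsub>C\<^esub> Ide C X) \<nu>) \<Delta> \<epsilon>)
          \<longleftrightarrow> (\<exists>\<psi> \<Delta> \<epsilon>. coalgebra (EM_cat C A mA eA) (X, \<psi>) \<Delta> \<epsilon>))"
proof -
  interpret strict_monoidal_category C by (rule assms)
  interpret right_category C D by (rule assms)
  interpret flat_algebra C A mA eA D
    by unfold_locales (use assms in auto)
  note iff = ring_coring_iff[OF _ assms(10,8)]
  let ?B = "bim_cat C D A mA eA" and ?P = "Bimod (A \<odot>\<^bsub>C\<^esub> X) (mA \<otimes>\<^bsub>C\<^esub> Ide C X)"
  have free: "\<exists>\<psi>. (X, \<psi>) \<in> em_objects C A mA eA \<and> ?P \<nu> = free_bimodule X \<psi>" if "?P \<nu> \<in> Obj ?B" for \<nu>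
  proof -
    have "bimodule C A mA eA (?P \<nu>)" using that by (simp add: bim_cat_def bim_objects_def)
    then show ?thesis using bimodule_is_free[OF _ assms(6), of \<nu>] by (metis free_bimodule_def)
  qed
  have obj: "?P \<nu> \<in> Obj ?B" if "algebra ?B (?P \<nu>) f g \<or> coalgebra ?B (?P \<nu>) f g" for \<nu> f g
    using that by (auto simp: algebra_def coalgebra_def)
  have obj': "(X, \<psi>) \<in> em_objects C A mA eA" if "algebra EM (X, \<psi>) f g \<or> coalgebra EM (X, \<psi>) f g" for \<psi> f g
    using that by (auto simp: algebra_def coalgebra_def EM_simps)
  show ?thesis
    unfolding compatible_ring_def compatible_coring_def
    using free obj obj' iff by (metis free_bimodule_def)
qed

end
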